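(* Let $F=\{\sigma_1,\dots,\sigma_n\}\subset\partial\mathbb{D}$ consist of pairwise distinct points, let $\Lambda=(\lambda_1,\dots,\lambda_n)\in(-\infty,0)^n$, and let $\tau\in\overline{\mathbb{D}}\setminus F$. Then every extreme point $G\not\equiv0$ of the convex set $\mathsf{Gen}_\tau(F,\Lambda)$ is of the form $$G(z)=\frac{(\tau-z)(1-\overline\tau z)}{ib+\sum_{j=1}^{n-1}a_j\frac{s_j+z}{s_j-z}+p_0(z;F,\Lambda)},\quad z\in\mathbb{D},$$ for some $s_1,\dots,s_{n-1}\in\partial\mathbb{D}$, $a_1,\dots,a_{n-1}\ge0$, and $b\in\mathbb{R}$. Some of the points $s_j$ may belong to $F$.
   Context: $\mathbb{D}$ is the open unit disk. A one-parameter semigroup $(\phi_t)_{t\ge0}$ of holomorphic self-maps of $\mathbb{D}$ satisfies $\phi_0=\mathrm{id}$, $\phi_s\circ\phi_t=\phi_{s+t}$, and $\phi_t\to\mathrm{id}$ pointwise as $t\to 0^+$. Its infinitesimal generator $G$ satisfies $\frac{d}{dt}\phi_t(z)=G(\phi_t(z))$. $\mathsf{Gen}_\tau$ is the set of generators with Denjoy–Wolff point $\tau$, together with $G\equiv0$. A point $\sigma\in\partial\mathbb{D}$ is a boundary regular fixed point (BRFP) if each $\phi_t$ has angular limit $\sigma$ and a finite angular derivative at $\sigma$. The spectral value there is $\lambda'$ with $\phi_t'(\sigma)=e^{-\lambda't}$, equivalently $\lambda'=\angle\lim_{z\to\sigma}G(z)/(\sigma-z)$. $\mathsf{Gen}_\tau(F,\Lambda)$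 is the set of $G\in\mathsf{Gen}_\tau$ whose semigroup has BRFPs at all $\sigma_k$ with spectral values $\lambda'_k\in[\lambda_k,0]$ (including $G\equiv0$). $p_0(z;F,\Lambda):=\sum_k\frac{|\tau-\sigma_k|^2}{2|\lambda_k|}\frac{\sigma_k+z}{\sigma_k-z}$. *)

theory Defs
  imports "HOL-Complex_Analysis.Complex_Analysis"
begin

abbreviation unit_disk :: "complex set" where "unit_disk \<equiv> ball 0 1"

definition hol_semigroup :: "(real \<Rightarrow> complex \<Rightarrow> complex) \<Rightarrow> bool" where
  "hol_semigroup \<phi> \<longleftrightarrow>
     (\<forall>t\<ge>0. \<phi> t holomorphic_on unit_disk \<and> \<phi> t ` unit_disk \<subseteq> unit_disk) \<and>
     (\<forall>z\<in>unit_disk. \<phi> 0 z = z) \<and>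
     (\<forall>s\<ge>0. \<forall>t\<ge>0. \<forall>z\<in>unit_disk. \<phi> (s + t) z = \<phi> s (\<phi> t z)) \<and>
     (\<forall>z\<in>unit_disk. ((\<lambda>t. \<phi> t z) \<longlongrightarrow> z) (at_right 0))"

definition generates :: "(complex \<Rightarrow> complex) \<Rightarrow> (real \<Rightarrow> complex \<Rightarrow> complex) \<Rightarrow> bool" where
  "generates G \<phi> \<longleftrightarrow> G holomorphic_on unit_disk \<and>
     (\<forall>z\<in>unit_disk. \<forall>t\<ge>0.
        ((\<lambda>s. \<phi> s z) has_vector_derivative G (\<phi> t z)) (at t within {0..}))"

definition dw_point :: "(real \<Rightarrow> complex \<Rightarrow> complex) \<Rightarrow> complex \<Rightarrow> bool" where
  "dw_point \<phi> \<tau> \<longleftrightarrow>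
     (\<tau> \<in> unit_disk \<and> (\<forall>t\<ge>0. \<phi> t \<tau> = \<tau>)) \<or>
     (\<tau> \<in> sphere 0 1 \<and> (\<forall>z\<in>unit_disk. ((\<lambda>t. \<phi> t z) \<longlongrightarrow> \<tau>) at_top))"

definition stolz :: "complex \<Rightarrow> real \<Rightarrow> complex set" where
  "stolz \<sigma> K = {z \<in> unit_disk. cmod (\<sigma> - z) < K * (1 - cmod z)}"

definition angular_limit :: "(complex \<Rightarrow> complex) \<Rightarrow> complex \<Rightarrow> complex \<Rightarrow> bool" where
  "angular_limit f \<sigma> L \<longleftrightarrow> (\<forall>K>1. (f \<longlongrightarrow> L) (at \<sigma> within stolz \<sigma> K))"

definition brfp :: "(real \<Rightarrow> complex \<Rightarrow> complex) \<Rightarrow> complex \<Rightarrow> real \<Rightarrow> bool" where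
  "brfp \<phi> \<sigma> lam \<longleftrightarrow>
     (\<forall>t\<ge>0. angular_limit (\<phi> t) \<sigma> \<sigma> \<and>
             angular_limit (\<lambda>z. (\<phi> t z - \<sigma>) / (z - \<sigma>)) \<sigma> (complex_of_real (exp (- lam * t))))"

text \<open>Gen_tau(F,Lambda). Generators are normalised to vanish off the disk, so that the set
  is a set of functions on the disk.\<close>
definition Gen_FL :: "complex \<Rightarrow> nat \<Rightarrow> (nat \<Rightarrow> complex) \<Rightarrow> (nat \<Rightarrow> real) \<Rightarrow> (complex \<Rightarrow> complex) set" where
  "Gen_FL \<tau> n \<sigma> \<Lambda> = {G. (\<forall>z. z \<notin> unit_disk \<longrightarrow> G z = 0) \<and>
     ((\<forall>z. G z = 0) \<or>
      (\<exists>\<phi>. hol_semigroup \<phi> \<and> generates G \<phi> \<and> dw_point \<phi> \<tau> \<and>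
           (\<forall>k<n. \<exists>lam. \<Lambda> k \<le> lam \<and> lam \<le> 0 \<and> brfp \<phi> (\<sigma> k) lam)))}"

definition extreme_pt :: "(complex \<Rightarrow> complex) \<Rightarrow> (complex \<Rightarrow> complex) set \<Rightarrow> bool" where
  "extreme_pt G C \<longleftrightarrow> G \<in> C \<and>
     (\<forall>G1\<in>C. \<forall>G2\<in>C. \<forall>t::real. 0 < t \<and> t < 1 \<and>
        G = (\<lambda>z. of_real t * G1 z + of_real (1 - t) * G2 z) \<longrightarrow> G1 = G2)"

definition p0 :: "nat \<Rightarrow> (nat \<Rightarrow> complex) \<Rightarrow> (nat \<Rightarrow> real) \<Rightarrow> complex \<Rightarrow> complex \<Rightarrow> complex" where
  "p0 n \<sigma> \<Lambda> \<tau> z = (\<Sum>k<n. of_real ((cmod (\<tau> - \<sigma> k))\<^sup>2 / (2 * \<bar>\<Lambda> k\<bar>)) *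
                         ((\<sigma> k + z) / (\<sigma> k - z)))"

end

theory Submission
  imports Defs
begin

text \<open>
  By Berkson--Porta a generator in the class is \<open>(\<tau> - z) (1 - cnj \<tau> z) p(z)\<close> with \<open>Re p > 0\<close>, and the
  conditions at the \<open>\<sigma> k\<close> say that the Herglotz measure of \<open>1 / p\<close> has at \<open>\<sigma> k\<close> at least the mass
  occurring in \<open>p0\<close>.  If \<open>T\<close> is a real trigonometric polynomial, a Laurent polynomial \<open>R\<close>, purely
  imaginary on the circle, makes \<open>h = T p + R\<close> holomorphic, and \<open>Re h\<close> is then bounded by a
  multiple of \<open>Re p\<close>.  For degree \<open>n\<close> there are \<open>2 n + 2\<close> real parameters, so the \<open>2 n\<close> conditions
  under which \<open>p + \<epsilon> h\<close> and \<open>p - \<epsilon> h\<close> stay in the class, together with one prescribed zero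
  of \<open>T\<close>, have a nontrivial solution.  Extremality forces \<open>h = 0\<close>, so \<open>p = - R / T\<close> is rational, and
  counting the common zeros of \<open>R\<close> and \<open>T\<close> leaves at most \<open>n - 1\<close> atoms in \<open>1 / p - p0\<close>.
\<close>

section \<open>Schwarz--Pick and Julia--Caratheodory\<close>

text \<open>The convex structure lives on \<open>p\<close>, on which G depends linearly, while the
  atoms live on \<open>1 / p\<close>. The two meet in the radial slope: a mass \<open>M > 0\<close>
  of \<open>1 / p\<close> at \<open>\<sigma> k\<close> is the same as p(r \<sigma> k) / (1 - r)
  tending to 1 / (2 M), and "mass at least w" becomes the affine bound "slope at most 1 / (2 w)".
  Hence a direction \<open>h\<close> is tested by its slopes. A finite slope needs R(\<sigma> k) =
  0, one real equation since R is imaginary on the circle. The second equation at \<sigma> k depends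
  on the atom: if it is minimal, the slope of \<open>h\<close> must vanish; if it is heavier, any
  slope is admissible and the equation is spent on a zero of T. These zeros, the prescribed one at a
  minimal atom, and the vanishing of \<open>p\<close> at every \<sigma> k lower the degree to n - 1.
  No measure is ever formed: the mass at \<open>s\<close> is the largest m with m Re (kern s) \<le>
  Re f. The perturbed functions must again be shown to come from semigroups, so the flow, its
  Denjoy--Wolff point and its angular derivatives have to be constructed.\<close>

lemma one_minus_cnj_mult_nonzero:
  assumes "cmod w \<le> 1" "cmod z < 1"
  shows "1 - cnj w * z \<noteq> 0"
proof
  assume "1 - cnj w * z = 0"
  then have "cmod (cnj w * z) = 1" by simp
  moreover have "cmod (cnj w * z) \<le> 1 * cmod z"
    unfolding norm_mult using assms by (intro mult_right_mono) auto
  ultimately show False using assms by simp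
qed

lemma norm_square_diff_moebius:
  "(cmod (1 - cnj w * z))\<^sup>2 - (cmod (z - w))\<^sup>2 = (1 - (cmod w)\<^sup>2) * (1 - (cmod z)\<^sup>2)"
proof -
  have "of_real ((cmod (1 - cnj w * z))\<^sup>2 - (cmod (z - w))\<^sup>2)
      = (of_real ((1 - (cmod w)\<^sup>2) * (1 - (cmod z)\<^sup>2)) :: complex)"
    by (simp add: complex_norm_square algebra_simps del: of_real_power)
  then show ?thesis unfolding of_real_eq_iff .
qed

text \<open>Moebius maps sending \<open>w\<close> and \<open>f w\<close> to the origin reduce the
  claim to the Schwarz lemma. Denominators are cleared and both sides squared so that
  \<open>w\<close> may afterwards run to a boundary point; \<open>julia_denjoy_wolff\<close> and
  \<open>julia_brfp\<close> arise in this way.\<close>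

lemma schwarz_pick:
  assumes f: "f holomorphic_on unit_disk" and im: "f ` unit_disk \<subseteq> unit_disk"
    and z: "z \<in> unit_disk" and w: "w \<in> unit_disk"
  shows "(1 - (cmod z)\<^sup>2) * (1 - (cmod w)\<^sup>2) * (cmod (1 - cnj (f w) * f z))\<^sup>2
     \<le> (1 - (cmod (f z))\<^sup>2) * (1 - (cmod (f w))\<^sup>2) * (cmod (1 - cnj w * z))\<^sup>2"
proof -
  define M where "M = Moebius_function 0"
  have nz: "cmod z < 1" and nw: "cmod w < 1" using z w by auto
  have nf: "cmod (f x) < 1" if "cmod x < 1" for x
    using im that by (auto simp: image_subset_iff)
  define g where "g = M (f w) \<circ> (f \<circ> M (- w))"
  have Mim: "M a ` unit_disk \<subseteq> unit_disk" if "cmod a < 1" for a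
    using that by (auto simp: M_def Moebius_function_norm_lt_1)
  have gh: "g holomorphic_on ball 0 1"
    unfolding g_def
  proof (intro holomorphic_on_compose_gen[where t="unit_disk"])
    show "M (- w) holomorphic_on ball 0 1" "M (f w) holomorphic_on ball 0 1"
      using nf nw by (auto simp: M_def Moebius_function_holomorphic)
    show "f holomorphic_on ball 0 1" by fact
    show "M (- w) ` ball 0 1 \<subseteq> ball 0 1" using Mim[of "-w"] nw by simp
    then show "(f \<circ> M (- w)) ` ball 0 1 \<subseteq> ball 0 1" using im by force
  qed
  have g0: "g 0 = 0" by (simp add: g_def M_def Moebius_function_of_zero Moebius_function_eq_zero)
  have gn: "cmod (g x) < 1" if "cmod x < 1" for x
    using that nw nf by (simp add: g_def M_def Moebius_function_norm_lt_1)
  define \<xi> where "\<xi> = M w z"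
  have x1: "cmod \<xi> < 1" using nz nw by (simp add: \<xi>_def M_def Moebius_function_norm_lt_1)
  have Mz: "M (- w) \<xi> = z"
    using Moebius_function_compose[of w "-w" z] Moebius_function_compose[of "-w" w z] nw nz
    by (simp add: \<xi>_def M_def)
  have S: "cmod (g \<xi>) \<le> cmod \<xi>"
    using Schwarz_Lemma(1)[OF gh g0 gn x1] by simp
  have "g \<xi> = (f z - f w) / (1 - cnj (f w) * f z)"
    using Mz by (simp add: g_def M_def Moebius_function_simple)
  then have S1: "cmod (f z - f w) / cmod (1 - cnj (f w) * f z) \<le> cmod (z - w) / cmod (1 - cnj w * z)"
    using S by (simp add: \<xi>_def M_def Moebius_function_simple norm_divide)
  have d1: "cmod (1 - cnj (f w) * f z) > 0"
    using one_minus_cnj_mult_nonzero[of "f w" "f z"] nf[OF nw] nf[OF nz] by simp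
  have d2: "cmod (1 - cnj w * z) > 0"
    using one_minus_cnj_mult_nonzero[of w z] nw nz by simp
  have "cmod (f z - f w) * cmod (1 - cnj w * z) \<le> cmod (z - w) * cmod (1 - cnj (f w) * f z)"
    using S1 d1 d2 by (simp add: field_simps)
  then have "(cmod (f z - f w) * cmod (1 - cnj w * z))\<^sup>2 \<le> (cmod (z - w) * cmod (1 - cnj (f w) * f z))\<^sup>2"
    by (intro power_mono) auto
  moreover have "(cmod (f z - f w))\<^sup>2 = (cmod (1 - cnj (f w) * f z))\<^sup>2 - (1 - (cmod (f w))\<^sup>2) * (1 - (cmod (f z))\<^sup>2)"
    using norm_square_diff_moebius[of "f w" "f z"] by simp
  moreover have "(cmod (z - w))\<^sup>2 = (cmod (1 - cnj w * z))\<^sup>2 - (1 - (cmod w)\<^sup>2) * (1 - (cmod z)\<^sup>2)"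
    using norm_square_diff_moebius[of w z] by simp
  ultimately show ?thesis
    by (simp add: power_mult_distrib algebra_simps)
qed

text \<open>The Cayley transform F = (f - 1) / (f + 1) carries the right half plane to the disk with
  1 - |F|^2 = 4 Re f / |f + 1|^2, and the factors |f + 1|^2 cancel between the two sides.\<close>

lemma schwarz_pick_half_plane:
  assumes f: "f holomorphic_on unit_disk" and re: "\<And>z. z \<in> unit_disk \<Longrightarrow> 0 \<le> Re (f z)"
    and z: "z \<in> unit_disk" and w: "w \<in> unit_disk"
  shows "(1 - (cmod z)\<^sup>2) * (1 - (cmod w)\<^sup>2) * (cmod (f z + cnj (f w)))\<^sup>2
     \<le> 4 * Re (f z) * Re (f w) * (cmod (1 - cnj w * z))\<^sup>2"
proof -
  have pos: "(1 - (cmod z)\<^sup>2) * (1 - (cmod w)\<^sup>2) * (cmod (f z + cnj (f w)))\<^sup>2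
     \<le> 4 * Re (f z) * Re (f w) * (cmod (1 - cnj w * z))\<^sup>2"
    if f: "f holomorphic_on unit_disk" and re: "\<And>z. z \<in> unit_disk \<Longrightarrow> 0 < Re (f z)" for f
  proof -
    define F where "F = (\<lambda>z. (f z - 1) / (f z + 1))"
    have n1: "f x + 1 \<noteq> 0" if "x \<in> unit_disk" for x
    proof
      assume "f x + 1 = 0"
      then have "Re (f x + 1) = 0" by simp
      then show False using re[OF that] by simp
    qed
    have F1: "1 - (cmod (F x))\<^sup>2 = 4 * Re (f x) / (cmod (f x + 1))\<^sup>2" if "x \<in> unit_disk" for x
    proof -
      have "(cmod (f x + 1))\<^sup>2 - (cmod (f x - 1))\<^sup>2 = 4 * Re (f x)"
        unfolding cmod_power2 by (simp add: power2_eq_square algebra_simps)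
      moreover have "(cmod (F x))\<^sup>2 = (cmod (f x - 1))\<^sup>2 / (cmod (f x + 1))\<^sup>2"
        by (simp add: F_def norm_divide power_divide)
      moreover have "(cmod (f x + 1))\<^sup>2 > 0" using n1[OF that] by simp
      ultimately show ?thesis
        by (metis diff_divide_distrib divide_self less_irrefl)
    qed
    have "F holomorphic_on unit_disk"
      unfolding F_def using n1 by (intro holomorphic_intros f) auto
    moreover have "F ` unit_disk \<subseteq> unit_disk"
    proof -
      have "cmod (F x) < 1" if "x \<in> unit_disk" for x
      proof -
        have "1 - (cmod (F x))\<^sup>2 > 0"
          using F1[OF that] re[OF that] n1[OF that] by simp
        then show ?thesis by (simp add: power2_less_1_iff abs_square_less_1)
      qed
      then show ?thesis by auto
    qed
    ultimately have SP: "(1 - (cmod z)\<^sup>2) * (1 - (cmod w)\<^sup>2) * (cmod (1 - cnj (F w) * F z))\<^sup>2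
       \<le> (1 - (cmod (F z))\<^sup>2) * (1 - (cmod (F w))\<^sup>2) * (cmod (1 - cnj w * z))\<^sup>2"
      by (rule schwarz_pick) (use z w in auto)
    define a where "a = (cmod (f z + 1))\<^sup>2"
    define b where "b = (cmod (f w + 1))\<^sup>2"
    have ab: "a > 0" "b > 0" using n1 z w by (auto simp: a_def b_def)
    have cw: "cnj (f w) + 1 \<noteq> 0"
      using n1[OF w] by (metis complex_cnj_add complex_cnj_cancel_iff complex_cnj_one complex_cnj_zero_iff)
    have "1 - cnj (F w) * F z = 2 * (f z + cnj (f w)) / ((f z + 1) * (cnj (f w) + 1))"
    proof -
      have gen: "1 - (b - 1) / (b + 1) * ((a - 1) / (a + 1)) = 2 * (a + b) / ((a + 1) * (b + 1))"
        if "a + 1 \<noteq> 0" "b + 1 \<noteq> 0" for a b :: complex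
      proof -
        have "(b - 1) / (b + 1) * ((a - 1) / (a + 1)) * ((a + 1) * (b + 1)) = (b - 1) * (a - 1)"
          using that by simp
        then have "(1 - (b - 1) / (b + 1) * ((a - 1) / (a + 1))) * ((a + 1) * (b + 1)) = (a + 1) * (b + 1) - (b - 1) * (a - 1)"
          by (metis left_diff_distrib mult_1)
        also have "\<dots> = 2 * (a + b)" by (simp add: algebra_simps)
        finally show ?thesis using that by (metis eq_divide_eq mult_eq_0_iff)
      qed
      show ?thesis using gen[OF n1[OF z] cw] by (simp add: F_def)
    qed
    then have E: "(cmod (1 - cnj (F w) * F z))\<^sup>2 = 4 * (cmod (f z + cnj (f w)))\<^sup>2 / (a * b)"
      using complex_mod_cnj[of "f w + 1"]
      by (simp add: a_def b_def norm_divide norm_mult power_divide power_mult_distrib del: complex_mod_cnj distrib_left_numeral)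
    have "X * (4 * N / (a * b)) \<le> (4 * P / a) * (4 * Q / b) * e \<Longrightarrow> X * N \<le> 4 * P * Q * e"
      for X N P Q e :: real
    proof -
      assume "X * (4 * N / (a * b)) \<le> (4 * P / a) * (4 * Q / b) * e"
      moreover have "X * (4 * N / (a * b)) = 4 * (X * N / (a * b))"
        "(4 * P / a) * (4 * Q / b) * e = 4 * (4 * P * Q * e / (a * b))" by simp_all
      ultimately have "(X * N) / (a * b) \<le> (4 * P * Q * e) / (a * b)" by linarith
      then show ?thesis using ab by (simp add: divide_le_cancel)
    qed
    then show ?thesis
      using SP unfolding E F1[OF z] F1[OF w] a_def[symmetric] b_def[symmetric] by blast
  qed
  \<comment> \<open>Where \<open>Re f\<close> vanishes the Cayley transform leaves the open disk, so
    the strict case is applied to \<open>f + e\<close> and \<open>e\<close> decreases to 0.\<close>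
  define L where "L = (\<lambda>e::real. (1 - (cmod z)\<^sup>2) * (1 - (cmod w)\<^sup>2) * (cmod ((f z + of_real e) + cnj (f w + of_real e)))\<^sup>2)"
  define R where "R = (\<lambda>e::real. 4 * Re (f z + of_real e) * Re (f w + of_real e) * (cmod (1 - cnj w * z))\<^sup>2)"
  have "(L \<longlongrightarrow> L 0) (at_right 0)" "(R \<longlongrightarrow> R 0) (at_right 0)"
  proof -
    have "continuous_on UNIV L" "continuous_on UNIV R"
      unfolding L_def R_def by (intro continuous_intros)+
    then have "isCont L 0" "isCont R 0"
      by (simp_all add: continuous_on_eq_continuous_at)
    then show "(L \<longlongrightarrow> L 0) (at_right 0)" "(R \<longlongrightarrow> R 0) (at_right 0)"
      unfolding isCont_def by (meson subset_UNIV tendsto_within_subset)+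
  qed
  moreover have "\<forall>\<^sub>F e in at_right 0. L e \<le> R e"
  proof -
    have "L e \<le> R e" if "e > 0" for e
      unfolding L_def R_def
      using that re by (intro pos) (auto intro!: holomorphic_on_add f holomorphic_on_const add_nonneg_pos)
    then show ?thesis by (rule eventually_mono[OF eventually_at_right_less])
  qed
  ultimately have "L 0 \<le> R 0"
    by (intro tendsto_le[of "at_right 0" R "R 0" L "L 0"]) auto
  then show ?thesis by (simp add: L_def R_def)
qed

text \<open>Dropping \<open>Re (f w)\<close> inside the modulus only decreases it, and one factor |f
  z - i Im (f w)| can then be divided out. The bound is linear in \<open>Re (f w)\<close>: it forces
  \<open>f\<close> to be constant when that vanishes, and gives smallness when \<open>w\<close> is
  chosen nearly optimal.\<close>

lemma harnack_upper:
  assumes f: "f holomorphic_on unit_disk" and re: "\<And>z. z \<in> unit_disk \<Longrightarrow> 0 \<le> Re (f z)"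
    and z: "z \<in> unit_disk" and w: "w \<in> unit_disk"
  shows "(1 - (cmod z)\<^sup>2) * (1 - (cmod w)\<^sup>2) * cmod (f z - \<i> * of_real (Im (f w)))
     \<le> 4 * Re (f w) * (cmod (1 - cnj w * z))\<^sup>2"
proof -
  define \<zeta> where "\<zeta> = f z - \<i> * of_real (Im (f w))"
  define d where "d = (1 - (cmod z)\<^sup>2) * (1 - (cmod w)\<^sup>2)"
  define e where "e = (cmod (1 - cnj w * z))\<^sup>2"
  have d: "d \<ge> 0" unfolding d_def using z w by (auto intro!: mult_nonneg_nonneg simp: power_le_one)
  have fe: "f z + cnj (f w) = \<zeta> + of_real (Re (f w))"
    by (simp add: \<zeta>_def complex_eq_iff)
  have c: "Re (f w) \<ge> 0" "Re \<zeta> \<ge> 0" using re z w by (auto simp: \<zeta>_def)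
  have "(cmod \<zeta>)\<^sup>2 \<le> (cmod (f z + cnj (f w)))\<^sup>2"
    unfolding fe cmod_power2 using c by (auto intro!: power_mono)
  then have "d * (cmod \<zeta>)\<^sup>2 \<le> d * (cmod (f z + cnj (f w)))\<^sup>2"
    using d by (rule mult_left_mono)
  also have "\<dots> \<le> 4 * Re (f z) * Re (f w) * e"
    unfolding d_def e_def by (rule schwarz_pick_half_plane[OF f re z w])
  also have "Re (f z) = Re \<zeta>" by (simp add: \<zeta>_def)
  also have "4 * Re \<zeta> * Re (f w) * e \<le> 4 * cmod \<zeta> * Re (f w) * e"
    using c complex_Re_le_cmod by (intro mult_right_mono mult_left_mono) (auto simp: e_def)
  finally have "(d * cmod \<zeta>) * cmod \<zeta> \<le> (4 * Re (f w) * e) * cmod \<zeta>"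
    by (simp add: power2_eq_square mult_ac)
  moreover have "0 \<le> 4 * Re (f w) * e" using c by (simp add: e_def)
  ultimately show ?thesis
    by (cases "\<zeta> = 0") (auto simp: \<zeta>_def[symmetric] d_def[symmetric] e_def[symmetric])
qed

text \<open>The identity |f w - f z|^2 = |f w + cnj (f z)|^2 - 4 Re (f w) Re (f z) turns the
  two-point inequality into one for the difference quotient; then \<open>w\<close> tends to
  \<open>z\<close>.\<close>

lemma deriv_bound_half_plane:
  assumes f: "f holomorphic_on unit_disk" and re: "\<And>z. z \<in> unit_disk \<Longrightarrow> 0 \<le> Re (f z)"
    and z: "z \<in> unit_disk"
  shows "(1 - (cmod z)\<^sup>2) * cmod (deriv f z) \<le> 2 * Re (f z)"
proof -
  have fd: "(f has_field_derivative deriv f z) (at z)"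
    using f z by (intro holomorphic_derivI) auto
  have lim: "((\<lambda>w. (f w - f z) / (w - z)) \<longlongrightarrow> deriv f z) (at z)"
    using fd by (simp add: has_field_derivative_iff)
  have isc: "(f \<longlongrightarrow> f z) (at z)"
    using fd DERIV_isCont isCont_def by blast
  have quot: "(1 - (cmod w)\<^sup>2) * (1 - (cmod z)\<^sup>2) * (cmod ((f w - f z) / (w - z)))\<^sup>2
      \<le> 4 * Re (f w) * Re (f z)" if "w \<in> unit_disk" "w \<noteq> z" for w
  proof -
    have a: "(cmod (f w - f z))\<^sup>2 = (cmod (f w + cnj (f z)))\<^sup>2 - 4 * Re (f w) * Re (f z)"
      unfolding cmod_power2 by (simp add: power2_eq_square algebra_simps)
    have b: "(cmod (w - z))\<^sup>2 = (cmod (1 - cnj z * w))\<^sup>2 - (1 - (cmod z)\<^sup>2) * (1 - (cmod w)\<^sup>2)"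
      using norm_square_diff_moebius[of z w] by simp
    have "(1 - (cmod w)\<^sup>2) * (1 - (cmod z)\<^sup>2) * (cmod (f w - f z))\<^sup>2 \<le> 4 * Re (f w) * Re (f z) * (cmod (w - z))\<^sup>2"
      using schwarz_pick_half_plane[OF f re that(1) z] unfolding a b by (simp add: algebra_simps)
    then show ?thesis using that(2)
      by (simp add: norm_divide power_divide divide_simps)
  qed
  have "((\<lambda>w. (1 - (cmod w)\<^sup>2) * (1 - (cmod z)\<^sup>2) * (cmod ((f w - f z) / (w - z)))\<^sup>2)
     \<longlongrightarrow> (1 - (cmod z)\<^sup>2) * (1 - (cmod z)\<^sup>2) * (cmod (deriv f z))\<^sup>2) (at z)"
    by (intro tendsto_intros lim)
  moreover have "((\<lambda>w. 4 * Re (f w) * Re (f z)) \<longlongrightarrow> 4 * Re (f z) * Re (f z)) (at z)"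
    by (intro tendsto_intros isc)
  moreover have "\<forall>\<^sub>F w in at z. (1 - (cmod w)\<^sup>2) * (1 - (cmod z)\<^sup>2) * (cmod ((f w - f z) / (w - z)))\<^sup>2
      \<le> 4 * Re (f w) * Re (f z)"
    using eventually_at_in_open'[OF open_ball z] eventually_neq_at_within[of z z UNIV]
    by eventually_elim (use quot in auto)
  ultimately have "(1 - (cmod z)\<^sup>2) * (1 - (cmod z)\<^sup>2) * (cmod (deriv f z))\<^sup>2 \<le> 4 * Re (f z) * Re (f z)"
    by (intro tendsto_le[of "at z"]) auto
  then have "((1 - (cmod z)\<^sup>2) * cmod (deriv f z))\<^sup>2 \<le> (2 * Re (f z))\<^sup>2"
    by (simp add: power2_eq_square mult_ac)
  then show ?thesis
    by (rule power2_le_imp_le) (use re[OF z] in simp)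
qed

section \<open>The Herglotz kernel, Stolz regions and radial limits\<close>

definition kern :: "complex \<Rightarrow> complex \<Rightarrow> complex" where
  "kern s z = (s + z) / (s - z)"

lemma Re_kern:
  assumes "cmod s = 1"
  shows "Re (kern s z) = (1 - (cmod z)\<^sup>2) / (cmod (s - z))\<^sup>2"
proof -
  have "Re ((s + z) * cnj (s - z)) = (cmod s)\<^sup>2 - (cmod z)\<^sup>2"
    unfolding cmod_power2 by (simp add: algebra_simps power2_eq_square)
  then show ?thesis
    using assms by (simp add: kern_def Re_complex_div_eq_0 complex_div_cnj[of "s + z" "s - z"] flip: of_real_power)
qed

lemma diff_sphere_eq:
  assumes "cmod s = 1"
  shows "s - z = s * (1 - cnj s * z)" and "cmod (1 - cnj s * z) = cmod (s - z)"
proof -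
  have "s * cnj s = 1" using assms by (simp add: complex_norm_square[symmetric])
  then show e: "s - z = s * (1 - cnj s * z)" by (simp add: right_diff_distrib flip: mult.assoc)
  show "cmod (1 - cnj s * z) = cmod (s - z)" unfolding e norm_mult using assms by simp
qed

lemma sphere_neq_disk: "cmod s = 1 \<Longrightarrow> z \<in> unit_disk \<Longrightarrow> s - z \<noteq> 0"
  by auto

lemma kern_mult:
  assumes s: "cmod s = 1" and z: "z \<in> unit_disk"
  shows "(1 - cnj s * z) * kern s z = 1 + cnj s * z"
proof -
  have c: "cnj s * s = 1" using s by (simp add: complex_norm_square[symmetric] mult.commute)
  have "(1 - cnj s * z) * kern s z = (cnj s * (s - z)) * kern s z" using c by (simp add: algebra_simps)
  also have "\<dots> = cnj s * (s + z)" using sphere_neq_disk[OF s z] by (simp add: kern_def)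
  also have "\<dots> = 1 + cnj s * z" using c by (simp add: algebra_simps)
  finally show ?thesis .
qed

lemma Re_kern_pos: "cmod s = 1 \<Longrightarrow> z \<in> unit_disk \<Longrightarrow> Re (kern s z) > 0"
  using sphere_neq_disk[of s z] by (simp add: Re_kern power_less_one_iff abs_square_less_1)

lemma holomorphic_kern [holomorphic_intros]: "cmod s = 1 \<Longrightarrow> kern s holomorphic_on unit_disk"
  using sphere_neq_disk[of s] unfolding kern_def by (intro holomorphic_intros) auto

lemma radial_in_stolz:
  assumes s: "cmod s = 1" and r: "0 \<le> r" "r < 1" and K: "K > 1"
  shows "of_real r * s \<in> stolz s K"
proof -
  have "s - of_real r * s = of_real (1 - r) * s" by (simp add: algebra_simps)
  then have "cmod (s - of_real r * s) = 1 - r" using s r by (simp only: norm_mult norm_of_real) auto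
  moreover have "1 * (1 - r) < K * (1 - r)" using r K by (intro mult_strict_right_mono) auto
  ultimately show ?thesis using s r by (simp add: stolz_def norm_mult)
qed

lemma radial_in_disk: "cmod s = 1 \<Longrightarrow> r \<in> {0<..<1} \<Longrightarrow> complex_of_real r * s \<in> unit_disk"
  by (simp add: norm_mult)

lemma cnj_radial: "cmod s = 1 \<Longrightarrow> cnj s * (complex_of_real r * s) = of_real r"
  using complex_norm_square[of s] by (simp add: mult.left_commute mult.commute[of "cnj s"])

lemma eventually_radial: "\<forall>\<^sub>F r in at_left (1::real). r \<in> {0<..<1}"
  by (rule eventually_at_left_real) simp

lemma filterlim_radial:
  assumes s: "cmod s = 1" and K: "K > 1"
  shows "filterlim (\<lambda>r. of_real r * s) (at s within stolz s K) (at_left 1)"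
  unfolding filterlim_at
proof
  have "((\<lambda>r. of_real r * s) \<longlongrightarrow> of_real 1 * s) (at_left 1)"
    by (intro tendsto_intros)
  then show "((\<lambda>r. of_real r * s) \<longlongrightarrow> s) (at_left 1)" by simp
  show "\<forall>\<^sub>F r in at_left 1. of_real r * s \<in> stolz s K \<and> of_real r * s \<noteq> s"
    using eventually_radial
  proof eventually_elim
    case (elim r)
    then show ?case using radial_in_stolz[OF s, of r K] K s by auto
  qed
qed

lemma angular_limit_radial:
  assumes "angular_limit f s L" "cmod s = 1"
  shows "((\<lambda>r. f (of_real r * s)) \<longlongrightarrow> L) (at_left 1)"
proof -
  have "(f \<longlongrightarrow> L) (at s within stolz s 2)" using assms(1) by (simp add: angular_limit_def)
  then show ?thesis by (rule filterlim_compose[OF _ filterlim_radial[OF assms(2)]]) simp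
qed

lemma angular_limit_unique:
  assumes "angular_limit f s L" "cmod s = 1" "((\<lambda>r. f (of_real r * s)) \<longlongrightarrow> M) (at_left 1)"
  shows "M = L"
  using tendsto_unique[OF _ assms(3) angular_limit_radial[OF assms(1,2)]] by simp

lemma eventually_stolz_disk: "\<forall>\<^sub>F z in at s within stolz s K. z \<in> stolz s K \<and> z \<in> unit_disk"
  unfolding eventually_at_filter by (simp add: stolz_def)

text \<open>Julia--Caratheodory: \<open>m\<close> is the point mass at \<open>s\<close> of the Herglotz measure of \<open>f\<close>.\<close>

theorem julia_caratheodory:
  assumes f: "f holomorphic_on unit_disk" and re: "\<And>z. z \<in> unit_disk \<Longrightarrow> 0 \<le> Re (f z)"
    and s: "cmod s = 1"
  obtains m where "m \<ge> 0" "\<And>z. z \<in> unit_disk \<Longrightarrow> m * Re (kern s z) \<le> Re (f z)"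
    "angular_limit (\<lambda>z. (1 - cnj s * z) * f z) s (2 * of_real m)"
proof -
  \<comment> \<open>The infimum of these quotients is the largest \<open>m\<close> for which
    \<open>m Re kern\<close> stays below \<open>Re f\<close>, that is, the heaviest point mass at
    \<open>s\<close> that can be split off.\<close>
  define X where "X = (\<lambda>z. Re (f z) / Re (kern s z)) ` unit_disk"
  define m where "m = Inf X"
  have kp: "Re (kern s z) > 0" if "z \<in> unit_disk" for z
    by (rule Re_kern_pos[OF s that])
  have Xne: "X \<noteq> {}" by (auto simp: X_def)
  have X0: "x \<ge> 0" if "x \<in> X" for x
    using that re kp by (auto simp: X_def intro!: divide_nonneg_pos)
  have bdd: "bdd_below X" using X0 by (auto simp: bdd_below_def)
  have m0: "m \<ge> 0" unfolding m_def using Xne X0 by (rule cInf_greatest)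
  have mle: "m * Re (kern s z) \<le> Re (f z)" if "z \<in> unit_disk" for z
  proof -
    have "m \<le> Re (f z) / Re (kern s z)"
      unfolding m_def using that by (intro cInf_lower bdd) (auto simp: X_def)
    then show ?thesis using kp[OF that] by (simp add: pos_le_divide_eq)
  qed
  define g where "g = (\<lambda>z. f z - of_real m * kern s z)"
  have gh: "g holomorphic_on unit_disk"
    unfolding g_def using s by (intro holomorphic_intros f)
  have g0: "0 \<le> Re (g z)" if "z \<in> unit_disk" for z
    using mle[OF that] by (simp add: g_def)
  have lim0: "((\<lambda>z. (1 - cnj s * z) * g z) \<longlongrightarrow> 0) (at s within stolz s K)" if K: "K > 1" for K
  proof (rule tendstoI)
    fix e :: real assume e: "e > 0"
    \<comment> \<open>Chosen so that the final bound 4 K \<epsilon> |1 - cnj w z|^2 / N, whose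
      quotient is 1 at z = s, becomes \<open>e / 2\<close> there.\<close>
    define \<epsilon> where "\<epsilon> = e / (8 * K)"
    have \<epsilon>: "\<epsilon> > 0" using e K by (simp add: \<epsilon>_def)
    \<comment> \<open>A near-minimiser of the quotient. At this fixed \<open>w\<close> the remainder
      \<open>g\<close> has a small real part, and Harnack's inequality spreads the smallness over
      the whole Stolz region.\<close>
    obtain w where w: "w \<in> unit_disk" "Re (f w) / Re (kern s w) < m + \<epsilon>"
    proof -
      have "Inf X < m + \<epsilon>" using \<epsilon> by (simp add: m_def)
      then obtain x where "x \<in> X" "x < m + \<epsilon>" using cInf_lessD[OF Xne] by blast
      then show thesis using that by (auto simp: X_def)
    qed
    define W where "W = 1 - (cmod w)\<^sup>2"
    define N where "N = (cmod (1 - cnj s * w))\<^sup>2"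
    have W: "W > 0" using w(1) by (simp add: W_def abs_square_less_1)
    have N: "N > 0" using sphere_neq_disk[OF s w(1)] by (simp add: N_def diff_sphere_eq(2)[OF s])
    have kw: "Re (kern s w) = W / N"
      by (simp add: Re_kern[OF s] W_def N_def diff_sphere_eq(2)[OF s])
    have "Re (f w) < (m + \<epsilon>) * Re (kern s w)"
      using w kp by (simp add: pos_divide_less_eq)
    then have gw: "Re (g w) \<le> \<epsilon> * (W / N)"
      unfolding kw[symmetric] by (simp add: g_def algebra_simps)
    define b where "b = \<bar>Im (g w)\<bar>"
    have bound: "cmod ((1 - cnj s * z) * g z) \<le> b * cmod (1 - cnj s * z) + 4 * K * \<epsilon> * ((cmod (1 - cnj w * z))\<^sup>2 / N)"
      if z: "z \<in> stolz s K" for z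
    proof -
      have zd: "z \<in> unit_disk" and st: "cmod (s - z) < K * (1 - cmod z)" using z by (auto simp: stolz_def)
      define Z where "Z = 1 - (cmod z)\<^sup>2"
      define Q where "Q = (cmod (1 - cnj w * z))\<^sup>2"
      have Zp: "Z > 0" using zd by (simp add: Z_def abs_square_less_1)
      \<comment> \<open>The only use of the Stolz condition: |1 - cnj s z| is at most K Z, which
        absorbs the factor \<open>Z\<close> on the left of Harnack's inequality.\<close>
      have "1 - cmod z \<le> Z" unfolding Z_def power2_eq_square using zd mult_left_le[of "cmod z" "cmod z"] by simp
      then have st2: "cmod (1 - cnj s * z) \<le> K * Z"
        using st K diff_sphere_eq(2)[OF s, of z] mult_left_mono[of "1 - cmod z" Z K] by linarith
      have "Z * W * cmod (g z - \<i> * of_real (Im (g w))) \<le> 4 * Re (g w) * Q"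
        unfolding Z_def W_def Q_def by (rule harnack_upper[OF gh g0 zd w(1)])
      also have "\<dots> \<le> 4 * (\<epsilon> * (W / N)) * Q"
        using gw by (intro mult_right_mono mult_left_mono) (auto simp: Q_def)
      finally have "W * (Z * cmod (g z - \<i> * of_real (Im (g w)))) \<le> W * (4 * \<epsilon> * (Q / N))"
        by (simp add: mult_ac)
      then have h: "Z * cmod (g z - \<i> * of_real (Im (g w))) \<le> 4 * \<epsilon> * (Q / N)"
        using W by (simp only: mult_le_cancel_left_pos)
      have "cmod (g z) \<le> b + cmod (g z - \<i> * of_real (Im (g w)))"
        using norm_triangle_sub[of "g z" "\<i> * of_real (Im (g w))"] by (simp add: b_def norm_mult)
      then have "cmod ((1 - cnj s * z) * g z)
          \<le> cmod (1 - cnj s * z) * (b + cmod (g z - \<i> * of_real (Im (g w))))"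
        unfolding norm_mult by (intro mult_left_mono) auto
      also have "\<dots> = b * cmod (1 - cnj s * z) + cmod (1 - cnj s * z) * cmod (g z - \<i> * of_real (Im (g w)))"
        by (simp add: algebra_simps)
      also have "\<dots> \<le> b * cmod (1 - cnj s * z) + (K * Z) * cmod (g z - \<i> * of_real (Im (g w)))"
        using st2 by (intro add_left_mono mult_right_mono) auto
      also have "\<dots> \<le> b * cmod (1 - cnj s * z) + K * (4 * \<epsilon> * (Q / N))"
        using mult_left_mono[OF h, of K] K by (simp add: mult_ac)
      finally show ?thesis by (simp add: Q_def mult_ac)
    qed
    define B where "B = (\<lambda>z. b * cmod (1 - cnj s * z) + 4 * K * \<epsilon> * ((cmod (1 - cnj w * z))\<^sup>2 / N))"
    have "cnj s * s = 1" using s by (simp add: complex_norm_square[symmetric] mult.commute)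
    moreover have "cmod (1 - cnj w * s) = cmod (1 - cnj s * w)"
      using complex_mod_cnj[of "1 - cnj w * s"] by (simp add: mult.commute)
    ultimately have Bs: "B s = e / 2"
      using N K by (simp add: B_def N_def[symmetric] \<epsilon>_def)
    have "continuous_on UNIV B" unfolding B_def using N by (intro continuous_intros) auto
    then have "(B \<longlongrightarrow> B s) (at s within stolz s K)"
      by (meson UNIV_I continuous_on_def subset_UNIV tendsto_within_subset)
    then have "\<forall>\<^sub>F z in at s within stolz s K. B z < e"
      by (rule order_tendstoD(2)) (use Bs e in simp)
    then show "\<forall>\<^sub>F z in at s within stolz s K. dist ((1 - cnj s * z) * g z) 0 < e"
      using eventually_stolz_disk[of s K]
    proof eventually_elim
      case (elim z)
      then show ?case using bound[of z] by (simp add: B_def)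
    qed
  qed
  have "((\<lambda>z. (1 - cnj s * z) * f z) \<longlongrightarrow> 2 * of_real m) (at s within stolz s K)" if K: "K > 1" for K
  proof -
    have c: "cnj s * s = 1" using s by (simp add: complex_norm_square[symmetric] mult.commute)
    have "((\<lambda>z. (1 - cnj s * z) * g z + of_real m * (1 + cnj s * z)) \<longlongrightarrow> 0 + of_real m * (1 + cnj s * s))
        (at s within stolz s K)"
      by (intro tendsto_intros lim0 K)
    moreover have "\<forall>\<^sub>F z in at s within stolz s K.
        (1 - cnj s * z) * g z + of_real m * (1 + cnj s * z) = (1 - cnj s * z) * f z"
      using eventually_stolz_disk[of s K]
    proof eventually_elim
      case (elim z)
      have "(1 - cnj s * z) * f z = (1 - cnj s * z) * g z + of_real m * ((1 - cnj s * z) * kern s z)"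
        by (simp add: g_def algebra_simps)
      then show ?case using kern_mult[OF s] elim by simp
    qed
    ultimately show ?thesis using c by (auto elim: Lim_transform_eventually simp: mult.commute)
  qed
  then have "angular_limit (\<lambda>z. (1 - cnj s * z) * f z) s (2 * of_real m)"
    by (simp add: angular_limit_def)
  with m0 mle show thesis using that by blast
qed

section \<open>Multiplication by trigonometric polynomials\<close>

text \<open>The backward shift of Taylor series, with the value at 0 that removes the singularity.
  Its iterates yield both the Taylor coefficients (\<open>tcoeff f j\<close> is the j-th one at 0)
  and the tails, so that corrections by finitely many terms involve no power series.\<close>

definition bshift :: "(complex \<Rightarrow> complex) \<Rightarrow> complex \<Rightarrow> complex" where
  "bshift f z = (if z = 0 then deriv f 0 else (f z - f 0) / z)"

definition tcoeff :: "(complex \<Rightarrow> complex) \<Rightarrow> nat \<Rightarrow> complex" where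
  "tcoeff f j = (bshift ^^ j) f 0"

lemma bshift_holomorphic:
  assumes "f holomorphic_on ball 0 R" "R > 0"
  shows "(bshift ^^ k) f holomorphic_on ball 0 R"
proof (induction k)
  case (Suc k)
  have "(\<lambda>z. if z = 0 then deriv ((bshift ^^ k) f) 0 else ((bshift ^^ k) f z - (bshift ^^ k) f 0) / (z - 0))
     holomorphic_on ball 0 R"
    by (rule pole_lemma[OF Suc]) (use assms in simp)
  moreover have "bshift g = (\<lambda>z. if z = 0 then deriv g 0 else (g z - g 0) / (z - 0))" for g
    by (simp add: bshift_def fun_eq_iff)
  note this[of "(bshift ^^ k) f"]
  ultimately show ?case unfolding funpow.simps o_apply by (simp only:)
qed (use assms in simp)

lemma bshift_pow_eq:
  assumes "z \<noteq> 0"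
  shows "(bshift ^^ k) f z = (f z - (\<Sum>j<k. tcoeff f j * z ^ j)) / z ^ k"
proof (induction k)
  case (Suc k)
  have "(bshift ^^ Suc k) f z = ((bshift ^^ k) f z - tcoeff f k) / z"
    using assms by (simp add: bshift_def tcoeff_def)
  also have "\<dots> = (f z - (\<Sum>j<k. tcoeff f j * z ^ j) - tcoeff f k * z ^ k) / z ^ Suc k"
    unfolding Suc using assms by (simp add: diff_divide_distrib mult.commute)
  finally show ?case by (simp add: diff_diff_eq)
qed simp

text \<open>Since \<open>f\<close> need not extend holomorphically across the circle, estimates
  there are made for the dilations f(r z). The constant \<open>c\<close> is present so that the rule
  can be iterated.\<close>

lemma bshift_dilate:
  assumes g: "g holomorphic_on unit_disk" and r: "0 < (r::real)" "r < 1"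
  shows "bshift (\<lambda>z. c * g (of_real r * z)) = (\<lambda>z. c * of_real r * bshift g (of_real r * z))"
proof
  fix z
  have "(g has_field_derivative deriv g 0) (at (of_real r * 0))"
    using holomorphic_derivI[OF g, of 0] by simp
  then have "((\<lambda>z. c * g (of_real r * z)) has_field_derivative c * (deriv g 0 * of_real r)) (at 0)"
    by (auto intro!: derivative_eq_intros DERIV_chain2[of g])
  then have "deriv (\<lambda>z. c * g (of_real r * z)) 0 = c * of_real r * deriv g 0"
    by (simp add: DERIV_imp_deriv mult_ac)
  then show "bshift (\<lambda>z. c * g (of_real r * z)) z = c * of_real r * bshift g (of_real r * z)"
    using r by (auto simp: bshift_def field_simps)
qed

lemma bshift_pow_dilate:
  assumes f: "f holomorphic_on unit_disk" and r: "0 < (r::real)" "r < 1"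
  shows "(bshift ^^ k) (\<lambda>z. f (of_real r * z)) = (\<lambda>z. of_real r ^ k * (bshift ^^ k) f (of_real r * z))"
proof (induction k)
  case (Suc k)
  show ?case
    unfolding funpow.simps o_apply Suc bshift_dilate[OF bshift_holomorphic[OF f zero_less_one] r]
    by (simp add: mult.commute)
qed simp

text \<open>The holomorphic function whose real part on the circle is \<open>2 Re (c z^k) Re f\<close>.\<close>

definition mult_op :: "nat \<Rightarrow> complex \<Rightarrow> (complex \<Rightarrow> complex) \<Rightarrow> complex \<Rightarrow> complex" where
  "mult_op k c f z = c * z ^ k * f z + cnj c * (bshift ^^ k) f z + c * (\<Sum>j<k. cnj (tcoeff f j) * z ^ (k - j))"

lemma mult_op_holomorphic:
  assumes "f holomorphic_on ball 0 R" "R > 0"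
  shows "mult_op k c f holomorphic_on ball 0 R"
  unfolding mult_op_def by (intro holomorphic_intros assms bshift_holomorphic)

lemma Re_mult_op_circle:
  assumes z: "cmod z = 1"
  shows "Re (mult_op k c f z) = 2 * Re (c * z ^ k) * Re (f z)"
proof -
  have z0: "z \<noteq> 0" using z by auto
  have inv: "1 / z = cnj z" using z z0 by (simp add: field_simps complex_norm_square[symmetric])
  have inv: "x / z ^ k = x * cnj z ^ k" for x k
    by (simp add: inv[symmetric] power_one_over)
  \<comment> \<open>On the circle 1 / z = cnj z, so the correction sum of \<open>mult_op\<close>
    equals \<open>w\<close>, and the Taylor terms dropped by the shift contribute
    \<open>- cnj w\<close>. Their sum is imaginary, which is what the third term of
    \<open>mult_op\<close> is made for.\<close>
  define w where "w = c * z ^ k * (\<Sum>j<k. cnj (tcoeff f j * z ^ j))"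
  have "z ^ (k - j) = z ^ k * cnj z ^ j" if "j < k" for j
    using that z0 by (simp add: inv[symmetric] power_diff)
  then have "c * (\<Sum>j<k. cnj (tcoeff f j) * z ^ (k - j)) = w"
    unfolding w_def sum_distrib_left by (intro sum.cong) (auto simp: mult_ac)
  moreover have "cnj c * (bshift ^^ k) f z = cnj (c * z ^ k) * f z - cnj w"
    unfolding bshift_pow_eq[OF z0] inv w_def by (simp add: algebra_simps)
  ultimately have "mult_op k c f z = (c * z ^ k + cnj (c * z ^ k)) * f z + (w - cnj w)"
    by (simp add: mult_op_def algebra_simps)
  also have "c * z ^ k + cnj (c * z ^ k) = of_real (2 * Re (c * z ^ k))"
    using complex_add_cnj by blast
  finally show ?thesis by simp
qed

lemma Re_nonneg_of_circle:
  assumes F: "F holomorphic_on ball 0 R" and R: "R > 1"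
    and c: "\<And>z. cmod z = 1 \<Longrightarrow> 0 \<le> Re (F z)" and z: "cmod z < 1"
  shows "0 \<le> Re (F z)"
proof -
  have "Re (- F z) \<le> 0"
  proof (rule maximum_real_frontier[where S=unit_disk and f="\<lambda>z. - F z" and \<xi>=z])
    show "(\<lambda>z. - F z) holomorphic_on interior unit_disk"
      using R by (intro holomorphic_intros holomorphic_on_subset[OF F]) auto
    show "continuous_on (closure unit_disk) (\<lambda>z. - F z)"
      using R by (intro continuous_intros continuous_on_subset[OF holomorphic_on_imp_continuous_on[OF F]]) auto
  qed (use c z in auto)
  then show ?thesis by simp
qed

text \<open>On the circle the real part factors as (C + e T) Re f with the real multiplier T = Sum 2
  Re (c k w^k), and \<open>C\<close> dominates |T|. Holomorphy beyond the circle lets the maximum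
  principle carry the sign inside.\<close>

lemma mult_op_bound_smooth:
  assumes f: "f holomorphic_on ball 0 R" and R: "R > 1"
    and re: "\<And>z. cmod z \<le> 1 \<Longrightarrow> 0 \<le> Re (f z)" and z: "cmod z < 1" and e: "\<bar>e\<bar> = (1::real)"
    and C: "C = 2 * (\<Sum>k\<le>n. cmod (c k))"
  shows "0 \<le> Re (of_real C * f z + of_real e * (\<Sum>k\<le>n. mult_op k (c k) f z))"
proof (rule Re_nonneg_of_circle[OF _ R _ z])
  show "(\<lambda>z. of_real C * f z + of_real e * (\<Sum>k\<le>n. mult_op k (c k) f z)) holomorphic_on ball 0 R"
    using R by (intro holomorphic_intros f mult_op_holomorphic) auto
  fix w :: complex assume w: "cmod w = 1"
  have "\<bar>\<Sum>k\<le>n. 2 * Re (c k * w ^ k)\<bar> \<le> (\<Sum>k\<le>n. 2 * cmod (c k))"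
  proof (rule order_trans[OF sum_abs] sum_mono)+
    fix k
    show "\<bar>2 * Re (c k * w ^ k)\<bar> \<le> 2 * cmod (c k)"
      using abs_Re_le_cmod[of "c k * w ^ k"] w by (simp add: norm_mult norm_power)
  qed
  moreover have "(\<Sum>k\<le>n. 2 * cmod (c k)) = C" by (simp only: C sum_distrib_left)
  moreover have "\<bar>e * x\<bar> = \<bar>x\<bar>" for x using e by (simp add: abs_mult)
  ultimately have "\<bar>e * (\<Sum>k\<le>n. 2 * Re (c k * w ^ k))\<bar> \<le> C" by (simp only:)
  then have "0 \<le> (C + e * (\<Sum>k\<le>n. 2 * Re (c k * w ^ k))) * Re (f w)"
    using re[of w] w by (intro mult_nonneg_nonneg) auto
  also have "\<dots> = Re (of_real C * f w + of_real e * (\<Sum>k\<le>n. mult_op k (c k) f w))"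
  proof -
    have "Re (\<Sum>k\<le>n. mult_op k (c k) f w) = (\<Sum>k\<le>n. 2 * Re (c k * w ^ k)) * Re (f w)"
      by (simp only: Re_sum Re_mult_op_circle[OF w] sum_distrib_right)
    moreover have "Re (of_real C * f w + of_real e * M) = C * Re (f w) + e * Re M" for M by simp
    ultimately show ?thesis by (simp only: distrib_right mult.assoc)
  qed
  finally show "0 \<le> Re (of_real C * f w + of_real e * (\<Sum>k\<le>n. mult_op k (c k) f w))" .
qed

lemma mult_op_bound:
  assumes f: "f holomorphic_on unit_disk"
    and re: "\<And>z. z \<in> unit_disk \<Longrightarrow> 0 \<le> Re (f z)" and z: "z \<in> unit_disk"
  shows "\<bar>Re (\<Sum>k\<le>n. mult_op k (c k) f z)\<bar> \<le> 2 * (\<Sum>k\<le>n. cmod (c k)) * Re (f z)"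
proof -
  define C where "C = 2 * (\<Sum>k\<le>n. cmod (c k))"
  have main: "0 \<le> Re (of_real C * f z + of_real e * (\<Sum>k\<le>n. mult_op k (c k) f z))" if e: "\<bar>e\<bar> = (1::real)" for e
  proof -
    \<comment> \<open>The combination formed from the dilation f(r z), but expressed through the
      coefficients and shifts of \<open>f\<close> itself. In this form it is continuous in
      \<open>r\<close> up to 1, while for \<open>r < 1\<close> the smooth case applies.\<close>
    define F where "F = (\<lambda>r::real. of_real C * f (of_real r * z) + of_real e *
       (\<Sum>k\<le>n. c k * z ^ k * f (of_real r * z) + cnj (c k) * (of_real r ^ k * (bshift ^^ k) f (of_real r * z))
          + c k * (\<Sum>j<k. cnj (of_real r ^ j * tcoeff f j) * z ^ (k - j))))"
    have F1: "F 1 = of_real C * f z + of_real e * (\<Sum>k\<le>n. mult_op k (c k) f z)"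
      by (simp add: F_def mult_op_def)
    have pos: "0 \<le> Re (F r)" if r: "0 < r" "r < 1" for r
    proof -
      define fr where "fr = (\<lambda>z. f (of_real r * z))"
      have tc: "tcoeff fr j = of_real r ^ j * tcoeff f j" for j
        unfolding tcoeff_def fr_def bshift_pow_dilate[OF f r] by simp
      have eq: "F r = of_real C * fr z + of_real e * (\<Sum>k\<le>n. mult_op k (c k) fr z)"
        unfolding F_def mult_op_def tc unfolding fr_def bshift_pow_dilate[OF f r] ..
      have inb: "of_real r * w \<in> unit_disk" if "w \<in> ball 0 (1/r)" for w :: complex
        using that r by (simp add: norm_mult field_simps)
      have "fr holomorphic_on ball 0 (1/r)"
        unfolding fr_def
        by (rule holomorphic_on_compose_gen[OF _ f, unfolded o_def])
           (use inb in \<open>auto intro!: holomorphic_intros\<close>)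
      moreover have "0 \<le> Re (fr w)" if "cmod w \<le> 1" for w
      proof -
        have "cmod w < 1 / r" using that r by (meson le_less_trans less_divide_eq_1_pos)
        then have "w \<in> ball 0 (1/r)" by simp
        then show ?thesis unfolding fr_def using inb re by blast
      qed
      ultimately show ?thesis unfolding eq
        using r z e by (intro mult_op_bound_smooth[where R="1/r"]) (auto simp: C_def)
    qed
    have cont: "continuous_on {0..1} (\<lambda>r. g (of_real r * z))" if "g holomorphic_on unit_disk" for g
    proof (rule continuous_on_compose2[OF holomorphic_on_imp_continuous_on[OF that]])
      show "continuous_on {0..1} (\<lambda>r. complex_of_real r * z)" by (intro continuous_intros)
      show "(\<lambda>r. complex_of_real r * z) ` {0..1} \<subseteq> unit_disk"
      proof clarsimp
        fix r :: real assume r: "0 \<le> r" "r \<le> 1"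
        have "r * cmod z \<le> 1 * cmod z" using r by (intro mult_right_mono) auto
        then show "cmod (complex_of_real r * z) < 1" using r z by (simp add: norm_mult)
      qed
    qed
    have "continuous_on {0..1} F"
      unfolding F_def by (intro continuous_intros cont f bshift_holomorphic) auto
    then have "(F \<longlongrightarrow> F 1) (at 1 within {0..1})" by (simp add: continuous_on_def)
    then have "(F \<longlongrightarrow> F 1) (at_left 1)"
      by (simp add: at_within_Icc_at_left)
    then have "((\<lambda>r. Re (F r)) \<longlongrightarrow> Re (F 1)) (at_left 1)" by (rule tendsto_Re)
    moreover have "\<forall>\<^sub>F r in at_left 1. 0 \<le> Re (F r)"
      using eventually_radial
      by eventually_elim (use pos in auto)
    ultimately have "0 \<le> Re (F 1)" by (intro tendsto_lowerbound) auto
    then show ?thesis by (simp add: F1)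
  qed
  show ?thesis using main[of 1] main[of "-1"] by (simp add: C_def abs_le_iff)
qed

section \<open>The perturbation direction h = T f + R\<close>

definition trig :: "nat \<Rightarrow> (nat \<Rightarrow> complex) \<Rightarrow> complex \<Rightarrow> complex" where
  "trig n c z = (\<Sum>k\<le>n. c k * z ^ k + cnj (c k) / z ^ k)"

text \<open>The Laurent polynomial R. In each summand over \<open>j\<close> the second term is, on
  the circle, the conjugate of the first, so R is imaginary there. Only Taylor coefficients of order
  below \<open>n\<close> enter.\<close>

definition trig_corr :: "nat \<Rightarrow> (nat \<Rightarrow> complex) \<Rightarrow> (complex \<Rightarrow> complex) \<Rightarrow> complex \<Rightarrow> complex" where
  "trig_corr n c f z = \<i> * of_real (Im (c 0)) +
     (\<Sum>k\<le>n. \<Sum>j<k. c k * cnj (tcoeff f j) * z ^ (k - j) - cnj (c k) * tcoeff f j / z ^ (k - j))"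

text \<open>The imaginary part of \<open>c 0\<close>, irrelevant for the multiplier, carries the free imaginary constant.\<close>

definition perturb :: "nat \<Rightarrow> (nat \<Rightarrow> complex) \<Rightarrow> (complex \<Rightarrow> complex) \<Rightarrow> complex \<Rightarrow> complex" where
  "perturb n c f z = \<i> * of_real (Im (c 0)) + (\<Sum>k\<le>n. mult_op k (c k) f z)"

lemma perturb_holomorphic: "f holomorphic_on unit_disk \<Longrightarrow> perturb n c f holomorphic_on unit_disk"
  unfolding perturb_def by (intro holomorphic_intros mult_op_holomorphic) auto

lemma perturb_bound:
  assumes "f holomorphic_on unit_disk"
    and "\<And>z. z \<in> unit_disk \<Longrightarrow> 0 \<le> Re (f z)" and "z \<in> unit_disk"
  shows "\<bar>Re (perturb n c f z)\<bar> \<le> 2 * (\<Sum>k\<le>n. cmod (c k)) * Re (f z)"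
  using mult_op_bound[OF assms, where n=n and c=c] by (simp add: perturb_def)

text \<open>The poles of the two summands at 0 cancel. The left side is the holomorphic form used
  for estimates, the right side the algebraic form used for the equations at the points
  \<open>\<sigma> k\<close>.\<close>

lemma perturb_eq:
  assumes z: "z \<noteq> 0"
  shows "perturb n c f z = trig n c z * f z + trig_corr n c f z"
proof -
  have "mult_op k (c k) f z = (c k * z ^ k + cnj (c k) / z ^ k) * f z +
     (\<Sum>j<k. c k * cnj (tcoeff f j) * z ^ (k - j) - cnj (c k) * tcoeff f j / z ^ (k - j))" for k
  proof -
    have "(\<Sum>j<k. cnj (c k) * tcoeff f j / z ^ (k - j)) = cnj (c k) * ((\<Sum>j<k. tcoeff f j * z ^ j) / z ^ k)"
      unfolding sum_divide_distrib sum_distrib_left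
      using z by (intro sum.cong) (auto simp: power_diff)
    then show ?thesis
      unfolding mult_op_def bshift_pow_eq[OF z] sum_subtractf
      by (simp add: sum_distrib_left diff_divide_distrib algebra_simps)
  qed
  moreover have "(\<Sum>k\<le>n. (c k * z ^ k + cnj (c k) / z ^ k) * f z) = trig n c z * f z"
    unfolding trig_def sum_distrib_right ..
  ultimately show ?thesis
    by (simp only: perturb_def trig_corr_def sum.distrib add_ac)
qed

section \<open>Rational functions with positive real part\<close>

text \<open>Weights may be zero and points may coincide, so this expresses "at most N atoms" and is
  monotone in \<open>N\<close>.\<close>

definition herglotz_atoms :: "nat \<Rightarrow> (complex \<Rightarrow> complex) \<Rightarrow> bool" where
  "herglotz_atoms N f \<longleftrightarrow> (\<exists>s a b. (\<forall>j<N. s j \<in> sphere 0 1 \<and> (a j :: real) \<ge> 0) \<and>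
     (\<forall>z\<in>unit_disk. f z = \<i> * of_real (b::real) + (\<Sum>j<N. of_real (a j) * kern (s j) z)))"

lemma herglotz_atoms_Suc:
  assumes f: "herglotz_atoms N f" and s: "cmod s = 1" "m \<ge> 0"
    and g: "\<And>z. z \<in> unit_disk \<Longrightarrow> g z = f z + of_real m * kern s z"
  shows "herglotz_atoms (Suc N) g"
proof -
  obtain t a b where *: "\<forall>j<N. t j \<in> sphere 0 1 \<and> (a j :: real) \<ge> 0"
    "\<forall>z\<in>unit_disk. f z = \<i> * of_real (b::real) + (\<Sum>j<N. of_real (a j) * kern (t j) z)"
    using f unfolding herglotz_atoms_def by blast
  show ?thesis unfolding herglotz_atoms_def
  proof (intro exI conjI)
    show "\<forall>j<Suc N. (t(N := s)) j \<in> sphere 0 1 \<and> (a(N := m)) j \<ge> 0"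
      using * s by (auto simp: less_Suc_eq)
    show "\<forall>z\<in>unit_disk. g z = \<i> * of_real b + (\<Sum>j<Suc N. of_real ((a(N := m)) j) * kern ((t(N := s)) j) z)"
      using * g by simp
  qed
qed

lemma herglotz_atoms_mono:
  assumes "herglotz_atoms N f" "N \<le> M"
  shows "herglotz_atoms M f"
  using assms(2,1)
proof (induction rule: dec_induct)
  case (step k)
  then show ?case by (auto intro: herglotz_atoms_Suc[of k f 1 0])
qed

text \<open>Says that V / W is imaginary on the circle, multiplied by |W|^2 because \<open>W\<close>
  may have zeros there. The finite exceptional set makes it easy to cancel common factors;
  \<open>imag_quot_circle\<close> shows that it can always be emptied.\<close>

definition imag_quot :: "complex poly \<Rightarrow> complex poly \<Rightarrow> bool" where
  "imag_quot V W \<longleftrightarrow> (\<exists>S. finite S \<and> (\<forall>z. cmod z = 1 \<and> z \<notin> S \<longrightarrow> Re (poly V z * cnj (poly W z)) = 0))"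

text \<open>The circle has no isolated points, so removing finitely many points leaves a dense
  subset and continuity fills the gaps.\<close>

lemma imag_quot_circle:
  assumes "imag_quot V W" "cmod z = 1"
  shows "Re (poly V z * cnj (poly W z)) = 0"
proof -
  obtain S where S: "finite S" "\<And>z. cmod z = 1 \<Longrightarrow> z \<notin> S \<Longrightarrow> Re (poly V z * cnj (poly W z)) = 0"
    using assms(1) unfolding imag_quot_def by blast
  have "connected (sphere (0::complex) 1)" by (rule connected_sphere) simp
  moreover have "\<nexists>x. sphere (0::complex) 1 = {x}"
  proof
    assume "\<exists>x. sphere (0::complex) 1 = {x}"
    moreover have "1 \<in> sphere (0::complex) 1" "-1 \<in> sphere (0::complex) 1" by auto
    ultimately have "(1::complex) = -1" by (metis singletonD)
    then show False by simp
  qed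
  ultimately have "z islimpt (sphere 0 1)"
    using connected_imp_perfect[of "sphere 0 1" z] assms(2) by simp
  then have "z islimpt (sphere 0 1 - S)"
  proof -
    assume "z islimpt (sphere 0 1)"
    then have "z islimpt ((sphere 0 1 - S) \<union> S)" by (rule islimpt_subset) auto
    then show ?thesis using islimpt_finite[OF S(1), of z] unfolding islimpt_Un by blast
  qed
  then have "z \<in> closure (sphere 0 1 - S)" by (simp add: closure_def)
  moreover have "continuous_on (closure (sphere 0 1 - S)) (\<lambda>z. Re (poly V z * cnj (poly W z)))"
    by (intro continuous_intros)
  ultimately show ?thesis
    using S(2) continuous_constant_on_closure[of "sphere 0 1 - S" "\<lambda>z. Re (poly V z * cnj (poly W z))" 0 z]
    by fastforce
qed

lemma imag_quotI:
  assumes "finite S" "\<And>z. cmod z = 1 \<Longrightarrow> z \<notin> S \<Longrightarrow> Re (poly V z * cnj (poly W z)) = 0"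
  shows "imag_quot V W"
  using assms unfolding imag_quot_def by blast

lemma imag_quot_cancel:
  assumes "imag_quot ([:-a, 1:] * V) ([:-a, 1:] * W)"
  shows "imag_quot V W"
proof (rule imag_quotI[of "{a}"])
  fix z assume z: "cmod z = 1" "z \<notin> {a}"
  have "poly ([:-a, 1:] * V) z * cnj (poly ([:-a, 1:] * W) z) = ((z - a) * cnj (z - a)) * (poly V z * cnj (poly W z))"
    by (simp add: algebra_simps)
  also have "(z - a) * cnj (z - a) = of_real ((cmod (z - a))\<^sup>2)" by (simp only: complex_norm_square)
  finally have "(cmod (z - a))\<^sup>2 * Re (poly V z * cnj (poly W z)) = 0"
    using imag_quot_circle[OF assms z(1)] by simp
  then show "Re (poly V z * cnj (poly W z)) = 0" using z by simp
qed simp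

lemma poly_linear_mult: "poly ([:-a, 1:] * q) z = (z - a) * poly q (z::complex)"
  by (simp only: poly_mult) simp

lemma poly_linear_factor: "poly p a = 0 \<Longrightarrow> \<exists>q. p = [:-a, 1:] * (q :: complex poly)"
  unfolding poly_eq_0_iff_dvd dvd_def .

lemma continuous_eq_off_finite:
  fixes g h :: "complex \<Rightarrow> complex"
  assumes "continuous_on unit_disk g" "continuous_on unit_disk h" "finite S"
    and eq: "\<And>z. z \<in> unit_disk \<Longrightarrow> z \<notin> S \<Longrightarrow> g z = h z" and z: "z \<in> unit_disk"
  shows "g z = h z"
proof -
  have "isCont g z" "isCont h z"
    using assms by (auto simp: continuous_on_eq_continuous_at)
  then have "((\<lambda>w. g w - h w) \<longlongrightarrow> g z - h z) (at z)"
    unfolding isCont_def by (intro tendsto_diff)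
  moreover have "\<forall>\<^sub>F w in at z. w \<notin> S"
    using islimpt_finite[OF assms(3)] by (simp add: islimpt_iff_eventually)
  then have "\<forall>\<^sub>F w in at z. g w - h w = 0"
    using eventually_at_in_open'[OF open_ball z] by eventually_elim (use eq in auto)
  then have "((\<lambda>w. g w - h w) \<longlongrightarrow> 0) (at z)" by (rule tendsto_eventually)
  ultimately have "g z - h z = 0" by (rule tendsto_unique[rotated]) simp
  then show ?thesis by simp
qed

lemma poly_quot_cancel:
  assumes f: "continuous_on unit_disk f"
    and eq: "\<And>z. z \<in> unit_disk \<Longrightarrow> poly ([:-a, 1:] * W) z * f z = poly ([:-a, 1:] * V) z"
    and z: "z \<in> unit_disk"
  shows "poly W z * f z = poly V z"
proof (rule continuous_eq_off_finite[OF _ _ _ _ z, where S="{a}"])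
  show "continuous_on unit_disk (\<lambda>z. poly W z * f z)" "continuous_on unit_disk (poly V)"
    by (intro continuous_intros f)+
  show "poly W z * f z = poly V z" if "z \<in> unit_disk" "z \<notin> {a}" for z
  proof -
    have "(z - a) * (poly W z * f z) = (z - a) * poly V z"
      using eq[OF that(1)] by (simp add: algebra_simps)
    then show ?thesis using that(2) by simp
  qed
qed simp

text \<open>Along the radius \<open>V\<close> is a bounded factor times (1 - cnj s z) f z, so it
  tends to 0 when \<open>f\<close> has no atom at \<open>s\<close>. The denominator factor z - s
  then cancels against a zero of the numerator.\<close>

lemma poly_root_of_no_atom:
  assumes s: "cmod s = 1" and f: "continuous_on unit_disk f"
    and eq: "\<And>z. z \<in> unit_disk \<Longrightarrow> poly ([:-s, 1:] * W) z * f z = poly V z"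
    and lim: "((\<lambda>r. (1 - cnj s * (of_real r * s)) * f (of_real r * s)) \<longlongrightarrow> 0) (at_left 1)"
  obtains V1 where "V = [:-s, 1:] * V1" "\<And>z. z \<in> unit_disk \<Longrightarrow> poly W z * f z = poly V1 z"
proof -
  have "((\<lambda>r. - s * poly W (of_real r * s) * ((1 - cnj s * (of_real r * s)) * f (of_real r * s))) \<longlongrightarrow>
     - s * poly W (of_real 1 * s) * 0) (at_left 1)"
    by (intro tendsto_intros lim)
  moreover have "\<forall>\<^sub>F r in at_left (1::real). - s * poly W (of_real r * s) * ((1 - cnj s * (of_real r * s)) * f (of_real r * s))
       = poly V (of_real r * s)"
    using eventually_radial
  proof eventually_elim
    case (elim r)
    have "of_real r * s \<in> unit_disk" using elim s by (simp add: norm_mult)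
    from eq[OF this, unfolded poly_linear_mult, symmetric]
    have "poly V (of_real r * s) = - (s - of_real r * s) * poly W (of_real r * s) * f (of_real r * s)"
      by simp
    then show ?case unfolding diff_sphere_eq(1)[OF s, of "of_real r * s"] by (simp add: mult_ac)
  qed
  ultimately have "((\<lambda>r. poly V (of_real r * s)) \<longlongrightarrow> - s * poly W (of_real 1 * s) * 0) (at_left 1)"
    by (rule Lim_transform_eventually)
  moreover have "((\<lambda>r. poly V (of_real r * s)) \<longlongrightarrow> poly V (of_real 1 * s)) (at_left 1)"
    by (intro tendsto_intros)
  ultimately have "poly V (of_real 1 * s) = - s * poly W (of_real 1 * s) * 0"
    by (intro tendsto_unique[OF trivial_limit_at_left_real])
  then have "poly V s = 0" by simp
  then obtain V1 where V1: "V = [:-s, 1:] * V1" using poly_linear_factor by blast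
  show thesis
    by (rule that[OF V1]) (use eq V1 in \<open>blast intro: poly_quot_cancel[OF f]\<close>)
qed

text \<open>The maximum principle for F and - F makes \<open>Re f\<close> vanish in the disk;
  Harnack's inequality with right-hand side 0 then gives constancy.\<close>

lemma imaginary_constant_of_circle:
  assumes f: "f holomorphic_on unit_disk" and c: "continuous_on (cball 0 1) F"
    and eq: "\<And>z. z \<in> unit_disk \<Longrightarrow> F z = f z"
    and re: "\<And>z. cmod z = 1 \<Longrightarrow> Re (F z) = 0" and z: "z \<in> unit_disk"
  shows "f z = \<i> * of_real (Im (f 0))"
proof -
  have hF: "F holomorphic_on unit_disk"
    by (rule holomorphic_transform[OF f]) (simp add: eq)
  have le: "Re (F z) \<le> 0" if "z \<in> unit_disk" for z
    by (rule maximum_real_frontier[where S=unit_disk and f=F]) (use that hF c re in auto)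
  have ge: "Re (- F z) \<le> 0" if "z \<in> unit_disk" for z
    by (rule maximum_real_frontier[where S=unit_disk and f="\<lambda>z. - F z"])
       (use that hF c re in \<open>auto intro!: holomorphic_intros continuous_intros\<close>)
  have r0: "Re (f z) = 0" if "z \<in> unit_disk" for z
    using le[OF that] ge[OF that] eq[OF that] by simp
  have "(1 - (cmod z)\<^sup>2) * (1 - (cmod 0)\<^sup>2) * cmod (f z - \<i> * of_real (Im (f 0)))
     \<le> 4 * Re (f 0) * (cmod (1 - cnj 0 * z))\<^sup>2"
    by (rule harnack_upper) (use f r0 z in auto)
  then have "(1 - (cmod z)\<^sup>2) * cmod (f z - \<i> * of_real (Im (f 0))) \<le> 0" using r0[of 0] by simp
  moreover have "1 - (cmod z)\<^sup>2 > 0" using z by (simp add: abs_square_less_1)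
  ultimately show ?thesis by (simp add: mult_le_0_iff)
qed

text \<open>Induction over the zeros of the denominator in the closed disk. A zero inside is also a
  zero of \<open>V\<close> and cancels. A zero on the circle accounts for one atom, which is split
  off before cancelling. With no such zero left, \<open>f\<close> has continuous imaginary boundary
  values and is an imaginary constant. Hence the degree bounds the number of atoms.\<close>

theorem herglotz_rational:
  assumes "f holomorphic_on unit_disk" "\<And>z. z \<in> unit_disk \<Longrightarrow> 0 \<le> Re (f z)"
    and "W \<noteq> 0" "\<And>z. z \<in> unit_disk \<Longrightarrow> poly W z * f z = poly V z" "imag_quot V W"
  shows "herglotz_atoms (degree W) f"
  using assms
proof (induction "degree W" arbitrary: f V W rule: less_induct)
  case less
  note f = less.prems(1) and re = less.prems(2) and W = less.prems(3) and eq = less.prems(4) and iq = less.prems(5)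
  have fc: "continuous_on unit_disk f" by (rule holomorphic_on_imp_continuous_on[OF f])
  show ?case
  proof (cases "\<exists>a. poly W a = 0 \<and> cmod a \<le> 1")
    case False
    have "f z = \<i> * of_real (Im (f 0))" if "z \<in> unit_disk" for z
    proof (rule imaginary_constant_of_circle[OF f _ _ _ that, where F="\<lambda>z. poly V z / poly W z"])
      show "continuous_on (cball 0 1) (\<lambda>z. poly V z / poly W z)"
        using False by (intro continuous_intros) auto
      show "poly V z / poly W z = f z" if "z \<in> unit_disk" for z
      proof -
        have "poly W z \<noteq> 0" using False that by force
        then show ?thesis using eq[OF that] by (simp add: nonzero_divide_eq_eq mult.commute)
      qed
      show "Re (poly V z / poly W z) = 0" if "cmod z = 1" for z
        using imag_quot_circle[OF iq that] by (simp add: Re_complex_div_eq_0)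
    qed
    then obtain b where "\<forall>z\<in>unit_disk. f z = \<i> * of_real b" by blast
    then have "herglotz_atoms 0 f" unfolding herglotz_atoms_def
      by (intro exI[of _ "\<lambda>_. 1"] exI[of _ "\<lambda>_. 0"] exI[of _ b]) simp
    then show ?thesis by (rule herglotz_atoms_mono) simp
  next
    case True
    then obtain a where a: "poly W a = 0" "cmod a \<le> 1" by blast
    then obtain W1 where W1: "W = [:-a, 1:] * W1" using poly_linear_factor by blast
    have W1n: "W1 \<noteq> 0" using W W1 by auto
    have deg: "degree W = Suc (degree W1)" unfolding W1 using W1n by (subst degree_mult_eq) auto
    show ?thesis
    proof (cases "cmod a < 1")
      case True
      then have "poly V a = 0" using eq[of a] a by simp
      then obtain V1 where V1: "V = [:-a, 1:] * V1" using poly_linear_factor by blast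
      have "herglotz_atoms (degree W1) f"
      proof (rule less.hyps[OF _ f re W1n])
        show "poly W1 z * f z = poly V1 z" if "z \<in> unit_disk" for z
          by (rule poly_quot_cancel[OF fc _ that]) (use eq W1 V1 in blast)
        show "imag_quot V1 W1" using iq unfolding V1 W1 by (rule imag_quot_cancel)
      qed (use deg in auto)
      then show ?thesis by (rule herglotz_atoms_mono) (use deg in auto)
    next
      case False
      then have a1: "cmod a = 1" using a by simp
      obtain m where m: "m \<ge> 0" "\<And>z. z \<in> unit_disk \<Longrightarrow> m * Re (kern a z) \<le> Re (f z)"
        "angular_limit (\<lambda>z. (1 - cnj a * z) * f z) a (2 * of_real m)"
        using julia_caratheodory[OF f re a1] by blast
      define g where "g = (\<lambda>z. f z - of_real m * kern a z)"
      have g: "g holomorphic_on unit_disk" unfolding g_def using a1 by (intro holomorphic_intros f)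
      have gre: "0 \<le> Re (g z)" if "z \<in> unit_disk" for z using m(2)[OF that] by (simp add: g_def)
      \<comment> \<open>The numerator of \<open>g\<close> over \<open>W\<close>: as (z - a) kern a z
        = - (z + a), subtracting \<open>m kern\<close> adds m W1 (z + a).\<close>
      define V1 where "V1 = V + smult (of_real m) (W1 * [:a, 1:])"
      have geq: "poly ([:-a, 1:] * W1) z * g z = poly V1 z" if "z \<in> unit_disk" for z
      proof -
        have k: "(z - a) * kern a z = - (z + a)"
          using sphere_neq_disk[OF a1 that] by (simp add: kern_def field_simps)
        have e: "poly ([:-a, 1:] * W1) z * g z = poly V z - of_real m * poly W1 z * ((z - a) * kern a z)"
          using eq[OF that] unfolding W1 g_def by (simp add: algebra_simps)
        show ?thesis unfolding e k by (simp add: V1_def algebra_simps)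
      qed
      have "((\<lambda>r. (1 - cnj a * (of_real r * a)) * g (of_real r * a)) \<longlongrightarrow> 2 * of_real m - of_real m * (1 + cnj a * (of_real 1 * a))) (at_left 1)"
      proof (rule Lim_transform_eventually)
        show "((\<lambda>r. (1 - cnj a * (of_real r * a)) * f (of_real r * a) - of_real m * (1 + cnj a * (of_real r * a)))
           \<longlongrightarrow> 2 * of_real m - of_real m * (1 + cnj a * (of_real 1 * a))) (at_left 1)"
          by (rule tendsto_diff[OF angular_limit_radial[OF m(3) a1]]) (intro tendsto_intros)
        show "\<forall>\<^sub>F r in at_left (1::real). (1 - cnj a * (of_real r * a)) * f (of_real r * a) - of_real m * (1 + cnj a * (of_real r * a))
           = (1 - cnj a * (of_real r * a)) * g (of_real r * a)"
          using eventually_radial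
        proof eventually_elim
          case (elim r)
          have "of_real r * a \<in> unit_disk" using elim a1 by (simp add: norm_mult)
          from kern_mult[OF a1 this, symmetric] show ?case
            unfolding g_def by (simp add: right_diff_distrib mult.left_commute)
        qed
      qed
      moreover have "cnj a * a = 1" using a1 by (simp add: complex_norm_square[symmetric] mult.commute)
      ultimately have lim: "((\<lambda>r. (1 - cnj a * (of_real r * a)) * g (of_real r * a)) \<longlongrightarrow> 0) (at_left 1)" by simp
      obtain V2 where V2: "V1 = [:-a, 1:] * V2" "\<And>z. z \<in> unit_disk \<Longrightarrow> poly W1 z * g z = poly V2 z"
        using poly_root_of_no_atom[OF a1 holomorphic_on_imp_continuous_on[OF g] geq lim] by blast
      have "herglotz_atoms (degree W1) g"
      proof (rule less.hyps[OF _ g gre W1n V2(2)])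
        \<comment> \<open>The kernel is imaginary on the circle, in the form Re ((a + z) cnj (z -
          a)) = |z|^2 - |a|^2 = 0, so splitting off an atom keeps the boundary condition.\<close>
        have "imag_quot V1 W"
        proof (rule imag_quotI[of "{}"])
          fix z assume z: "cmod z = 1"
          have "poly V1 z * cnj (poly W z) = poly V z * cnj (poly W z)
             + of_real m * (poly W1 z * cnj (poly W1 z)) * ((a + z) * cnj (z - a))"
            unfolding V1_def W1 by (simp add: algebra_simps)
          moreover have "Re ((a + z) * cnj (z - a)) = (cmod z)\<^sup>2 - (cmod a)\<^sup>2"
            unfolding cmod_power2 by (simp add: algebra_simps power2_eq_square)
          moreover have "poly W1 z * cnj (poly W1 z) = of_real ((cmod (poly W1 z))\<^sup>2)"
            by (simp only: complex_norm_square)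
          ultimately show "Re (poly V1 z * cnj (poly W z)) = 0"
            using imag_quot_circle[OF iq z] z a1
            by (metis (no_types, lifting) Re_complex_of_real add.right_neutral diff_self mult_zero_right of_real_mult plus_complex.sel(1) times_complex.sel(1) Im_complex_of_real mult_zero_left)
        qed simp
        then show "imag_quot V2 W1" unfolding V2 W1 by (rule imag_quot_cancel)
      qed (use deg in auto)
      then have "herglotz_atoms (Suc (degree W1)) f"
        by (rule herglotz_atoms_Suc[OF _ a1 m(1)]) (simp add: g_def)
      then show ?thesis using deg by simp
    qed
  qed
qed

lemma poly_roots_of_no_atoms:
  assumes "finite Y" and "\<And>s. s \<in> Y \<Longrightarrow> cmod s = 1" and f: "continuous_on unit_disk f"
    and "\<And>z. z \<in> unit_disk \<Longrightarrow> poly ((\<Prod>s\<in>Y. [:-s, 1:]) * W) z * f z = poly V z"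
    and "\<And>s. s \<in> Y \<Longrightarrow> ((\<lambda>r. (1 - cnj s * (of_real r * s)) * f (of_real r * s)) \<longlongrightarrow> 0) (at_left 1)"
  obtains V1 where "V = (\<Prod>s\<in>Y. [:-s, 1:]) * V1" "\<And>z. z \<in> unit_disk \<Longrightarrow> poly W z * f z = poly V1 z"
  using assms(1,2,4,5)
proof (induction Y arbitrary: V thesis rule: finite_induct)
  case (insert s Y)
  obtain V1 where V1: "V = [:-s, 1:] * V1" "\<And>z. z \<in> unit_disk \<Longrightarrow> poly ((\<Prod>s\<in>Y. [:-s, 1:]) * W) z * f z = poly V1 z"
  proof (rule poly_root_of_no_atom[OF _ f])
    show "cmod s = 1" using insert by simp
    show "((\<lambda>r. (1 - cnj s * (of_real r * s)) * f (of_real r * s)) \<longlongrightarrow> 0) (at_left 1)" using insert by simp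
    show "poly ([:-s, 1:] * ((\<Prod>s\<in>Y. [:-s, 1:]) * W)) z * f z = poly V z" if "z \<in> unit_disk" for z
      using insert.prems(3)[OF that] insert.hyps by (simp add: mult.assoc del: mult_pCons_left poly_mult)
  qed blast
  obtain V2 where "V1 = (\<Prod>s\<in>Y. [:-s, 1:]) * V2" "\<And>z. z \<in> unit_disk \<Longrightarrow> poly W z * f z = poly V2 z"
    using insert.IH[OF _ _ V1(2)] insert.prems(2,4) by blast
  then show ?case using insert.prems(1)[of V2] V1(1) insert.hyps by (simp add: mult.assoc del: mult_pCons_left)
qed auto

lemma prod_linear_factors_dvd:
  fixes p :: "complex poly"
  assumes "finite S" "\<And>s. s \<in> S \<Longrightarrow> poly p s = 0"
  shows "(\<Prod>s\<in>S. [:-s, 1:]) dvd p"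
  using assms
proof (induction S arbitrary: p rule: finite_induct)
  case (insert s S)
  then have "poly p s = 0" by simp
  then obtain q where q: "p = [:-s, 1:] * q" using poly_linear_factor by blast
  have "poly q x = 0" if "x \<in> S" for x
  proof -
    have "poly p x = 0" "x \<noteq> s" using insert that by auto
    then show ?thesis by (simp add: q)
  qed
  then have "(\<Prod>s\<in>S. [:-s, 1:]) dvd q" by (rule insert.IH)
  then show ?case using insert.hyps by (simp add: q mult_dvd_mono del: mult_pCons_left)
qed simp

lemma degree_prod_linear_factors:
  "degree (\<Prod>s\<in>S. [:-s, 1:] :: complex poly) = card S"
  by (subst degree_prod_eq_sum_degree) auto

section \<open>Real linear systems with more unknowns than equations\<close>

lemma underdetermined_homogeneous:
  fixes a :: "nat \<Rightarrow> 'j \<Rightarrow> real"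
  assumes "finite J" "m < card J"
  shows "\<exists>x. (\<exists>j\<in>J. x j \<noteq> 0) \<and> (\<forall>i<m. (\<Sum>j\<in>J. a i j * x j) = 0)"
  using assms
proof (induction m arbitrary: a J)
  case 0
  then have "J \<noteq> {}" by auto
  then show ?case by (intro exI[of _ "\<lambda>_. 1"]) auto
next
  case (Suc m)
  show ?case
  proof (cases "\<exists>j0\<in>J. a m j0 \<noteq> 0")
    case False
    obtain x where "\<exists>j\<in>J. x j \<noteq> 0" "\<forall>i<m. (\<Sum>j\<in>J. a i j * x j) = 0"
      using Suc.IH[of J a] Suc.prems by auto
    then show ?thesis using False by (intro exI[of _ x]) (auto simp: less_Suc_eq)
  next
    case True
    then obtain j0 where j0: "j0 \<in> J" "a m j0 \<noteq> 0" by blast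
    \<comment> \<open>Row \<open>i\<close> after subtracting the multiple of row \<open>m\<close>
      that clears its coefficient at the pivot \<open>j0\<close>; the pivot unknown is recovered at
      the end from row \<open>m\<close>.\<close>
    define b where "b = (\<lambda>i j. a i j - a i j0 * a m j / a m j0)"
    have "m < card (J - {j0})" using Suc.prems j0 by simp
    then obtain x where x: "\<exists>j\<in>J - {j0}. x j \<noteq> 0" "\<forall>i<m. (\<Sum>j\<in>J - {j0}. b i j * x j) = 0"
      using Suc.IH[of "J - {j0}" b] Suc.prems by auto
    define S where "S = (\<Sum>j\<in>J - {j0}. a m j * x j)"
    define y where "y = x(j0 := - S / a m j0)"
    have yJ: "(\<Sum>j\<in>J. a i j * y j) = (\<Sum>j\<in>J - {j0}. a i j * x j) - a i j0 * S / a m j0" for i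
    proof -
      have "(\<Sum>j\<in>J. a i j * y j) = a i j0 * y j0 + (\<Sum>j\<in>J - {j0}. a i j * y j)"
        using Suc.prems(1) j0(1) by (rule sum.remove)
      also have "(\<Sum>j\<in>J - {j0}. a i j * y j) = (\<Sum>j\<in>J - {j0}. a i j * x j)"
        by (intro sum.cong) (auto simp: y_def)
      finally show ?thesis by (simp add: y_def)
    qed
    have bJ: "(\<Sum>j\<in>J - {j0}. b i j * x j) = (\<Sum>j\<in>J - {j0}. a i j * x j) - a i j0 * S / a m j0" for i
      unfolding b_def S_def
      by (simp add: left_diff_distrib sum_subtractf sum_distrib_left sum_divide_distrib mult.assoc)
    have "(\<Sum>j\<in>J. a i j * y j) = 0" if "i < Suc m" for i
    proof (cases "i = m")
      case True
      then show ?thesis using j0(2) by (simp add: yJ S_def[symmetric])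
    next
      case False
      then show ?thesis using that x(2) by (simp add: yJ bJ[symmetric])
    qed
    moreover have "\<exists>j\<in>J. y j \<noteq> 0" using x(1) by (auto simp: y_def)
    ultimately show ?thesis by blast
  qed
qed

text \<open>Each complex unknown counts as two real ones. Every real-linear functional of
  \<open>c\<close> has the form Sum Re (c k * u k), which is the origin of the minus sign before
  \<open>Im\<close> in the real matrix.\<close>

lemma underdetermined_homogeneous_complex:
  fixes u :: "nat \<Rightarrow> nat \<Rightarrow> complex"
  assumes "m < 2 * Suc n"
  obtains c where "\<exists>k\<le>n. c k \<noteq> 0" "\<And>i. i < m \<Longrightarrow> (\<Sum>k\<le>n. Re (c k * u i k)) = 0"
proof -
  define J where "J = {..n} \<times> (UNIV :: bool set)"
  define a where "a = (\<lambda>i (k, h). if h then Re (u i k) else - Im (u i k))"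
  have "finite J" "m < card J" using assms by (auto simp: J_def card_cartesian_product)
  then obtain x where x: "\<exists>j\<in>J. x j \<noteq> 0" "\<forall>i<m. (\<Sum>j\<in>J. a i j * x j) = 0"
    using underdetermined_homogeneous by blast
  define c where "c = (\<lambda>k. Complex (x (k, True)) (x (k, False)))"
  have "(\<Sum>j\<in>J. a i j * x j) = (\<Sum>k\<le>n. Re (c k * u i k))" for i
    by (simp add: J_def sum.cartesian_product' UNIV_bool a_def c_def algebra_simps)
  moreover have "\<exists>k\<le>n. c k \<noteq> 0"
    using x(1) unfolding J_def c_def
    by (auto simp: complex_eq_iff) (metis (full_types))
  ultimately show thesis using that x(2) by metis
qed

section \<open>From generators to Berkson--Porta functions\<close>

definition bp_factor :: "complex \<Rightarrow> complex \<Rightarrow> complex" where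
  "bp_factor \<tau> z = (\<tau> - z) * (1 - cnj \<tau> * z)"

text \<open>A mass \<open>M\<close> of \<open>1 / p\<close> at \<open>s\<close> means slope 1 / (2
  M) of \<open>p\<close>, and \<open>bp_factor \<tau> s\<close> is - s |\<tau> - s|^2, so the
  spectral value there is - |\<tau> - s|^2 / (2 M). For l < 0, a spectral value at least
  \<open>l\<close> thus amounts to a mass at least this weight.\<close>

definition atom_weight :: "complex \<Rightarrow> complex \<Rightarrow> real \<Rightarrow> real" where
  "atom_weight \<tau> s l = (cmod (\<tau> - s))\<^sup>2 / (2 * \<bar>l\<bar>)"

text \<open>The Berkson--Porta functions \<open>p\<close> for which \<open>1/p\<close> has at each \<open>\<sigma> k\<close> a Herglotz atom at
  least as heavy as that of \<open>p0\<close>.\<close>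

definition bp_class :: "complex \<Rightarrow> nat \<Rightarrow> (nat \<Rightarrow> complex) \<Rightarrow> (nat \<Rightarrow> real) \<Rightarrow> (complex \<Rightarrow> complex) \<Rightarrow> bool" where
  "bp_class \<tau> n \<sigma> \<Lambda> p \<longleftrightarrow> p holomorphic_on unit_disk \<and> (\<forall>z\<in>unit_disk. 0 < Re (p z)) \<and>
     (\<forall>k<n. \<forall>z\<in>unit_disk. atom_weight \<tau> (\<sigma> k) (\<Lambda> k) * Re (kern (\<sigma> k) z) \<le> Re (1 / p z))"

section \<open>Julia inequalities at the Denjoy--Wolff point and at boundary regular fixed
  points\<close>

lemma semigroup_disk: "hol_semigroup \<phi> \<Longrightarrow> t \<ge> 0 \<Longrightarrow> z \<in> unit_disk \<Longrightarrow> \<phi> t z \<in> unit_disk"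
  by (simp add: hol_semigroup_def image_subset_iff)

lemma tendsto_le_frequently:
  fixes f g :: "nat \<Rightarrow> real"
  assumes "f \<longlonglongrightarrow> a" "g \<longlonglongrightarrow> b" "\<exists>\<^sub>F k in sequentially. f k \<le> g k"
  shows "a \<le> b"
proof (rule ccontr)
  assume "\<not> a \<le> b"
  then have "0 < a - b" by simp
  then have "\<forall>\<^sub>F k in sequentially. 0 < f k - g k"
    by (rule order_tendstoD(1)[OF tendsto_diff[OF assms(1,2)]])
  then have "\<not> (\<exists>\<^sub>F k in sequentially. f k \<le> g k)"
    unfolding not_frequently by eventually_elim simp
  then show False using assms(3) by blast
qed

text \<open>Otherwise the sequence would eventually increase and stay above a positive term. It
  supplies infinitely many steps at which an orbit converging to the circle does not move away from
  it.\<close>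

lemma frequently_nonincreasing:
  fixes u :: "nat \<Rightarrow> real"
  assumes "u \<longlonglongrightarrow> 0" "\<And>k. u k > 0"
  shows "\<exists>\<^sub>F k in sequentially. u (Suc k) \<le> u k"
proof (rule ccontr)
  assume "\<not> ?thesis"
  then have "\<forall>\<^sub>F k in sequentially. u k < u (Suc k)"
    unfolding not_frequently by (simp add: not_le)
  then obtain N where N: "\<And>k. k \<ge> N \<Longrightarrow> u k < u (Suc k)" by (auto simp: eventually_sequentially)
  have "u N \<le> u k" if "k \<ge> N" for k
    using that by (induction rule: dec_induct) (use N in force)+
  then have "u N \<le> 0"
    by (intro tendsto_lowerbound[OF assms(1)]) (auto simp: eventually_sequentially)
  then show False using assms(2)[of N] by simp
qed

text \<open>For interior \<tau> this is Schwarz--Pick at the fixed point. For \<tau> on the circle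
  it is Wolff's lemma: Schwarz--Pick is applied at the points \<open>w k\<close> of the orbit of 0,
  which converge to \<tau>, and for infinitely many \<open>k\<close> the gap 1 - |w k|^2 does not
  grow in the next step. The form without denominators covers both cases.\<close>

lemma julia_denjoy_wolff:
  assumes sg: "hol_semigroup \<phi>" and dw: "dw_point \<phi> \<tau>" and t: "t \<ge> 0" and z: "z \<in> unit_disk"
  shows "(1 - (cmod z)\<^sup>2) * (cmod (1 - cnj \<tau> * \<phi> t z))\<^sup>2 \<le> (1 - (cmod (\<phi> t z))\<^sup>2) * (cmod (1 - cnj \<tau> * z))\<^sup>2"
proof -
  have hol: "\<phi> t holomorphic_on unit_disk" "\<phi> t ` unit_disk \<subseteq> unit_disk"
    using sg t unfolding hol_semigroup_def by blast+
  consider "\<tau> \<in> unit_disk" "\<phi> t \<tau> = \<tau>"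
    | "\<tau> \<in> sphere 0 1" "\<And>z. z \<in> unit_disk \<Longrightarrow> ((\<lambda>t. \<phi> t z) \<longlongrightarrow> \<tau>) at_top"
    using dw t unfolding dw_point_def by blast
  then show ?thesis
  proof cases
    case 1
    have "(1 - (cmod \<tau>)\<^sup>2) * ((1 - (cmod z)\<^sup>2) * (cmod (1 - cnj \<tau> * \<phi> t z))\<^sup>2)
       \<le> (1 - (cmod \<tau>)\<^sup>2) * ((1 - (cmod (\<phi> t z))\<^sup>2) * (cmod (1 - cnj \<tau> * z))\<^sup>2)"
      using schwarz_pick[OF hol z 1(1)] 1(2) by (simp add: mult_ac)
    moreover have "1 - (cmod \<tau>)\<^sup>2 > 0" using 1(1) by (simp add: abs_square_less_1)
    ultimately show ?thesis by (simp only: mult_le_cancel_left_pos)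
  next
    case 2
    show ?thesis
    proof (cases "t = 0")
      case True
      then show ?thesis using sg z by (simp add: hol_semigroup_def)
    next
      case False
      then have t0: "t > 0" using t by simp
      define w where "w = (\<lambda>k. \<phi> (real k * t) 0)"
      define u where "u = (\<lambda>k. 1 - (cmod (w k))\<^sup>2)"
      have wd: "w k \<in> unit_disk" for k
        unfolding w_def by (rule semigroup_disk[OF sg]) (use t0 in auto)
      have wS: "\<phi> t (w k) = w (Suc k)" for k
      proof -
        have "\<phi> (t + real k * t) 0 = \<phi> t (\<phi> (real k * t) 0)"
          using sg t0 unfolding hol_semigroup_def by auto
        moreover have "t + real k * t = real (Suc k) * t" by (simp add: algebra_simps)
        ultimately show ?thesis by (simp add: w_def)
      qed
      have "filterlim (\<lambda>k. real k * t) at_top sequentially"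
        using filterlim_tendsto_pos_mult_at_top[OF tendsto_const t0 filterlim_real_sequentially]
        by (simp add: mult.commute)
      then have wl: "w \<longlonglongrightarrow> \<tau>"
        unfolding w_def using 2(2)[of 0] by (auto intro: filterlim_compose)
      have "u \<longlonglongrightarrow> 1 - (cmod \<tau>)\<^sup>2" unfolding u_def by (intro tendsto_intros wl)
      then have ul: "u \<longlonglongrightarrow> 0" using 2(1) by simp
      have u0: "u k > 0" for k using wd[of k] by (simp add: u_def abs_square_less_1)
      have ineq: "(1 - (cmod z)\<^sup>2) * (cmod (1 - cnj (w (Suc k)) * \<phi> t z))\<^sup>2 \<le> (1 - (cmod (\<phi> t z))\<^sup>2) * (cmod (1 - cnj (w k) * z))\<^sup>2"
        if k: "u (Suc k) \<le> u k" for k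
      proof -
        have "1 - (cmod (\<phi> t z))\<^sup>2 \<ge> 0" using semigroup_disk[OF sg t z] by (simp add: abs_square_le_1)
        then have "(1 - (cmod (\<phi> t z))\<^sup>2) * u (Suc k) * (cmod (1 - cnj (w k) * z))\<^sup>2
            \<le> (1 - (cmod (\<phi> t z))\<^sup>2) * u k * (cmod (1 - cnj (w k) * z))\<^sup>2"
          using k by (intro mult_right_mono mult_left_mono) auto
        then have "u k * ((1 - (cmod z)\<^sup>2) * (cmod (1 - cnj (w (Suc k)) * \<phi> t z))\<^sup>2)
           \<le> u k * ((1 - (cmod (\<phi> t z))\<^sup>2) * (cmod (1 - cnj (w k) * z))\<^sup>2)"
          using schwarz_pick[OF hol z wd[of k]] unfolding wS u_def by (simp add: mult_ac)
        then show ?thesis using u0 by (simp only: mult_le_cancel_left_pos)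
      qed
      show ?thesis
      proof (rule tendsto_le_frequently)
        show "(\<lambda>k. (1 - (cmod z)\<^sup>2) * (cmod (1 - cnj (w (Suc k)) * \<phi> t z))\<^sup>2)
          \<longlonglongrightarrow> (1 - (cmod z)\<^sup>2) * (cmod (1 - cnj \<tau> * \<phi> t z))\<^sup>2"
          by (intro tendsto_intros LIMSEQ_Suc wl)
        show "(\<lambda>k. (1 - (cmod (\<phi> t z))\<^sup>2) * (cmod (1 - cnj (w k) * z))\<^sup>2)
          \<longlonglongrightarrow> (1 - (cmod (\<phi> t z))\<^sup>2) * (cmod (1 - cnj \<tau> * z))\<^sup>2"
          by (intro tendsto_intros wl)
        show "\<exists>\<^sub>F k in sequentially. (1 - (cmod z)\<^sup>2) * (cmod (1 - cnj (w (Suc k)) * \<phi> t z))\<^sup>2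
           \<le> (1 - (cmod (\<phi> t z))\<^sup>2) * (cmod (1 - cnj (w k) * z))\<^sup>2"
          using frequently_nonincreasing[OF ul u0] by (rule frequently_mono[rotated]) (use ineq in blast)
      qed
    qed
  qed
qed

text \<open>Schwarz--Pick is applied at the radial points r s. Because 1 - |w| \<le> |w - s|, the
  difference quotient \<open>D r\<close> controls the ratio of the distances to the circle after and
  before the map; its limit exp (- l t) becomes the dilation constant.\<close>

lemma julia_brfp:
  assumes sg: "hol_semigroup \<phi>" and br: "brfp \<phi> s l" and s: "cmod s = 1" and t: "t \<ge> 0" and z: "z \<in> unit_disk"
  shows "(1 - (cmod z)\<^sup>2) * (cmod (1 - cnj s * \<phi> t z))\<^sup>2
     \<le> exp (- l * t) * ((1 - (cmod (\<phi> t z))\<^sup>2) * (cmod (1 - cnj s * z))\<^sup>2)"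
proof -
  have hol: "\<phi> t holomorphic_on unit_disk" "\<phi> t ` unit_disk \<subseteq> unit_disk"
    using sg t unfolding hol_semigroup_def by blast+
  define w where "w = (\<lambda>r. complex_of_real r * s)"
  define D where "D = (\<lambda>r. (\<phi> t (w r) - s) / (w r - s))"
  have lw: "(w \<longlongrightarrow> s) (at_left 1)"
    using filterlim_radial[OF s, of 2] by (simp add: filterlim_at w_def)
  have lp: "((\<lambda>r. \<phi> t (w r)) \<longlongrightarrow> s) (at_left 1)"
    using br t s unfolding brfp_def w_def by (blast intro: angular_limit_radial)
  have lD: "(D \<longlongrightarrow> complex_of_real (exp (- l * t))) (at_left 1)"
    using br t s unfolding brfp_def w_def D_def
    by (intro angular_limit_radial[where f="\<lambda>z. (\<phi> t z - s) / (z - s)"]) blast+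
  define L where "L = (\<lambda>r. (1 - (cmod z)\<^sup>2) * (1 + r) * (cmod (1 - cnj (\<phi> t (w r)) * \<phi> t z))\<^sup>2)"
  define R where "R = (\<lambda>r. (1 - (cmod (\<phi> t z))\<^sup>2) * (cmod (D r) * (1 + cmod (\<phi> t (w r)))) * (cmod (1 - cnj (w r) * z))\<^sup>2)"
  have "(L \<longlongrightarrow> (1 - (cmod z)\<^sup>2) * (1 + 1) * (cmod (1 - cnj s * \<phi> t z))\<^sup>2) (at_left 1)"
    unfolding L_def by (intro tendsto_intros lp)
  moreover have "(R \<longlongrightarrow> (1 - (cmod (\<phi> t z))\<^sup>2) * (cmod (complex_of_real (exp (- l * t))) * (1 + cmod s)) * (cmod (1 - cnj s * z))\<^sup>2) (at_left 1)"
    unfolding R_def by (intro tendsto_intros lp lD lw)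
  moreover have "\<forall>\<^sub>F r in at_left 1. L r \<le> R r"
    using eventually_radial
  proof eventually_elim
    case (elim r)
    have wd: "w r \<in> unit_disk" using elim s by (simp add: w_def norm_mult)
    have nw: "cmod (w r) = r" using elim s by (simp add: w_def norm_mult)
    have "w r - s = of_real (r - 1) * s" by (simp add: w_def algebra_simps)
    then have ws: "cmod (w r - s) = 1 - r" using elim s by (simp only: norm_mult norm_of_real) simp
    have n: "cmod (\<phi> t (w r)) < 1" "cmod (\<phi> t z) < 1"
      using semigroup_disk[OF sg t wd] semigroup_disk[OF sg t z] by auto
    have "1 - cmod (\<phi> t (w r)) \<le> cmod (\<phi> t (w r) - s)"
      using norm_triangle_ineq3[of "\<phi> t (w r)" s] s by simp
    also have "\<dots> = cmod (D r) * (1 - r)"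
      using elim by (simp add: D_def norm_divide ws)
    finally have "(1 - cmod (\<phi> t (w r))) * (1 + cmod (\<phi> t (w r))) \<le> cmod (D r) * (1 - r) * (1 + cmod (\<phi> t (w r)))"
      by (rule mult_right_mono) simp
    then have b: "1 - (cmod (\<phi> t (w r)))\<^sup>2 \<le> (1 - r) * (cmod (D r) * (1 + cmod (\<phi> t (w r))))"
      by (simp add: algebra_simps power2_eq_square)
    have "(1 - r) * L r = (1 - (cmod z)\<^sup>2) * (1 - (cmod (w r))\<^sup>2) * (cmod (1 - cnj (\<phi> t (w r)) * \<phi> t z))\<^sup>2"
      by (simp add: L_def nw power2_eq_square algebra_simps)
    also have "\<dots> \<le> (1 - (cmod (\<phi> t z))\<^sup>2) * (1 - (cmod (\<phi> t (w r)))\<^sup>2) * (cmod (1 - cnj (w r) * z))\<^sup>2"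
      by (rule schwarz_pick[OF hol z wd])
    also have "\<dots> \<le> (1 - (cmod (\<phi> t z))\<^sup>2) * ((1 - r) * (cmod (D r) * (1 + cmod (\<phi> t (w r))))) * (cmod (1 - cnj (w r) * z))\<^sup>2"
      using n by (intro mult_right_mono mult_left_mono b) (auto simp: abs_square_le_1)
    also have "\<dots> = (1 - r) * R r" by (simp add: R_def)
    finally show ?case using elim by simp
  qed
  ultimately have h: "(1 - (cmod z)\<^sup>2) * (1 + 1) * (cmod (1 - cnj s * \<phi> t z))\<^sup>2
     \<le> (1 - (cmod (\<phi> t z))\<^sup>2) * (cmod (complex_of_real (exp (- l * t))) * (1 + cmod s)) * (cmod (1 - cnj s * z))\<^sup>2"
    by (intro tendsto_le[of "at_left 1" R _ L]) auto
  have gen: "a * b \<le> e * (c * d)" if "a * (1 + 1) * b \<le> c * (e * (1 + 1)) * d" for a b c d e :: real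
  proof -
    have "a * (1 + 1) * b = 2 * (a * b)" "c * (e * (1 + 1)) * d = 2 * (e * (c * d))" by simp_all
    with that show ?thesis by linarith
  qed
  have e: "cmod (complex_of_real (exp (- l * t))) = exp (- l * t)" by simp
  show ?thesis using h unfolding e s by (rule gen)
qed

section \<open>Differentiation at time zero and the Berkson--Porta form\<close>

lemma derivative_nonneg_at_left_endpoint:
  fixes F :: "real \<Rightarrow> real"
  assumes "(F has_real_derivative D) (at 0 within {0..})" "F 0 = 0" "\<And>t. t \<ge> 0 \<Longrightarrow> F t \<ge> 0"
  shows "D \<ge> 0"
proof -
  have "((\<lambda>t. (F t - F 0) / (t - 0)) \<longlongrightarrow> D) (at 0 within {0..})"
    using assms(1) by (simp add: has_field_derivative_iff)
  moreover have "\<forall>\<^sub>F t in at 0 within {0..}. 0 \<le> (F t - F 0) / (t - 0)"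
    unfolding eventually_at_filter using assms(2,3) by (auto intro!: always_eventually divide_nonneg_nonneg)
  ultimately show ?thesis
    by (intro tendsto_lowerbound) (auto simp: at_within_Ici_at_right)
qed

text \<open>Both sides of the assumed inequality agree at t = 0, so it may be differentiated there.
  With \<open>l = 0\<close> at the Denjoy--Wolff point this gives the positivity of
  \<open>p\<close>; at a boundary regular fixed point with spectral value \<open>l\<close> it leads
  to the point mass.\<close>

lemma generator_inequality:
  assumes g: "generates G \<phi>" and z: "z \<in> unit_disk" and p0: "\<phi> 0 z = z"
    and J: "\<And>t. t \<ge> 0 \<Longrightarrow> (1 - (cmod z)\<^sup>2) * (cmod (1 - cnj \<tau> * \<phi> t z))\<^sup>2
     \<le> exp (- l * t) * ((1 - (cmod (\<phi> t z))\<^sup>2) * (cmod (1 - cnj \<tau> * z))\<^sup>2)"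
  shows "l * (1 - (cmod z)\<^sup>2) * (cmod (1 - cnj \<tau> * z))\<^sup>2 \<le> 2 * Re (G z * cnj (bp_factor \<tau> z))"
proof -
  have vd: "((\<lambda>t. \<phi> t z) has_vector_derivative G z) (at 0 within {0..})"
    using g z p0 unfolding generates_def by fastforce
  define x where "x = (\<lambda>t. Re (\<phi> t z))"
  define y where "y = (\<lambda>t. Im (\<phi> t z))"
  have dx: "(x has_real_derivative Re (G z)) (at 0 within {0..})"
    and dy: "(y has_real_derivative Im (G z)) (at 0 within {0..})"
    using vd unfolding x_def y_def has_real_derivative_iff_has_vector_derivative has_vector_derivative_complex_iff
    by blast+
  define a b where "a = Re \<tau>" and "b = Im \<tau>"
  define A B where "A = (cmod (1 - cnj \<tau> * z))\<^sup>2" and "B = 1 - (cmod z)\<^sup>2"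
  \<comment> \<open>Right side minus left side of the inequality, written in real coordinates
    without moduli so that the real derivative rules apply.\<close>
  define F where "F = (\<lambda>t. exp (- l * t) * ((1 - (x t * x t + y t * y t)) * A)
     - B * ((1 - (a * x t + b * y t)) * (1 - (a * x t + b * y t)) + (a * y t - b * x t) * (a * y t - b * x t)))"
  have Feq: "F t = exp (- l * t) * ((1 - (cmod (\<phi> t z))\<^sup>2) * A) - B * (cmod (1 - cnj \<tau> * \<phi> t z))\<^sup>2" for t
    unfolding F_def cmod_power2 x_def y_def a_def b_def by (simp add: power2_eq_square algebra_simps)
  have xy0: "x 0 = Re z" "y 0 = Im z" using p0 by (simp_all add: x_def y_def)
  define D where "D = - l * (B * A) - 2 * (Re z * Re (G z) + Im z * Im (G z)) * A
     - B * (- 2 * (1 - (a * Re z + b * Im z)) * (a * Re (G z) + b * Im (G z)) + 2 * (a * Im z - b * Re z) * (a * Im (G z) - b * Re (G z)))"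
  have "(F has_real_derivative D) (at 0 within {0..})"
    unfolding F_def D_def
    apply (rule derivative_eq_intros dx dy refl)+
    apply (simp add: xy0 B_def cmod_power2)
    apply (simp add: algebra_simps power2_eq_square)
    done
  moreover have "F 0 = 0" by (simp add: Feq p0 A_def B_def)
  moreover have "F t \<ge> 0" if "t \<ge> 0" for t using J[OF that] by (simp add: Feq A_def B_def)
  ultimately have "D \<ge> 0" by (rule derivative_nonneg_at_left_endpoint)
  moreover have "D = 2 * Re (G z * cnj (bp_factor \<tau> z)) - l * B * A"
    unfolding D_def bp_factor_def A_def B_def cmod_power2 a_def b_def
    by (simp add: power2_eq_square algebra_simps)
  ultimately show ?thesis by (simp add: A_def B_def)
qed

lemma bp_factor_nonzero: "z \<in> unit_disk \<Longrightarrow> cmod \<tau> \<le> 1 \<Longrightarrow> z \<noteq> \<tau> \<Longrightarrow> bp_factor \<tau> z \<noteq> 0"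
  using one_minus_cnj_mult_nonzero[of \<tau> z] by (simp add: bp_factor_def)

lemma bp_factor_sphere:
  assumes s: "cmod s = 1"
  shows "bp_factor s z = s * (1 - cnj s * z)\<^sup>2" "bp_factor \<tau> s = - s * of_real ((cmod (\<tau> - s))\<^sup>2)"
proof -
  show "bp_factor s z = s * (1 - cnj s * z)\<^sup>2"
    unfolding bp_factor_def diff_sphere_eq(1)[OF s] by (simp add: power2_eq_square)
  have c: "s * cnj s = 1" using s by (simp add: complex_norm_square[symmetric])
  have "1 - cnj \<tau> * s = s * (cnj s - cnj \<tau>)" using c by (simp add: right_diff_distrib mult.commute)
  then have "bp_factor \<tau> s = - s * ((\<tau> - s) * cnj (\<tau> - s))"
    by (simp add: bp_factor_def algebra_simps)
  then show "bp_factor \<tau> s = - s * of_real ((cmod (\<tau> - s))\<^sup>2)" by (simp only: complex_norm_square)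
qed

lemma Re_divide_alt: "Re (x / y) = Re (x * cnj y) / (cmod y)\<^sup>2"
  by (metis Re_divide_of_real complex_div_cnj of_real_power)

text \<open>\<open>p\<close> is the quotient of \<open>G\<close> by \<open>bp_factor\<close>. The
  factor 1 - cnj \<tau> z has no zero in the disk; for interior \<tau> the zero of \<tau> - z is
  removable since G \<tau> = 0, and the sign at that point follows by continuity.\<close>

lemma berkson_porta_factorization:
  assumes G: "G holomorphic_on unit_disk" and \<tau>: "cmod \<tau> \<le> 1"
    and z\<tau>: "\<tau> \<in> unit_disk \<Longrightarrow> G \<tau> = 0"
    and ineq: "\<And>z. z \<in> unit_disk \<Longrightarrow> 0 \<le> Re (G z * cnj (bp_factor \<tau> z))"
  obtains p where "p holomorphic_on unit_disk" "\<And>z. z \<in> unit_disk \<Longrightarrow> 0 \<le> Re (p z)"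
    "\<And>z. z \<in> unit_disk \<Longrightarrow> G z = bp_factor \<tau> z * p z"
proof -
  have n: "1 - cnj \<tau> * z \<noteq> 0" if "z \<in> unit_disk" for z
    using one_minus_cnj_mult_nonzero[of \<tau> z] \<tau> that by simp
  obtain q where q: "q holomorphic_on unit_disk" "\<And>z. z \<in> unit_disk \<Longrightarrow> G z = (\<tau> - z) * q z"
  proof (cases "\<tau> \<in> unit_disk")
    case True
    define q where "q = (\<lambda>z. - (if z = \<tau> then deriv G \<tau> else (G z - G \<tau>) / (z - \<tau>)))"
    show thesis
    proof (rule that)
      show "q holomorphic_on unit_disk"
        unfolding q_def by (intro holomorphic_on_minus pole_lemma G) (use True in simp)
      show "G z = (\<tau> - z) * q z" for z
        using z\<tau>[OF True] by (auto simp: q_def field_simps)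
    qed
  next
    case False
    show thesis
    proof (rule that[of "\<lambda>z. G z / (\<tau> - z)"])
      show "(\<lambda>z. G z / (\<tau> - z)) holomorphic_on unit_disk"
        using False by (intro holomorphic_intros G) auto
      show "G z = (\<tau> - z) * (G z / (\<tau> - z))" if "z \<in> unit_disk" for z
        using False that by auto
    qed
  qed
  define p where "p = (\<lambda>z. q z / (1 - cnj \<tau> * z))"
  have p: "p holomorphic_on unit_disk"
    unfolding p_def using n by (intro holomorphic_intros q)
  have Gp: "G z = bp_factor \<tau> z * p z" if "z \<in> unit_disk" for z
    using n[OF that] q(2)[OF that] by (simp add: p_def bp_factor_def)
  have re: "0 \<le> Re (p z)" if z: "z \<in> unit_disk" "z \<noteq> \<tau>" for z
  proof -
    have "p z = G z / bp_factor \<tau> z" using Gp[OF z(1)] bp_factor_nonzero[OF z(1) \<tau> z(2)] by simp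
    then show ?thesis using ineq[OF z(1)] by (simp only: Re_divide_alt) (simp add: divide_nonneg_nonneg)
  qed
  have "0 \<le> Re (p z)" if z: "z \<in> unit_disk" for z
  proof (cases "z = \<tau>")
    case True
    have "isCont p z"
      using holomorphic_on_imp_continuous_on[OF p] z by (simp add: continuous_on_eq_continuous_at)
    then have "((\<lambda>w. Re (p w)) \<longlongrightarrow> Re (p z)) (at z)" unfolding isCont_def by (rule tendsto_Re)
    moreover have "\<forall>\<^sub>F w in at z. 0 \<le> Re (p w)"
      using eventually_at_in_open'[OF open_ball z] eventually_neq_at_within[of z z UNIV]
      by eventually_elim (use re True in auto)
    ultimately show ?thesis by (intro tendsto_lowerbound) auto
  qed (use re z in auto)
  with p Gp show thesis using that by blast
qed

lemma one_minus_of_real_nonzero: "r < 1 \<Longrightarrow> 1 - complex_of_real r \<noteq> 0"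
  by (auto simp: complex_eq_iff)

text \<open>On the radius (1 - cnj s z) / p z and p z / (1 - r) are reciprocal, so mass and slope
  satisfy 2 M \<alpha> = 1 and a finite slope forces a positive mass. The slope depends linearly on
  \<open>p\<close>, the mass does not.\<close>

lemma reciprocal_atom:
  assumes p: "p holomorphic_on unit_disk" "\<And>z. z \<in> unit_disk \<Longrightarrow> 0 < Re (p z)" and s: "cmod s = 1"
    and lim: "((\<lambda>r. p (of_real r * s) / (1 - of_real r)) \<longlongrightarrow> \<alpha>) (at_left 1)"
  obtains M where "M > 0" "\<alpha> = of_real (1 / (2 * M))"
    "\<And>z. z \<in> unit_disk \<Longrightarrow> M * Re (kern s z) \<le> Re (1 / p z)"
proof -
  have nz: "p z \<noteq> 0" if "z \<in> unit_disk" for z using p(2)[OF that] by auto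
  have hq: "(\<lambda>z. 1 / p z) holomorphic_on unit_disk" using nz by (intro holomorphic_intros p)
  have req: "0 \<le> Re (1 / p z)" if "z \<in> unit_disk" for z
    using p(2)[OF that] by (simp add: Re_divide_alt)
  obtain M where M: "M \<ge> 0" "\<And>z. z \<in> unit_disk \<Longrightarrow> M * Re (kern s z) \<le> Re (1 / p z)"
    "angular_limit (\<lambda>z. (1 - cnj s * z) * (1 / p z)) s (2 * of_real M)"
    using julia_caratheodory[OF hq req s] by blast
  have c: "cnj s * s = 1" using s by (simp add: complex_norm_square[symmetric] mult.commute)
  have "((\<lambda>r. (1 - cnj s * (of_real r * s)) * (1 / p (of_real r * s)) * (p (of_real r * s) / (1 - of_real r))) \<longlongrightarrow> 2 * of_real M * \<alpha>) (at_left 1)"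
    by (intro tendsto_mult[OF angular_limit_radial[OF M(3) s] lim])
  moreover have "\<forall>\<^sub>F r in at_left (1::real). (1 - cnj s * (of_real r * s)) * (1 / p (of_real r * s)) * (p (of_real r * s) / (1 - of_real r)) = 1"
    using eventually_radial
  proof eventually_elim
    case (elim r)
    have "of_real r * s \<in> unit_disk" using elim s by (simp add: norm_mult)
    note n = nz[OF this]
    have "1 - complex_of_real r \<noteq> 0" using elim by (simp add: one_minus_of_real_nonzero)
    moreover have "1 - cnj s * (of_real r * s) = 1 - of_real r" using c by (simp add: mult.left_commute)
    ultimately show ?case using n by simp
  qed
  ultimately have "((\<lambda>_. 1) \<longlongrightarrow> 2 * of_real M * \<alpha>) (at_left (1::real))" by (rule Lim_transform_eventually)
  then have e: "2 * of_real M * \<alpha> = 1" by (simp add: tendsto_const_iff)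
  then have "M \<noteq> 0" by auto
  with M(1) have M0: "M > 0" by simp
  moreover have "\<alpha> = of_real (1 / (2 * M))" using e M0 by (simp add: field_simps)
  ultimately show thesis using that M(2) by blast
qed

lemma generator_imp_bp_class:
  assumes n: "n \<ge> 1" and \<sigma>: "\<forall>k<n. \<sigma> k \<in> sphere 0 1" and \<tau>: "\<tau> \<in> cball 0 1" "\<tau> \<notin> \<sigma> ` {..<n}"
    and G: "G \<in> Gen_FL \<tau> n \<sigma> \<Lambda>" and G0: "\<exists>z. G z \<noteq> 0"
  obtains p where "bp_class \<tau> n \<sigma> \<Lambda> p" "\<And>z. z \<in> unit_disk \<Longrightarrow> G z = bp_factor \<tau> z * p z"
proof -
  obtain \<phi> where sg: "hol_semigroup \<phi>" and gen: "generates G \<phi>" and dw: "dw_point \<phi> \<tau>"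
    and br: "\<And>k. k < n \<Longrightarrow> \<exists>lam. \<Lambda> k \<le> lam \<and> lam \<le> 0 \<and> brfp \<phi> (\<sigma> k) lam"
    and off: "\<And>z. z \<notin> unit_disk \<Longrightarrow> G z = 0"
    using G G0 unfolding Gen_FL_def by blast
  have hG: "G holomorphic_on unit_disk" using gen by (simp add: generates_def)
  have t1: "cmod \<tau> \<le> 1" using \<tau> by simp
  have id0: "\<phi> 0 z = z" if "z \<in> unit_disk" for z using sg that by (simp add: hol_semigroup_def)
  have "0 \<le> Re (G z * cnj (bp_factor \<tau> z))" if z: "z \<in> unit_disk" for z
    using generator_inequality[OF gen z id0[OF z], of \<tau> 0] julia_denjoy_wolff[OF sg dw _ z] by simp
  moreover have "G \<tau> = 0" if t: "\<tau> \<in> unit_disk"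
  proof -
    have "((\<lambda>s. \<phi> s \<tau>) has_vector_derivative G (\<phi> 0 \<tau>)) (at 0 within {0..})"
      using gen t unfolding generates_def by auto
    moreover have fx: "\<phi> s \<tau> = \<tau>" if "s \<ge> 0" for s
      using dw t that unfolding dw_point_def by auto
    have "((\<lambda>s. \<phi> s \<tau>) has_vector_derivative 0) (at 0 within {0..})"
      by (rule has_vector_derivative_transform[of 0 "{0..}" _ "\<lambda>_. \<tau>"]) (use fx in auto)
    ultimately have "G (\<phi> 0 \<tau>) = 0"
      by (rule vector_derivative_unique_within[rotated]) (simp add: at_within_Ici_at_right)
    then show ?thesis using fx by simp
  qed
  ultimately obtain p where p: "p holomorphic_on unit_disk" "\<And>z. z \<in> unit_disk \<Longrightarrow> 0 \<le> Re (p z)"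
    "\<And>z. z \<in> unit_disk \<Longrightarrow> G z = bp_factor \<tau> z * p z"
    using berkson_porta_factorization[OF hG t1] by metis
  have slope: "\<exists>\<alpha>. ((\<lambda>r. p (of_real r * \<sigma> k) / (1 - of_real r)) \<longlongrightarrow> of_real \<alpha>) (at_left 1)
     \<and> \<alpha> * (cmod (\<tau> - \<sigma> k))\<^sup>2 \<le> - \<Lambda> k" if k: "k < n" for k
  proof -
    define s where "s = \<sigma> k"
    have s: "cmod s = 1" using \<sigma> k by (simp add: s_def)
    have ts: "\<tau> \<noteq> s" using \<tau>(2) k by (auto simp: s_def)
    obtain l where l: "\<Lambda> k \<le> l" "brfp \<phi> s l" using br[OF k] s_def by blast
    \<comment> \<open>The generator inequality at \<open>s\<close>, divided by |bp_factor s z|^2,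
      says that this function has nonnegative real part. Its point mass at \<open>s\<close> then
      yields the slope of \<open>p\<close>.\<close>
    define H where "H = (\<lambda>z. 2 * G z / bp_factor s z - of_real l * kern s z)"
    have bn: "bp_factor s z \<noteq> 0" if "z \<in> unit_disk" for z
      using bp_factor_nonzero[OF that, of s] sphere_neq_disk[OF s that] s by auto
    have hH: "H holomorphic_on unit_disk"
      unfolding H_def using bn s
      by (intro holomorphic_intros hG) (auto simp: bp_factor_def[abs_def] intro!: holomorphic_intros)
    have reH: "0 \<le> Re (H z)" if z: "z \<in> unit_disk" for z
    proof -
      define N where "N = (cmod (s - z))\<^sup>2"
      define B where "B = 1 - (cmod z)\<^sup>2"
      have N: "N > 0" using sphere_neq_disk[OF s z] by (simp add: N_def)
      have nb: "cmod (bp_factor s z) = N"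
        unfolding bp_factor_sphere[OF s] N_def by (simp add: norm_mult norm_power s diff_sphere_eq(2)[OF s])
      have "l * B * N \<le> 2 * Re (G z * cnj (bp_factor s z))"
        unfolding B_def N_def diff_sphere_eq(2)[OF s, symmetric]
        by (rule generator_inequality[OF gen z id0[OF z]]) (rule julia_brfp[OF sg l(2) s _ z])
      then have "l * B * N / N\<^sup>2 \<le> 2 * Re (G z * cnj (bp_factor s z)) / N\<^sup>2"
        by (rule divide_right_mono) simp
      moreover have "l * B * N / N\<^sup>2 = l * (B / N)" using N by (simp add: power2_eq_square)
      moreover have "Re (2 * G z / bp_factor s z) = 2 * Re (G z * cnj (bp_factor s z)) / N\<^sup>2"
        unfolding Re_divide_alt nb by simp
      moreover have "Re (H z) = Re (2 * G z / bp_factor s z) - l * (B / N)"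
        unfolding H_def B_def N_def Re_kern[OF s, symmetric] by simp
      ultimately show ?thesis by linarith
    qed
    obtain m where "m \<ge> 0" "\<And>z. z \<in> unit_disk \<Longrightarrow> m * Re (kern s z) \<le> Re (H z)"
      "angular_limit (\<lambda>z. (1 - cnj s * z) * H z) s (2 * of_real m)"
      using julia_caratheodory[OF hH reH s] by blast
    note m = this(1,3)
    define d where "d = (cmod (\<tau> - s))\<^sup>2"
    have d: "d > 0" using ts by (simp add: d_def)
    \<comment> \<open>Along the radius (1 - r) H tends to 2 m, (1 - r) kern to 2 and bp_factor
      \<tau> to - s d. Solving for p / (1 - r) gives this limit, which is at most - l / d because m
      \<ge> 0.\<close>
    define \<alpha> where "\<alpha> = - (m + l) / d"
    have c: "cnj s * s = 1" "s * cnj s = 1" using s by (simp_all add: complex_norm_square[symmetric] mult.commute)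
    have s0: "s \<noteq> 0" using s by auto
    define E where "E = (\<lambda>r. bp_factor \<tau> (complex_of_real r * s))"
    have lE: "(E \<longlongrightarrow> - s * of_real d) (at_left 1)"
    proof -
      have "(E \<longlongrightarrow> bp_factor \<tau> (of_real 1 * s)) (at_left 1)"
        unfolding E_def bp_factor_def by (intro tendsto_intros)
      then show ?thesis using bp_factor_sphere(2)[OF s, of \<tau>] by (simp add: d_def)
    qed
    have "((\<lambda>r. ((1 - cnj s * (of_real r * s)) * H (of_real r * s) + of_real l * (1 + of_real r)) * s / (2 * E r))
        \<longlongrightarrow> (2 * of_real m + of_real l * (1 + of_real 1)) * s / (2 * (- s * of_real d))) (at_left 1)"
      using d s0 by (intro tendsto_intros angular_limit_radial[OF m(2) s] lE) auto
    moreover have "(2 * of_real m + of_real l * (1 + of_real 1)) * s / (2 * (- s * of_real d)) = complex_of_real \<alpha>"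
      using d s0 by (simp add: \<alpha>_def field_simps)
    ultimately have lim: "((\<lambda>r. ((1 - cnj s * (of_real r * s)) * H (of_real r * s) + of_real l * (1 + of_real r)) * s / (2 * E r))
        \<longlongrightarrow> complex_of_real \<alpha>) (at_left 1)" by (simp only:)
    have ev: "\<forall>\<^sub>F r in at_left (1::real). r \<in> {0<..<1}"
      by (rule eventually_at_left_real) simp
    have "\<forall>\<^sub>F r in at_left (1::real). E r \<noteq> 0"
      using d s0 by (intro tendsto_imp_eventually_ne[OF lE]) auto
    then have "\<forall>\<^sub>F r in at_left (1::real). ((1 - cnj s * (of_real r * s)) * H (of_real r * s) + of_real l * (1 + of_real r)) * s / (2 * E r)
        = p (of_real r * s) / (1 - of_real r)"
      using ev
    proof eventually_elim
      case (elim r)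
      define z where "z = complex_of_real r * s"
      define x where "x = 1 - complex_of_real r"
      have z: "z \<in> unit_disk" using elim s by (simp add: z_def norm_mult)
      have x0: "x \<noteq> 0" using elim by (simp add: x_def one_minus_of_real_nonzero)
      have cz: "cnj s * z = of_real r" using c by (simp add: z_def mult.left_commute)
      have "x * H z = 2 * E r * p z / (s * x) - of_real l * (x * kern s z)"
        unfolding H_def p(3)[OF z] bp_factor_sphere(1)[OF s] cz
        using x0 s0 by (simp add: x_def[symmetric] E_def z_def right_diff_distrib power2_eq_square)
      also have "x * kern s z = 1 + of_real r" using kern_mult[OF s z] by (simp add: cz x_def)
      finally have "x * H z + of_real l * (1 + of_real r) = 2 * E r * p z / (s * x)" by simp
      then have "(x * H z + of_real l * (1 + of_real r)) * s / (2 * E r) = 2 * E r * p z / (s * x) * s / (2 * E r)"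
        by (rule arg_cong[of _ _ "\<lambda>y. y * s / (2 * E r)"])
      also have "\<dots> = p z / x" using elim s0 x0 by simp
      finally show ?case unfolding z_def[symmetric] cz x_def[symmetric] .
    qed
    with lim have "((\<lambda>r. p (of_real r * s) / (1 - of_real r)) \<longlongrightarrow> complex_of_real \<alpha>) (at_left 1)"
      by (rule Lim_transform_eventually)
    moreover have "\<alpha> * d \<le> - \<Lambda> k" using d m(1) l(1) by (simp add: \<alpha>_def)
    ultimately show ?thesis unfolding s_def d_def by blast
  qed
  \<comment> \<open>A zero of \<open>Re p\<close> would make \<open>p\<close> an imaginary constant
    by Harnack's inequality. The finite slope at one boundary fixed point forces this constant to be
    0, against G being nonzero; here n \<ge> 1 enters.\<close>
  have pos: "0 < Re (p w)" if w: "w \<in> unit_disk" for w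
  proof (rule ccontr)
    assume "\<not> 0 < Re (p w)"
    then have w0: "Re (p w) = 0" using p(2)[OF w] by simp
    define c where "c = \<i> * complex_of_real (Im (p w))"
    have const: "p z = c" if z: "z \<in> unit_disk" for z
    proof -
      have "(1 - (cmod z)\<^sup>2) * (1 - (cmod w)\<^sup>2) * cmod (p z - c) \<le> 4 * Re (p w) * (cmod (1 - cnj w * z))\<^sup>2"
        unfolding c_def by (rule harnack_upper[OF p(1,2) z w])
      moreover have "(1 - (cmod z)\<^sup>2) * (1 - (cmod w)\<^sup>2) > 0"
        using z w by (auto simp: abs_square_less_1)
      ultimately have "cmod (p z - c) \<le> 0"
        using w0 by (metis mult_zero_left mult_zero_right mult_le_cancel_left_pos)
      then show ?thesis by simp
    qed
    have k: "0 < n" using n by simp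
    define s where "s = \<sigma> 0"
    have s: "cmod s = 1" using \<sigma> k by (simp add: s_def)
    obtain \<alpha> where "((\<lambda>r. p (of_real r * s) / (1 - of_real r)) \<longlongrightarrow> of_real \<alpha>) (at_left 1)"
      using slope[OF k] unfolding s_def by blast
    then have "((\<lambda>r. p (of_real r * s) / (1 - of_real r) * (1 - of_real r)) \<longlongrightarrow> of_real \<alpha> * (1 - of_real 1)) (at_left 1)"
      by (intro tendsto_intros)
    moreover have "\<forall>\<^sub>F r in at_left (1::real). p (of_real r * s) / (1 - of_real r) * (1 - of_real r) = c"
      using eventually_radial
    proof eventually_elim
      case (elim r)
      have "of_real r * s \<in> unit_disk" using elim s by (simp add: norm_mult)
      moreover have "1 - complex_of_real r \<noteq> 0" using elim by (simp add: one_minus_of_real_nonzero)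
      ultimately show ?case using const by simp
    qed
    ultimately have "((\<lambda>_. c) \<longlongrightarrow> of_real \<alpha> * (1 - of_real 1)) (at_left (1::real))" by (rule Lim_transform_eventually)
    then have "c = 0" by (simp add: tendsto_const_iff)
    then have "G z = 0" for z using off[of z] p(3)[of z] const[of z] by (cases "z \<in> unit_disk") auto
    then show False using G0 by blast
  qed
  have "atom_weight \<tau> (\<sigma> k) (\<Lambda> k) * Re (kern (\<sigma> k) z) \<le> Re (1 / p z)" if k: "k < n" and z: "z \<in> unit_disk" for k z
  proof -
    have s: "cmod (\<sigma> k) = 1" using \<sigma> k by simp
    define d where "d = (cmod (\<tau> - \<sigma> k))\<^sup>2"
    obtain \<alpha> where \<alpha>: "((\<lambda>r. p (of_real r * \<sigma> k) / (1 - of_real r)) \<longlongrightarrow> of_real \<alpha>) (at_left 1)"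
      "\<alpha> * d \<le> - \<Lambda> k" using slope[OF k] unfolding d_def by blast
    obtain M where M: "M > 0" "complex_of_real \<alpha> = of_real (1 / (2 * M))"
      "\<And>z. z \<in> unit_disk \<Longrightarrow> M * Re (kern (\<sigma> k) z) \<le> Re (1 / p z)"
      using reciprocal_atom[OF p(1) pos s \<alpha>(1)] by blast
    have a: "\<alpha> = 1 / (2 * M)" using M(2) unfolding of_real_eq_iff .
    have d0: "d \<ge> 0" by (simp add: d_def)
    have "d / (2 * M) \<le> \<bar>\<Lambda> k\<bar>" using \<alpha>(2) by (simp add: a)
    then have "d \<le> \<bar>\<Lambda> k\<bar> * (2 * M)" using M(1) by (simp add: pos_divide_le_eq)
    then have "d / (2 * \<bar>\<Lambda> k\<bar>) \<le> M"
      using M(1) by (cases "\<Lambda> k = 0") (auto simp: pos_divide_le_eq mult_ac)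
    then have "atom_weight \<tau> (\<sigma> k) (\<Lambda> k) \<le> M" by (simp add: atom_weight_def d_def)
    then have "atom_weight \<tau> (\<sigma> k) (\<Lambda> k) * Re (kern (\<sigma> k) z) \<le> M * Re (kern (\<sigma> k) z)"
      using Re_kern_pos[OF s z] by (intro mult_right_mono) auto
    with M(3)[OF z] show ?thesis by simp
  qed
  then have "bp_class \<tau> n \<sigma> \<Lambda> p"
    using p(1) pos by (simp add: bp_class_def)
  then show thesis using that p(3) by blast
qed

section \<open>Flows of holomorphic vector fields\<close>

lemma has_vector_derivative_norm_power2:
  fixes x :: "real \<Rightarrow> complex"
  assumes "(x has_vector_derivative v) (at t within S)"
  shows "((\<lambda>t. (cmod (x t))\<^sup>2) has_real_derivative 2 * Re (cnj (x t) * v)) (at t within S)"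
proof -
  have d: "((\<lambda>t. Re (x t)) has_real_derivative Re v) (at t within S)"
    "((\<lambda>t. Im (x t)) has_real_derivative Im v) (at t within S)"
    using assms unfolding has_vector_derivative_complex_iff by blast+
  show ?thesis
    unfolding cmod_power2
    by (rule derivative_eq_intros d refl)+ (simp add: algebra_simps)
qed

lemma monotone_of_derivative_within:
  fixes f :: "real \<Rightarrow> real"
  assumes d: "\<And>t. t \<in> {0..T} \<Longrightarrow> (f has_real_derivative f' t) (at t within {0..T})"
    and le: "\<And>t. t \<in> {0..T} \<Longrightarrow> f' t \<ge> 0" and ab: "0 \<le> a" "a \<le> b" "b \<le> T"
  shows "f a \<le> f b"
proof (rule DERIV_nonneg_imp_increasing_open[OF ab(2)])
  show "\<exists>y. DERIV f x :> y \<and> y \<ge> 0" if "a < x" "x < b" for x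
  proof -
    have "x \<in> interior {0..T}" using that ab by (simp add: interior_atLeastAtMost_real)
    then have "at x within {0..T} = at x" by (rule at_within_interior)
    then show ?thesis using d[of x] le[of x] that ab by auto
  qed
  have "continuous_on {0..T} f"
    using d by (meson DERIV_continuous continuous_on_eq_continuous_within)
  then show "continuous_on {a..b} f" by (rule continuous_on_subset) (use ab in auto)
qed

text \<open>The hitting times form a compact set, and by the intermediate value theorem
  \<open>f\<close> cannot exceed the level before the earliest one. Continuity arguments for
  trajectories run up to this time.\<close>

lemma first_hitting_time:
  fixes f :: "real \<Rightarrow> real"
  assumes c: "continuous_on {0..T} f" and "f 0 < r" and t: "t \<in> {0..T}" "f t \<ge> r"
  obtains u where "u \<in> {0..T}" "f u = r" "\<And>s. s \<in> {0..u} \<Longrightarrow> f s \<le> r"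
proof -
  define A where "A = {s \<in> {0..T}. f s \<in> {r}}"
  have hit: "\<exists>s\<ge>0. s \<le> t \<and> f s = r" if "0 \<le> t" "t \<le> T" "f t \<ge> r" for t
    by (rule IVT') (use that assms(2) continuous_on_subset[OF c] in auto)
  obtain s where "s \<ge> 0" "s \<le> t" "f s = r" using hit[of t] t by auto
  then have "s \<in> A" using t by (simp add: A_def)
  then have "A \<noteq> {}" by blast
  moreover have "compact A"
  proof -
    have "A = {0..T} \<inter> f -` {r}" by (auto simp: A_def)
    moreover have "closed ({0..T} \<inter> f -` {r})" by (rule continuous_closed_preimage[OF c]) auto
    moreover have "bounded A"
      by (rule bounded_subset[OF bounded_closed_interval[of 0 T]]) (auto simp: A_def)
    ultimately show ?thesis by (simp add: compact_eq_bounded_closed)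
  qed
  ultimately obtain u where u: "u \<in> A" "\<And>s. s \<in> A \<Longrightarrow> u \<le> s"
    using compact_attains_inf[of A] by metis
  have "f s \<le> r" if s: "s \<in> {0..u}" for s
  proof (rule ccontr)
    assume "\<not> f s \<le> r"
    then obtain v where "0 \<le> v" "v \<le> s" "f v = r"
      using hit[of s] s u(1) by (force simp: A_def)
    moreover have "v = s"
      using u(2)[of v] calculation s u(1) by (auto simp: A_def)
    ultimately show False using \<open>\<not> f s \<le> r\<close> by simp
  qed
  with u(1) show thesis using that by (auto simp: A_def)
qed

text \<open>Picard iteration in Bielecki's weighted norm: with the weight exp (- K t) it contracts
  on all of [0, T] at once, so no short intervals have to be glued.\<close>

lemma picard_lipschitz:
  fixes g :: "complex \<Rightarrow> complex"
  assumes L: "L \<ge> 0" "\<And>x y. cmod (g x - g y) \<le> L * cmod (x - y)" and T: "T \<ge> 0"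
  obtains x where "x 0 = z" "\<And>t. t \<in> {0..T} \<Longrightarrow> (x has_vector_derivative g (x t)) (at t within {0..T})"
proof -
  \<comment> \<open>K \<ge> 2 L gives the contraction factor L / K \<le> 1/2; the extra 1 keeps
    \<open>K\<close> positive for L = 0.\<close>
  define K where "K = 2 * L + 1"
  have K: "K > 0" "L / K \<le> 1/2" using L by (auto simp: K_def field_simps)
  \<comment> \<open>Clamping time to [0, T] turns functions on the interval into bounded continuous
    functions on the line, the complete space in which the fixed point is taken.\<close>
  define cl where "cl = (\<lambda>t::real. max 0 (min T t))"
  have cl: "cl t \<in> {0..T}" for t using T by (auto simp: cl_def)
  have clc: "continuous_on UNIV cl" unfolding cl_def by (intro continuous_intros)
  have gc: "continuous_on UNIV g"
    using L(2) by (intro lipschitz_on_continuous_on[of L]) (auto simp: lipschitz_on_def dist_norm L(1))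
  \<comment> \<open>The unknown \<open>y\<close> stands for exp (- K t) x(t), so the field is
    evaluated at the rescaled value.\<close>
  define h where "h = (\<lambda>(y :: real \<Rightarrow>\<^sub>C complex) s. g (exp (K * s) *\<^sub>R y s))"
  have hc: "continuous_on S (h y)" for y S
    unfolding h_def by (intro continuous_on_compose2[OF gc] continuous_intros) auto
  have hi: "h y integrable_on {a..b}" for y a b
    by (intro integrable_continuous_real hc)
  define P where "P = (\<lambda>y t. exp (- K * cl t) *\<^sub>R (z + integral {0..cl t} (h y)))"
  define Q where "Q = (\<lambda>y t. exp (- K * t) *\<^sub>R (z + integral {0..t} (h y)))"
  have Qc: "continuous_on {0..T} (Q y)" for y
    unfolding Q_def by (intro continuous_intros indefinite_integral_continuous_1 hi)
  have PQ: "P y = (\<lambda>t. Q y (cl t))" for y by (simp add: P_def Q_def)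
  have Pb: "P y \<in> bcontfun" for y
    unfolding bcontfun_def
  proof (intro CollectI conjI)
    show "continuous_on UNIV (P y)"
      unfolding PQ by (rule continuous_on_compose2[OF Qc clc]) (use cl in auto)
    have "bounded (Q y ` {0..T})"
      by (intro compact_imp_bounded compact_continuous_image Qc) simp
    then show "bounded (range (P y))"
      by (rule bounded_subset) (use cl in \<open>auto simp: PQ\<close>)
  qed
  define \<Phi> where "\<Phi> = (\<lambda>y. Bcontfun (P y))"
  have \<Phi>: "apply_bcontfun (\<Phi> y) = P y" for y
    unfolding \<Phi>_def by (rule Bcontfun_inverse[OF Pb])
  have "dist (\<Phi> y1) (\<Phi> y2) \<le> 1/2 * dist y1 y2" for y1 y2
  proof (rule dist_bound)
    fix t
    define c where "c = cl t"
    define d where "d = dist y1 y2"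
    have c0: "c \<ge> 0" using cl[of t] by (simp add: c_def)
    have d0: "d \<ge> 0" by (simp add: d_def)
    have hb: "cmod (h y1 s - h y2 s) \<le> L * d * exp (K * s)" for s
    proof -
      have "cmod (h y1 s - h y2 s) \<le> L * cmod (exp (K * s) *\<^sub>R y1 s - exp (K * s) *\<^sub>R y2 s)"
        unfolding h_def by (rule L(2))
      also have "cmod (exp (K * s) *\<^sub>R y1 s - exp (K * s) *\<^sub>R y2 s) = exp (K * s) * cmod (y1 s - y2 s)"
        by (simp flip: scaleR_diff_right)
      finally have "cmod (h y1 s - h y2 s) \<le> L * exp (K * s) * cmod (y1 s - y2 s)" by simp
      also have "\<dots> \<le> L * exp (K * s) * d"
        using dist_bounded[where f=y1 and g=y2 and x=s] L(1) by (intro mult_left_mono) (auto simp: d_def dist_norm)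
      finally show ?thesis by (simp add: mult_ac)
    qed
    have int: "((\<lambda>s. L * d * exp (K * s)) has_integral (L * d / K * exp (K * c) - L * d / K * exp (K * 0))) {0..c}"
    proof (rule fundamental_theorem_of_calculus[OF c0])
      fix x assume "x \<in> {0..c}"
      have "((\<lambda>s. L * d / K * exp (K * s)) has_real_derivative L * d * exp (K * x)) (at x within {0..c})"
        using K by (auto intro!: derivative_eq_intros)
      then show "((\<lambda>s. L * d / K * exp (K * s)) has_vector_derivative L * d * exp (K * x)) (at x within {0..c})"
        by (simp add: has_real_derivative_iff_has_vector_derivative)
    qed
    have "P y1 t - P y2 t = exp (- K * c) *\<^sub>R integral {0..c} (\<lambda>s. h y1 s - h y2 s)"
      unfolding P_def c_def[symmetric] integral_diff[OF hi[of y1 0 c] hi[of y2 0 c]]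
      by (simp add: algebra_simps)
    then have "cmod (P y1 t - P y2 t) = exp (- K * c) * cmod (integral {0..c} (\<lambda>s. h y1 s - h y2 s))" by simp
    also have "\<dots> \<le> exp (- K * c) * integral {0..c} (\<lambda>s. L * d * exp (K * s))"
      using hb int by (intro mult_left_mono integral_norm_bound_integral integrable_diff hi) (auto intro: has_integral_integrable)
    also have "\<dots> = exp (- K * c) * (L * d / K * exp (K * c) - L * d / K)"
      using integral_unique[OF int] by simp
    also have "\<dots> \<le> exp (- K * c) * (L * d / K * exp (K * c))"
      using L(1) K d0 by (intro mult_left_mono) auto
    also have "\<dots> = L / K * d" by (simp add: exp_minus field_simps)
    also have "\<dots> \<le> 1/2 * d" using K d0 by (intro mult_right_mono) auto
    finally show "dist (\<Phi> y1 t) (\<Phi> y2 t) \<le> 1/2 * dist y1 y2" by (simp add: \<Phi> dist_norm d_def)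
  qed
  then have "\<exists>!y. \<Phi> y = y" by (intro banach_fix_type[of "1/2"]) auto
  then obtain y where y: "\<Phi> y = y" by blast
  define x where "x = (\<lambda>t. z + integral {0..t} (h y))"
  have xy: "exp (K * t) *\<^sub>R y t = x t" if "t \<in> {0..T}" for t
  proof -
    have "cl t = t" using that by (simp add: cl_def)
    then have "y t = exp (- K * t) *\<^sub>R x t" using fun_cong[OF \<Phi>[of y], of t] unfolding y by (simp add: P_def x_def)
    then show ?thesis by (simp add: exp_minus)
  qed
  have "(x has_vector_derivative g (x t)) (at t within {0..T})" if t: "t \<in> {0..T}" for t
  proof -
    have "(x has_vector_derivative 0 + h y t) (at t within {0..T})"
      unfolding x_def by (intro derivative_intros integral_has_vector_derivative hc t)
    then show ?thesis using xy[OF t] by (simp add: h_def)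
  qed
  moreover have "x 0 = z" by (simp add: x_def)
  ultimately show thesis using that by blast
qed

section \<open>Trajectories in the disk: uniqueness, a priori bounds and global existence\<close>

definition solves :: "(complex \<Rightarrow> complex) \<Rightarrow> (real \<Rightarrow> complex) \<Rightarrow> real set \<Rightarrow> bool" where
  "solves G x I \<longleftrightarrow> (\<forall>t\<in>I. x t \<in> unit_disk \<and> (x has_vector_derivative G (x t)) (at t within I))"

lemma solves_subset: "solves G x I \<Longrightarrow> J \<subseteq> I \<Longrightarrow> solves G x J"
  unfolding solves_def by (meson has_vector_derivative_within_subset subsetD)

lemma solves_continuous: "solves G x I \<Longrightarrow> continuous_on I x"
  unfolding solves_def continuous_on_eq_continuous_within
  by (meson has_vector_derivative_continuous)

lemma lipschitz_on_smaller_disk: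
  fixes G :: "complex \<Rightarrow> complex"
  assumes G: "G holomorphic_on unit_disk" and r: "r < 1"
  obtains L where "L \<ge> 0" "\<And>x y :: complex. x \<in> cball 0 r \<Longrightarrow> y \<in> cball 0 r \<Longrightarrow> cmod (G x - G y) \<le> L * cmod (x - y)"
proof -
  have sub: "cball 0 r \<subseteq> unit_disk" using r by auto
  have "continuous_on (cball 0 r) (deriv G)"
    using holomorphic_on_imp_continuous_on[OF holomorphic_deriv[OF G open_ball]] sub
    by (rule continuous_on_subset)
  then have "bounded (deriv G ` cball 0 r)"
    by (intro compact_imp_bounded compact_continuous_image) auto
  then obtain L where L: "L > 0" "\<And>x. x \<in> cball 0 r \<Longrightarrow> cmod (deriv G x) \<le> L"
    by (auto simp: bounded_pos)
  show thesis
  proof (rule that[of L])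
    fix x y :: complex assume "x \<in> cball 0 r" "y \<in> cball 0 r"
    then show "cmod (G x - G y) \<le> L * cmod (x - y)"
      using L sub holomorphic_derivI[OF G open_ball]
      by (intro field_differentiable_bound[where S="cball 0 r" and f'="deriv G"]) auto
  qed (use L in simp)
qed

text \<open>The squared distance stays differentiable where the solutions meet; weighted with exp (-
  2 L t) it does not increase.\<close>

lemma gronwall_lipschitz:
  assumes x: "solves G x {0..T}" and y: "solves G y {0..T}"
    and B: "\<And>t. t \<in> {0..T} \<Longrightarrow> x t \<in> B" "\<And>t. t \<in> {0..T} \<Longrightarrow> y t \<in> B"
    and L: "\<And>a b. a \<in> B \<Longrightarrow> b \<in> B \<Longrightarrow> cmod (G a - G b) \<le> L * cmod (a - b)"
    and t: "t \<in> {0..T}"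
  shows "cmod (x t - y t) \<le> exp (L * t) * cmod (x 0 - y 0)"
proof -
  define f where "f = (\<lambda>s. - (exp (- 2 * L * s) * (cmod (x s - y s))\<^sup>2))"
  define f' where "f' = (\<lambda>s. - (exp (- 2 * L * s) * (2 * Re (cnj (x s - y s) * (G (x s) - G (y s))))
     + - 2 * L * exp (- 2 * L * s) * (cmod (x s - y s))\<^sup>2))"
  have "f 0 \<le> f t"
  proof (rule monotone_of_derivative_within[where f=f and f'=f' and T=T])
    fix s assume s: "s \<in> {0..T}"
    have "((\<lambda>s. x s - y s) has_vector_derivative G (x s) - G (y s)) (at s within {0..T})"
      using x y s unfolding solves_def by (intro derivative_intros) auto
    note d = has_vector_derivative_norm_power2[OF this]
    show "(f has_real_derivative f' s) (at s within {0..T})"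
      unfolding f_def f'_def
      by (rule derivative_eq_intros d refl)+ (simp add: algebra_simps)
    have "Re (cnj (x s - y s) * (G (x s) - G (y s))) \<le> cmod (x s - y s) * cmod (G (x s) - G (y s))"
      using complex_Re_le_cmod[of "cnj (x s - y s) * (G (x s) - G (y s))"] by (simp only: norm_mult complex_mod_cnj)
    also have "\<dots> \<le> cmod (x s - y s) * (L * cmod (x s - y s))"
      using B s by (intro mult_left_mono L) auto
    finally have "0 \<le> L * (cmod (x s - y s))\<^sup>2 - Re (cnj (x s - y s) * (G (x s) - G (y s)))"
      by (simp add: power2_eq_square mult_ac)
    then have "0 \<le> 2 * exp (- 2 * L * s) * (L * (cmod (x s - y s))\<^sup>2 - Re (cnj (x s - y s) * (G (x s) - G (y s))))"
      by (intro mult_nonneg_nonneg) auto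
    then show "f' s \<ge> 0" unfolding f'_def by (simp only: algebra_simps)
  qed (use t in auto)
  then have "exp (- 2 * L * t) * (cmod (x t - y t))\<^sup>2 \<le> (cmod (x 0 - y 0))\<^sup>2" by (simp add: f_def)
  then have "(exp (L * t))\<^sup>2 * (exp (- 2 * L * t) * (cmod (x t - y t))\<^sup>2) \<le> (exp (L * t))\<^sup>2 * (cmod (x 0 - y 0))\<^sup>2"
    by (intro mult_left_mono) auto
  moreover have "(exp (L * t))\<^sup>2 * exp (- 2 * L * t) = 1"
    unfolding exp_double[symmetric] exp_add[symmetric] by simp
  ultimately have "(cmod (x t - y t))\<^sup>2 \<le> (exp (L * t) * cmod (x 0 - y 0))\<^sup>2"
    by (simp only: mult.assoc[symmetric] power_mult_distrib mult_1)
  then show ?thesis by (rule power2_le_imp_le) simp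
qed

lemma solves_bounded_away:
  assumes "solves G x {0..T}"
  obtains r where "r < 1" "\<And>t. t \<in> {0..T} \<Longrightarrow> x t \<in> cball 0 r"
proof (cases "T \<ge> 0")
  case True
  have "continuous_on {0..T} (\<lambda>t. cmod (x t))" by (intro continuous_intros solves_continuous[OF assms])
  then obtain u where "u \<in> {0..T}" "\<And>t. t \<in> {0..T} \<Longrightarrow> cmod (x t) \<le> cmod (x u)"
    using continuous_attains_sup[of "{0..T}" "\<lambda>t. cmod (x t)"] True by auto
  moreover have "cmod (x u) < 1" using assms calculation(1) by (simp add: solves_def)
  ultimately show thesis using that[of "cmod (x u)"] by auto
next
  case False
  then show thesis using that[of 0] by auto
qed

lemma solves_unique:
  assumes G: "G holomorphic_on unit_disk" and x: "solves G x {0..T}" and y: "solves G y {0..T}"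
    and "x 0 = y 0" and t: "t \<in> {0..T}"
  shows "x t = y t"
proof -
  obtain r1 where r1: "r1 < 1" "\<And>t. t \<in> {0..T} \<Longrightarrow> x t \<in> cball 0 r1" using solves_bounded_away[OF x] by blast
  obtain r2 where r2: "r2 < 1" "\<And>t. t \<in> {0..T} \<Longrightarrow> y t \<in> cball 0 r2" using solves_bounded_away[OF y] by blast
  have "max r1 r2 < 1" using r1 r2 by simp
  then obtain L where L: "\<And>a b. a \<in> cball 0 (max r1 r2) \<Longrightarrow> b \<in> cball 0 (max r1 r2) \<Longrightarrow> cmod (G a - G b) \<le> L * cmod (a - b)"
    using lipschitz_on_smaller_disk[OF G] by metis
  have "cmod (x t - y t) \<le> exp (L * t) * cmod (x 0 - y 0)"
    by (rule gronwall_lipschitz[where B="cball 0 (max r1 r2)", OF x y _ _ L t]) (use r1(2) r2(2) in \<open>fastforce+\<close>)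
  then show ?thesis using assms(4) by simp
qed

text \<open>The infinitesimal Schwarz--Pick inequality: along the flow the hyperbolic speed
  \<open>cmod (G z) / (1 - (cmod z)\<^sup>2)\<close> does not increase, so trajectories cannot leave the disk in finite time.\<close>

definition contracting :: "(complex \<Rightarrow> complex) \<Rightarrow> bool" where
  "contracting G \<longleftrightarrow> (\<forall>z\<in>unit_disk. (1 - (cmod z)\<^sup>2) * Re (deriv G z) + 2 * Re (cnj z * G z) \<le> 0)"

text \<open>With N = |G x|^2 and W = 1 - |x|^2, the derivative of N / W^2 along a solution is 2 N /
  W^3 times the expression in \<open>contracting\<close> at the current point.\<close>

lemma solves_hyperbolic_speed:
  fixes G :: "complex \<Rightarrow> complex"
  assumes G: "G holomorphic_on unit_disk" and x: "solves G x {0..T}" and t: "t \<in> {0..T}"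
    and ctr: "contracting G"
  shows "cmod (G (x t)) / (1 - (cmod (x t))\<^sup>2) \<le> cmod (G (x 0)) / (1 - (cmod (x 0))\<^sup>2)"
proof -
  define N where "N = (\<lambda>t. (cmod (G (x t)))\<^sup>2)"
  define W where "W = (\<lambda>t. 1 - (cmod (x t))\<^sup>2)"
  have W: "W s > 0" if "s \<in> {0..T}" for s
    using x that by (simp add: W_def solves_def abs_square_less_1)
  define N' where "N' = (\<lambda>s. 2 * Re (cnj (G (x s)) * (G (x s) * deriv G (x s))))"
  define W' where "W' = (\<lambda>s. - (2 * Re (cnj (x s) * G (x s))))"
  have dN: "(N has_real_derivative N' s) (at s within {0..T})"
    and dW: "(W has_real_derivative W' s) (at s within {0..T})" if s: "s \<in> {0..T}" for s
  proof -
    have dx: "(x has_vector_derivative G (x s)) (at s within {0..T})" and xs: "x s \<in> unit_disk"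
      using x s by (auto simp: solves_def)
    have "((G \<circ> x) has_vector_derivative G (x s) * deriv G (x s)) (at s within {0..T})"
      using holomorphic_derivI[OF G open_ball xs] by (intro field_vector_diff_chain_within[OF dx])
    then show "(N has_real_derivative N' s) (at s within {0..T})"
      unfolding N_def N'_def o_def by (rule has_vector_derivative_norm_power2)
    show "(W has_real_derivative W' s) (at s within {0..T})"
      unfolding W_def W'_def
      by (rule derivative_eq_intros has_vector_derivative_norm_power2[OF dx] refl)+ simp
  qed
  define f where "f = (\<lambda>s. - (N s / (W s)\<^sup>2))"
  have "f 0 \<le> f t"
  proof (rule monotone_of_derivative_within[where f=f and T=T and
        f'="\<lambda>s. - ((N' s * (W s)\<^sup>2 - N s * (2 * W s * W' s)) / ((W s)\<^sup>2 * (W s)\<^sup>2))"])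
    fix s assume s: "s \<in> {0..T}"
    have "((\<lambda>s. (W s)\<^sup>2) has_real_derivative 2 * W s * W' s) (at s within {0..T})"
      by (rule derivative_eq_intros dW[OF s] refl)+ simp
    then show "(f has_real_derivative - ((N' s * (W s)\<^sup>2 - N s * (2 * W s * W' s)) / ((W s)\<^sup>2 * (W s)\<^sup>2))) (at s within {0..T})"
      unfolding f_def using W[OF s] by (intro DERIV_minus DERIV_divide dN s) auto
    have xs: "x s \<in> unit_disk" using x s by (simp add: solves_def)
    have "N' s = 2 * N s * Re (deriv G (x s))"
    proof -
      have c: "cnj (G (x s)) * (G (x s) * deriv G (x s)) = of_real (N s) * deriv G (x s)"
        by (simp only: N_def complex_norm_square mult.assoc[symmetric] mult.commute[of "cnj (G (x s))"])
      show ?thesis unfolding N'_def c by simp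
    qed
    then have "N' s * (W s)\<^sup>2 - N s * (2 * W s * W' s) = 2 * N s * W s * (W s * Re (deriv G (x s)) + 2 * Re (cnj (x s) * G (x s)))"
      by (simp add: W'_def power2_eq_square algebra_simps)
    also have "\<dots> \<le> 0"
      using ctr xs W[OF s] by (intro mult_nonneg_nonpos) (auto simp: N_def W_def contracting_def)
    finally show "0 \<le> - ((N' s * (W s)\<^sup>2 - N s * (2 * W s * W' s)) / ((W s)\<^sup>2 * (W s)\<^sup>2))"
      using W[OF s] by (simp add: divide_nonpos_pos)
  qed (use t in auto)
  then have "(cmod (G (x t)) / W t)\<^sup>2 \<le> (cmod (G (x 0)) / W 0)\<^sup>2"
    by (simp add: f_def N_def power_divide)
  then have "cmod (G (x t)) / W t \<le> cmod (G (x 0)) / W 0"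
    by (rule power2_le_imp_le) (use W[of 0] t in \<open>auto intro!: divide_nonneg_nonneg\<close>)
  then show ?thesis by (simp add: W_def)
qed

text \<open>The speed bound |G x| \<le> c W gives W' \<ge> - 2 c W for W = 1 - |x|^2, so the gap to
  the circle shrinks at most exponentially, at a rate fixed by the initial point.\<close>

lemma solves_disk_estimate:
  fixes G :: "complex \<Rightarrow> complex"
  assumes G: "G holomorphic_on unit_disk" and x: "solves G x {0..T}" and t: "t \<in> {0..T}"
    and ctr: "contracting G"
  shows "(1 - (cmod (x 0))\<^sup>2) * exp (- 2 * (cmod (G (x 0)) / (1 - (cmod (x 0))\<^sup>2)) * T) \<le> 1 - (cmod (x t))\<^sup>2"
proof -
  define c where "c = cmod (G (x 0)) / (1 - (cmod (x 0))\<^sup>2)"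
  define W where "W = (\<lambda>t. 1 - (cmod (x t))\<^sup>2)"
  have W: "W s > 0" if "s \<in> {0..T}" for s
    using x that by (simp add: W_def solves_def abs_square_less_1)
  have T: "0 \<in> {0..T}" using t by auto
  have c0: "c \<ge> 0" using W[OF T] by (simp add: c_def W_def)
  have "exp (2 * c * 0) * W 0 \<le> exp (2 * c * t) * W t"
  proof (rule monotone_of_derivative_within[where f="\<lambda>s. exp (2 * c * s) * W s" and T=T and
       f'="\<lambda>s. 2 * c * exp (2 * c * s) * W s + exp (2 * c * s) * - (2 * Re (cnj (x s) * G (x s)))"])
    fix s assume s: "s \<in> {0..T}"
    have dx: "(x has_vector_derivative G (x s)) (at s within {0..T})" and xs: "x s \<in> unit_disk"
      using x s by (auto simp: solves_def)
    have dW: "(W has_real_derivative - (2 * Re (cnj (x s) * G (x s)))) (at s within {0..T})"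
      unfolding W_def
      by (rule derivative_eq_intros has_vector_derivative_norm_power2[OF dx] refl)+ simp
    show "((\<lambda>s. exp (2 * c * s) * W s) has_real_derivative
        2 * c * exp (2 * c * s) * W s + exp (2 * c * s) * - (2 * Re (cnj (x s) * G (x s)))) (at s within {0..T})"
      by (rule derivative_eq_intros dW refl)+ simp
    have "Re (cnj (x s) * G (x s)) \<le> cmod (x s) * cmod (G (x s))"
      using complex_Re_le_cmod[of "cnj (x s) * G (x s)"] by (simp only: norm_mult complex_mod_cnj)
    also have "\<dots> \<le> 1 * cmod (G (x s))" using xs by (intro mult_right_mono) auto
    also have "cmod (G (x s)) / W s \<le> c"
      using solves_hyperbolic_speed[OF G x s ctr] by (simp add: W_def c_def)
    then have "1 * cmod (G (x s)) \<le> c * W s" using W[OF s] by (simp add: pos_divide_le_eq)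
    finally have "0 \<le> 2 * exp (2 * c * s) * (c * W s - Re (cnj (x s) * G (x s)))" by simp
    have alg: "2 * c * e * w + e * - (2 * r) = 2 * e * (c * w - r)" for e w r by (simp add: algebra_simps)
    show "0 \<le> 2 * c * exp (2 * c * s) * W s + exp (2 * c * s) * - (2 * Re (cnj (x s) * G (x s)))"
      unfolding alg by fact
  qed (use t in auto)
  then have "exp (- 2 * c * t) * (exp (2 * c * 0) * W 0) \<le> exp (- 2 * c * t) * (exp (2 * c * t) * W t)"
    by (rule mult_left_mono) simp
  moreover have "exp (- 2 * c * t) * (exp (2 * c * t) * W t) = W t"
    unfolding mult.assoc[symmetric] exp_add[symmetric] by simp
  moreover have "exp (- 2 * c * t) * (exp (2 * c * 0) * W 0) = W 0 * exp (- 2 * c * t)" by simp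
  ultimately have "W 0 * exp (- 2 * c * t) \<le> W t" by linarith
  moreover have "W 0 * exp (- 2 * c * T) \<le> W 0 * exp (- 2 * c * t)"
    using W[OF T] c0 t by (intro mult_left_mono) (auto intro: mult_left_mono)
  ultimately show ?thesis by (simp add: W_def c_def)
qed

lemma solves_exists:
  fixes G :: "complex \<Rightarrow> complex"
  assumes G: "G holomorphic_on unit_disk" and z: "z \<in> unit_disk" and T: "T \<ge> 0"
    and ctr: "contracting G"
  obtains x where "x 0 = z" "solves G x {0..T}"
proof -
  define \<eta> where "\<eta> = (1 - (cmod z)\<^sup>2) * exp (- 2 * (cmod (G z) / (1 - (cmod z)\<^sup>2)) * T)"
  have W: "1 - (cmod z)\<^sup>2 > 0" using z by (simp add: abs_square_less_1)
  have \<eta>0: "\<eta> > 0" using W by (simp add: \<eta>_def)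
  have "exp (- 2 * (cmod (G z) / (1 - (cmod z)\<^sup>2)) * T) \<le> 1" using W T by simp
  then have \<eta>1: "\<eta> \<le> 1 - (cmod z)\<^sup>2"
    unfolding \<eta>_def using W mult_left_mono[of _ 1 "1 - (cmod z)\<^sup>2"] by fastforce
  then have \<eta>2: "\<eta> \<le> 1" by (simp add: order_trans)
  \<comment> \<open>The a priori estimate keeps solutions in 1 - |x|^2 \<ge> \<eta>. The radius with
    r^2 = 1 - \<eta> / 2 leaves a margin, so that reaching |x| = r is contradictory.\<close>
  define r where "r = sqrt (1 - \<eta> / 2)"
  have r2: "r\<^sup>2 = 1 - \<eta> / 2" using \<eta>2 by (simp add: r_def)
  have r: "0 \<le> r" "r < 1" using \<eta>0 \<eta>2 by (auto simp: r_def)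
  have small: "cmod w < r" if "\<eta> \<le> 1 - (cmod w)\<^sup>2" for w
  proof -
    have "(cmod w)\<^sup>2 < r\<^sup>2" using that \<eta>0 by (simp add: r2)
    then show ?thesis using r(1) by (rule power_less_imp_less_base)
  qed
  \<comment> \<open>Composing \<open>G\<close> with the nearest-point projection makes it globally
    Lipschitz without changing it on the smaller disk, where the solution turns out to stay.\<close>
  define pr where "pr = closest_point (cball (0::complex) r)"
  obtain L where L: "L \<ge> 0" "\<And>x y :: complex. x \<in> cball 0 r \<Longrightarrow> y \<in> cball 0 r \<Longrightarrow> cmod (G x - G y) \<le> L * cmod (x - y)"
    using lipschitz_on_smaller_disk[OF G r(2)] by blast
  have ne: "cball (0::complex) r \<noteq> {}" using r by auto
  have "cmod ((G \<circ> pr) x - (G \<circ> pr) y) \<le> L * cmod (x - y)" for x y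
  proof -
    have "pr w \<in> cball 0 r" for w unfolding pr_def using closest_point_in_set[OF closed_cball ne] .
    then have "cmod (G (pr x) - G (pr y)) \<le> L * cmod (pr x - pr y)" by (intro L(2))
    also have "\<dots> \<le> L * cmod (x - y)"
      using closest_point_lipschitz[OF convex_cball closed_cball ne, of x y] L(1)
      by (intro mult_left_mono) (auto simp: pr_def dist_norm)
    finally show ?thesis by simp
  qed
  then obtain x where x: "x 0 = z" "\<And>t. t \<in> {0..T} \<Longrightarrow> (x has_vector_derivative (G \<circ> pr) (x t)) (at t within {0..T})"
    using picard_lipschitz[OF L(1) _ T, of "G \<circ> pr" z] by blast
  have sol: "solves G x {0..u}" if u: "u \<in> {0..T}" "\<And>s. s \<in> {0..u} \<Longrightarrow> cmod (x s) \<le> r" for u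
    unfolding solves_def
  proof (intro ballI conjI)
    fix t assume t: "t \<in> {0..u}"
    show "x t \<in> unit_disk" using u(2)[OF t] r by simp
    have "(x has_vector_derivative (G \<circ> pr) (x t)) (at t within {0..u})"
      using x(2)[of t] t u(1) by (auto intro: has_vector_derivative_within_subset)
    moreover have "pr (x t) = x t" unfolding pr_def using u(2)[OF t] by (intro closest_point_self) simp
    ultimately show "(x has_vector_derivative G (x t)) (at t within {0..u})" by simp
  qed
  have xc: "continuous_on {0..T} (\<lambda>t. cmod (x t))"
    using x(2) by (intro continuous_intros) (meson continuous_on_eq_continuous_within has_vector_derivative_continuous)
  have "cmod (x t) \<le> r" if t: "t \<in> {0..T}" for t
  proof (rule ccontr)
    assume "\<not> cmod (x t) \<le> r"
    moreover have "cmod (x 0) < r" using small[OF \<eta>1] x(1) by simp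
    ultimately obtain u where u: "u \<in> {0..T}" "cmod (x u) = r" "\<And>s. s \<in> {0..u} \<Longrightarrow> cmod (x s) \<le> r"
      using first_hitting_time[OF xc _ t, of r] by auto
    have "(1 - (cmod z)\<^sup>2) * exp (- 2 * (cmod (G z) / (1 - (cmod z)\<^sup>2)) * u) \<le> 1 - (cmod (x u))\<^sup>2"
      using solves_disk_estimate[OF G sol[OF u(1,3)] _ ctr, of u] u(1) x(1) by auto
    moreover have "\<eta> \<le> (1 - (cmod z)\<^sup>2) * exp (- 2 * (cmod (G z) / (1 - (cmod z)\<^sup>2)) * u)"
      unfolding \<eta>_def using W u(1) by (intro mult_left_mono) (auto intro!: mult_left_mono divide_right_mono)
    ultimately have "cmod (x u) < r" by (intro small) simp
    then show False using u(2) by simp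
  qed
  then have "solves G x {0..T}" using T by (intro sol) auto
  with x(1) show thesis using that by blast
qed

lemma solves_global_exists:
  fixes G :: "complex \<Rightarrow> complex"
  assumes G: "G holomorphic_on unit_disk" and z: "z \<in> unit_disk"
    and ctr: "contracting G"
  obtains x where "x 0 = z" "solves G x {0..}"
proof -
  have "\<exists>x. x 0 = z \<and> solves G x {0..real N}" for N
    using solves_exists[OF G z _ ctr, of "real N"] by (metis of_nat_0_le_iff)
  then obtain X where X: "\<And>N. X N 0 = z" "\<And>N. solves G (X N) {0..real N}" by metis
  \<comment> \<open>By uniqueness the solutions on different intervals agree, so the value may be
    read from any interval that is long enough.\<close>
  define x where "x = (\<lambda>t. X (nat \<lceil>t\<rceil>) t)"
  have eq: "x t = X N t" if t: "0 \<le> t" "t \<le> real N" for t N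
  proof -
    define M where "M = nat \<lceil>t\<rceil>"
    have M: "t \<le> real M" using t by (simp add: M_def)
    have "X M t = X N t"
      by (rule solves_unique[OF G solves_subset[OF X(2)] solves_subset[OF X(2)], of t]) (use X(1) M t in auto)
    then show ?thesis by (simp add: x_def M_def)
  qed
  have "solves G x {0..}"
    unfolding solves_def
  proof (intro ballI conjI)
    fix t :: real assume t: "t \<in> {0..}"
    define N where "N = Suc (nat \<lceil>t\<rceil>)"
    have N: "t < real N" using t by (simp add: N_def) linarith
    have tN: "t \<in> {0..real N}" using t N by simp
    have xt: "x t = X N t" using eq t N by simp
    show "x t \<in> unit_disk" unfolding xt using X(2)[of N] tN by (simp add: solves_def)
    have "(X N has_vector_derivative G (X N t)) (at t within {0..real N})"
      using X(2)[of N] tN by (simp add: solves_def)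
    then have "(x has_vector_derivative G (x t)) (at t within {0..real N})"
      unfolding xt by (intro has_vector_derivative_transform[OF tN, of x "X N"]) (use eq in auto)
    moreover have "at t within {0..real N} = at t within {0..}"
      by (rule at_within_nhd[of t "{..<real N}"]) (use N in auto)
    ultimately show "(x has_vector_derivative G (x t)) (at t within {0..})" by simp
  qed
  moreover have "x 0 = z" using eq[of 0 0] X(1) by simp
  ultimately show thesis using that by blast
qed

section \<open>Holomorphic dependence on the initial point and the semigroup law\<close>

lemma flow_locally_uniform:
  fixes G :: "complex \<Rightarrow> complex"
  assumes G: "G holomorphic_on unit_disk" and z0: "z0 \<in> unit_disk" and T: "T \<ge> 0"
    and ctr: "contracting G"
    and \<phi>: "\<And>z. z \<in> unit_disk \<Longrightarrow> \<phi> 0 z = z" "\<And>z. z \<in> unit_disk \<Longrightarrow> solves G (\<lambda>t. \<phi> t z) {0..T}"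
  obtains \<rho> r where "\<rho> > 0" "r < 1" "cball z0 \<rho> \<subseteq> unit_disk"
    "\<And>z t. z \<in> cball z0 \<rho> \<Longrightarrow> t \<in> {0..T} \<Longrightarrow> \<phi> t z \<in> cball 0 r"
proof -
  obtain \<rho> where \<rho>: "\<rho> > 0" "cball z0 \<rho> \<subseteq> unit_disk"
    using z0 open_contains_cball open_ball by blast
  \<comment> \<open>The a priori gap to the circle as a function of the initial point. Its minimum
    over a compact disk is positive and keeps all trajectories starting there away from the
    circle.\<close>
  define h where "h = (\<lambda>z. (1 - (cmod z)\<^sup>2) * exp (- 2 * (cmod (G z) / (1 - (cmod z)\<^sup>2)) * T))"
  have W: "1 - (cmod z)\<^sup>2 > 0" if "z \<in> unit_disk" for z using that by (simp add: abs_square_less_1)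
  have W0: "1 - (cmod z)\<^sup>2 \<noteq> 0" if "z \<in> cball z0 \<rho>" for z using W[of z] \<rho>(2) that by fastforce
  have "continuous_on (cball z0 \<rho>) h"
    unfolding h_def using W0 holomorphic_on_imp_continuous_on[OF G] \<rho>(2)
    by (intro continuous_intros) (auto intro: continuous_on_subset)
  then obtain w where w: "w \<in> cball z0 \<rho>" "\<And>z. z \<in> cball z0 \<rho> \<Longrightarrow> h w \<le> h z"
    using continuous_attains_inf[of "cball z0 \<rho>" h] \<rho>(1) by auto
  have h0: "h w > 0" using W[of w] w(1) \<rho>(2) by (auto simp: h_def)
  define r where "r = sqrt (1 - min 1 (h w))"
  have "r < 1" using h0 by (simp add: r_def real_sqrt_lt_1_iff)
  moreover have "\<phi> t z \<in> cball 0 r" if "z \<in> cball z0 \<rho>" "t \<in> {0..T}" for z t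
  proof -
    have zd: "z \<in> unit_disk" using that \<rho> by blast
    have "h w \<le> 1 - (cmod (\<phi> t z))\<^sup>2"
      using solves_disk_estimate[OF G \<phi>(2)[OF zd] that(2) ctr] w(2)[OF that(1)] \<phi>(1)[OF zd]
      by (simp add: h_def)
    then have "(cmod (\<phi> t z))\<^sup>2 \<le> 1 - min 1 (h w)" by simp
    then show ?thesis by (simp add: r_def real_le_rsqrt)
  qed
  ultimately show thesis using that \<rho> by blast
qed

lemma norm_diff_bound_of_vector_derivative:
  fixes f :: "real \<Rightarrow> complex"
  assumes "\<And>t. t \<in> {0..T} \<Longrightarrow> (f has_vector_derivative f' t) (at t within {0..T})"
    and "\<And>t. t \<in> {0..T} \<Longrightarrow> cmod (f' t) \<le> B" and "t \<in> {0..T}"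
  shows "cmod (f t - f 0) \<le> B * t"
proof -
  have "norm (f t - f 0) \<le> B * norm (t - 0)"
  proof (rule differentiable_bound[where S="{0..T}" and f'="\<lambda>x h. h *\<^sub>R f' x"])
    fix x assume x: "x \<in> {0..T}"
    show "(f has_derivative (\<lambda>h. h *\<^sub>R f' x)) (at x within {0..T})"
      using assms(1)[OF x] by (simp add: has_vector_derivative_def)
    show "onorm (\<lambda>h. h *\<^sub>R f' x) \<le> B"
      using assms(2)[OF x] onorm_scaleR_left[OF bounded_linear_ident, of "f' x"] by (simp add: onorm_id)
  qed (use assms(3) in auto)
  then show ?thesis using assms(3) by simp
qed

text \<open>Linearisation along the trajectory of \<open>z0\<close>: the difference of two solutions
  obeys the linear equation with coefficient G'(\<phi> t z0) up to an error quadratic in |w - z0|.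
  Multiplied by the integrating factor \<open>E\<close> it stays within O(|w - z0|^2) of its initial
  value w - z0, so the derivative is 1 / E(T).\<close>

lemma flow_holomorphic:
  fixes G :: "complex \<Rightarrow> complex"
  assumes G: "G holomorphic_on unit_disk" and T: "T \<ge> 0"
    and ctr: "contracting G"
    and \<phi>: "\<And>z. z \<in> unit_disk \<Longrightarrow> \<phi> 0 z = z" "\<And>z. z \<in> unit_disk \<Longrightarrow> solves G (\<lambda>t. \<phi> t z) {0..T}"
  shows "\<phi> T holomorphic_on unit_disk"
proof -
  have "\<exists>D. (\<phi> T has_field_derivative D) (at z0)" if z0: "z0 \<in> unit_disk" for z0
  proof -
    obtain \<rho> r where \<rho>: "\<rho> > 0" and r: "r < 1" and sub: "cball z0 \<rho> \<subseteq> unit_disk"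
      and in_r: "\<And>z t. z \<in> cball z0 \<rho> \<Longrightarrow> t \<in> {0..T} \<Longrightarrow> \<phi> t z \<in> cball 0 r"
      using flow_locally_uniform[OF G z0 T ctr \<phi>] by blast
    obtain L where L: "L \<ge> 0" "\<And>x y. x \<in> cball 0 r \<Longrightarrow> y \<in> cball 0 r \<Longrightarrow> cmod (G x - G y) \<le> L * cmod (x - y)"
      using lipschitz_on_smaller_disk[OF G r] by blast
    have G': "deriv G holomorphic_on unit_disk" by (rule holomorphic_deriv[OF G open_ball])
    obtain L' where L': "L' \<ge> 0" "\<And>x y. x \<in> cball 0 r \<Longrightarrow> y \<in> cball 0 r \<Longrightarrow> cmod (deriv G x - deriv G y) \<le> L' * cmod (x - y)"
      using lipschitz_on_smaller_disk[OF G' r] by blast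
    have rd: "cball 0 r \<subseteq> unit_disk" using r by auto
    have z0b: "z0 \<in> cball z0 \<rho>" using \<rho> by simp
    have taylor: "cmod (G w - G z - deriv G z * (w - z)) \<le> L' * cmod (w - z) * cmod (w - z)"
      if "w \<in> cball 0 r" "z \<in> cball 0 r" for w z
    proof -
      define S where "S = cball 0 r \<inter> cball z (cmod (w - z))"
      have "cmod ((G w - deriv G z * w) - (G z - deriv G z * z)) \<le> (L' * cmod (w - z)) * cmod (w - z)"
      proof (rule field_differentiable_bound[where S=S and f="\<lambda>x. G x - deriv G z * x" and f'="\<lambda>x. deriv G x - deriv G z"])
        show "convex S" unfolding S_def by (intro convex_Int convex_cball)
        show "w \<in> S" "z \<in> S" using that by (auto simp: S_def dist_norm norm_minus_commute)
        fix x assume x: "x \<in> S"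
        have "(G has_field_derivative deriv G x) (at x)"
          using x rd by (intro holomorphic_derivI[OF G open_ball]) (auto simp: S_def)
        then have "((\<lambda>x. G x - deriv G z * x) has_field_derivative deriv G x - deriv G z * 1) (at x)"
          by (intro DERIV_diff DERIV_cmult DERIV_ident)
        then show "((\<lambda>x. G x - deriv G z * x) has_field_derivative deriv G x - deriv G z) (at x within S)"
          by (auto intro: has_field_derivative_at_within)
        have "cmod (deriv G x - deriv G z) \<le> L' * cmod (x - z)"
          using x that by (intro L'(2)) (auto simp: S_def)
        also have "\<dots> \<le> L' * cmod (w - z)"
          using x L'(1) by (intro mult_left_mono) (auto simp: S_def dist_norm norm_minus_commute)
        finally show "cmod (deriv G x - deriv G z) \<le> L' * cmod (w - z)" .
      qed
      then show ?thesis by (simp add: algebra_simps)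
    qed
    have sol: "solves G (\<lambda>t. \<phi> t w) {0..T}" if "w \<in> cball z0 \<rho>" for w
      using that sub \<phi>(2) by blast
    define a where "a = (\<lambda>s. deriv G (\<phi> s z0))"
    have ac: "continuous_on {0..T} a"
      unfolding a_def
      by (rule continuous_on_compose2[OF holomorphic_on_imp_continuous_on[OF G'] solves_continuous[OF sol[OF z0b]]])
         (use in_r[OF z0b] rd in auto)
    define A where "A = (\<lambda>t. integral {0..t} a)"
    define E where "E = (\<lambda>t. exp (- A t))"
    have dA: "(A has_vector_derivative a t) (at t within {0..T})" if "t \<in> {0..T}" for t
      unfolding A_def by (rule integral_has_vector_derivative[OF ac that])
    have dE: "(E has_vector_derivative - (a t * E t)) (at t within {0..T})" if t: "t \<in> {0..T}" for t
    proof -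
      have "((\<lambda>x. exp (- x)) has_field_derivative - exp (- A t)) (at (A t) within A ` {0..T})"
        by (auto intro!: derivative_eq_intros)
      from field_vector_diff_chain_within[OF dA[OF t] this] show ?thesis by (simp add: o_def E_def)
    qed
    have "continuous_on {0..T} E"
      using dE by (meson continuous_on_eq_continuous_within has_vector_derivative_continuous)
    then have "bounded (E ` {0..T})" by (intro compact_imp_bounded compact_continuous_image) auto
    then obtain B where B: "B > 0" "\<And>t. t \<in> {0..T} \<Longrightarrow> cmod (E t) \<le> B" by (auto simp: bounded_pos)
    define C where "C = L' * (exp (L * T))\<^sup>2 * B * T"
    have key: "cmod ((\<phi> T w - \<phi> T z0) * E T - (w - z0)) \<le> C * (cmod (w - z0))\<^sup>2" if w: "w \<in> cball z0 \<rho>" for w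
    proof -
      define D where "D = (\<lambda>t. \<phi> t w - \<phi> t z0)"
      define d where "d = cmod (w - z0)"
      have wz: "\<phi> 0 w = w" "\<phi> 0 z0 = z0" using \<phi>(1) w sub z0 by auto
      have Db: "cmod (D t) \<le> exp (L * T) * d" if t: "t \<in> {0..T}" for t
      proof -
        have "cmod (D t) \<le> exp (L * t) * cmod (\<phi> 0 w - \<phi> 0 z0)"
          unfolding D_def by (rule gronwall_lipschitz[where B="cball 0 r", OF sol[OF w] sol[OF z0b] in_r[OF w] in_r[OF z0b] L(2) t])
        also have "\<dots> \<le> exp (L * T) * d"
          unfolding wz d_def using t L(1) by (intro mult_right_mono) (auto intro: mult_left_mono)
        finally show ?thesis .
      qed
      define f where "f = (\<lambda>t. D t * E t)"
      define f' where "f' = (\<lambda>t. D t * - (a t * E t) + (G (\<phi> t w) - G (\<phi> t z0)) * E t)"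
      have "cmod (f T - f 0) \<le> (L' * (exp (L * T))\<^sup>2 * B * d\<^sup>2) * T"
      proof (rule norm_diff_bound_of_vector_derivative[where f'=f' and T=T])
        fix t assume t: "t \<in> {0..T}"
        have "(D has_vector_derivative G (\<phi> t w) - G (\<phi> t z0)) (at t within {0..T})"
          unfolding D_def using sol[OF w] sol[OF z0b] t by (intro derivative_intros) (auto simp: solves_def)
        then show "(f has_vector_derivative f' t) (at t within {0..T})"
          unfolding f_def f'_def by (intro has_vector_derivative_mult dE t)
        have "f' t = (G (\<phi> t w) - G (\<phi> t z0) - deriv G (\<phi> t z0) * (\<phi> t w - \<phi> t z0)) * E t"
          by (simp add: f'_def a_def D_def algebra_simps)
        then have "cmod (f' t) = cmod (G (\<phi> t w) - G (\<phi> t z0) - deriv G (\<phi> t z0) * (\<phi> t w - \<phi> t z0)) * cmod (E t)"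
          by (simp add: norm_mult)
        also have "\<dots> \<le> (L' * cmod (D t) * cmod (D t)) * B"
          unfolding D_def using L'(1) by (intro mult_mono taylor in_r w z0b t B) auto
        also have "\<dots> \<le> (L' * (exp (L * T) * d) * (exp (L * T) * d)) * B"
          using L'(1) B(1) Db[OF t] by (intro mult_right_mono mult_mono mult_left_mono) (auto simp: d_def)
        also have "\<dots> = L' * (exp (L * T))\<^sup>2 * B * d\<^sup>2" by (simp add: power2_eq_square mult_ac)
        finally show "cmod (f' t) \<le> L' * (exp (L * T))\<^sup>2 * B * d\<^sup>2" .
      qed (use T in simp)
      moreover have "f T = (\<phi> T w - \<phi> T z0) * E T" by (simp add: f_def D_def)
      moreover have "f 0 = w - z0" by (simp add: f_def D_def wz E_def A_def)
      ultimately show ?thesis by (simp add: C_def d_def mult_ac)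
    qed
    have E0: "E T \<noteq> 0" by (simp add: E_def)
    have "((\<lambda>w. ((\<phi> T w - \<phi> T z0) * E T - (w - z0)) / (w - z0)) \<longlongrightarrow> 0) (at z0)"
    proof (rule Lim_null_comparison)
      show "\<forall>\<^sub>F w in at z0. norm (((\<phi> T w - \<phi> T z0) * E T - (w - z0)) / (w - z0)) \<le> C * cmod (w - z0)"
      proof -
        have "\<forall>\<^sub>F w in at z0. w \<in> ball z0 \<rho>" by (rule eventually_at_in_open') (use \<rho> in auto)
        then show ?thesis using eventually_neq_at_within[of z0 z0 UNIV]
        proof eventually_elim
          case (elim w)
          then have "cmod ((\<phi> T w - \<phi> T z0) * E T - (w - z0)) \<le> C * (cmod (w - z0))\<^sup>2" by (intro key) simp
          then show ?case using elim by (simp add: norm_divide pos_divide_le_eq power2_eq_square mult_ac)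
        qed
      qed
      have "((\<lambda>w. C * cmod (w - z0)) \<longlongrightarrow> C * cmod (z0 - z0)) (at z0)" by (intro tendsto_intros)
      then show "((\<lambda>w. C * cmod (w - z0)) \<longlongrightarrow> 0) (at z0)" by simp
    qed
    then have "((\<lambda>w. (((\<phi> T w - \<phi> T z0) * E T - (w - z0)) / (w - z0) + 1) / E T) \<longlongrightarrow> (0 + 1) / E T) (at z0)"
      by (intro tendsto_intros E0)
    moreover have "\<forall>\<^sub>F w in at z0. (((\<phi> T w - \<phi> T z0) * E T - (w - z0)) / (w - z0) + 1) / E T = (\<phi> T w - \<phi> T z0) / (w - z0)"
      using eventually_neq_at_within[of z0 z0 UNIV]
      by eventually_elim (use E0 in \<open>simp add: diff_divide_distrib\<close>)
    ultimately have "((\<lambda>w. (\<phi> T w - \<phi> T z0) / (w - z0)) \<longlongrightarrow> (0 + 1) / E T) (at z0)"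
      by (rule Lim_transform_eventually)
    then show ?thesis by (auto simp: has_field_derivative_iff)
  qed
  then show ?thesis by (simp add: holomorphic_on_open field_differentiable_def)
qed

theorem semigroup_of_contracting_field:
  fixes G :: "complex \<Rightarrow> complex"
  assumes G: "G holomorphic_on unit_disk"
    and ctr: "contracting G"
  obtains \<phi> where "hol_semigroup \<phi>" "generates G \<phi>"
proof -
  have "\<forall>z. \<exists>x. z \<in> unit_disk \<longrightarrow> x 0 = z \<and> solves G x {0..}"
    using solves_global_exists[OF G _ ctr] by metis
  then obtain X where X: "\<And>z. z \<in> unit_disk \<Longrightarrow> X z 0 = z" "\<And>z. z \<in> unit_disk \<Longrightarrow> solves G (X z) {0..}" by metis
  define \<phi> where "\<phi> = (\<lambda>t z. X z t)"
  have \<phi>0: "\<phi> 0 z = z" if "z \<in> unit_disk" for z using X(1)[OF that] by (simp add: \<phi>_def)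
  have sol: "solves G (\<lambda>t. \<phi> t z) {0..}" if "z \<in> unit_disk" for z using X(2)[OF that] by (simp add: \<phi>_def)
  have disk: "\<phi> t z \<in> unit_disk" if "t \<ge> 0" "z \<in> unit_disk" for t z
    using sol[OF that(2)] that(1) by (simp add: solves_def)
  have gen: "generates G \<phi>" using G sol by (simp add: generates_def solves_def)
  have "\<phi> t holomorphic_on unit_disk" if "t \<ge> 0" for t
    by (rule flow_holomorphic[OF G that ctr \<phi>0 solves_subset[OF sol]]) auto
  moreover have "\<phi> (s + t) z = \<phi> s (\<phi> t z)" if s: "s \<ge> 0" and t: "t \<ge> 0" and z: "z \<in> unit_disk" for s t z
  proof -
    \<comment> \<open>The field is autonomous, so a time shift of a solution is a solution;
      uniqueness turns this into the semigroup law.\<close>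
    have "solves G (\<lambda>u. \<phi> (u + t) z) {0..}"
      unfolding solves_def
    proof (intro ballI conjI)
      fix u :: real assume u: "u \<in> {0..}"
      show "\<phi> (u + t) z \<in> unit_disk" using u t z by (intro disk) auto
      have d: "((\<lambda>v. \<phi> v z) has_vector_derivative G (\<phi> (u + t) z)) (at (u + t) within {0..})"
        using sol[OF z] u t by (simp add: solves_def)
      have "((\<lambda>v. \<phi> v z) has_vector_derivative G (\<phi> (u + t) z)) (at (u + t) within (\<lambda>v. v + t) ` {0..})"
        by (rule has_vector_derivative_within_subset[OF d]) (use t in auto)
      moreover have "((\<lambda>v. v + t) has_vector_derivative 1) (at u within {0..})"
        by (auto intro!: derivative_eq_intros)
      ultimately have "((\<lambda>v. \<phi> v z) \<circ> (\<lambda>v. v + t) has_vector_derivative 1 *\<^sub>R G (\<phi> (u + t) z)) (at u within {0..})"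
        by (intro vector_diff_chain_within)
      then show "((\<lambda>u. \<phi> (u + t) z) has_vector_derivative G (\<phi> (u + t) z)) (at u within {0..})"
        by (simp add: o_def)
    qed
    then have a: "solves G (\<lambda>u. \<phi> (u + t) z) {0..s}" by (rule solves_subset) auto
    have b: "solves G (\<lambda>u. \<phi> u (\<phi> t z)) {0..s}"
      by (rule solves_subset[OF sol[OF disk[OF t z]]]) auto
    have c: "\<phi> (0 + t) z = \<phi> 0 (\<phi> t z)" using \<phi>0[OF disk[OF t z]] by simp
    have "s \<in> {0..s}" using s by simp
    note solves_unique[OF G a b c this]
    then show ?thesis by simp
  qed
  moreover have "((\<lambda>t. \<phi> t z) \<longlongrightarrow> z) (at_right 0)" if z: "z \<in> unit_disk" for z
  proof -
    have "continuous_on {0..} (\<lambda>t. \<phi> t z)" by (rule solves_continuous[OF sol[OF z]])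
    then have "((\<lambda>t. \<phi> t z) \<longlongrightarrow> \<phi> 0 z) (at 0 within {0..})" by (auto simp: continuous_on_def)
    then show ?thesis using \<phi>0[OF z] by (simp add: at_within_Ici_at_right)
  qed
  ultimately have "hol_semigroup \<phi>"
    using \<phi>0 disk by (simp add: hol_semigroup_def image_subset_iff)
  with gen show thesis using that by blast
qed

section \<open>From Berkson--Porta functions to generators\<close>

lemma generates_solves:
  assumes "hol_semigroup \<phi>" "generates G \<phi>" "z \<in> unit_disk"
  shows "solves G (\<lambda>t. \<phi> t z) {0..}"
  using assms semigroup_disk[OF assms(1)] by (simp add: solves_def generates_def)

text \<open>Put b = bp_factor \<tau>, A = |\<tau> - z| and B = |1 - cnj \<tau> z|. The identity (1 -
  |z|^2) b' + 2 cnj z b = - (A^2 + B^2) and the bound (1 - |z|^2) |p'| \<le> 2 Re p together leave -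
  (A - B)^2 Re p.\<close>

lemma bp_field_contracting:
  assumes p: "p holomorphic_on unit_disk" "\<And>z. z \<in> unit_disk \<Longrightarrow> 0 \<le> Re (p z)"
    and G: "\<And>z. z \<in> unit_disk \<Longrightarrow> G z = bp_factor \<tau> z * p z" and z: "z \<in> unit_disk"
  shows "(1 - (cmod z)\<^sup>2) * Re (deriv G z) + 2 * Re (cnj z * G z) \<le> 0"
proof -
  define b' where "b' = - (1 - cnj \<tau> * z) - cnj \<tau> * (\<tau> - z)"
  define A B where "A = cmod (\<tau> - z)" and "B = cmod (1 - cnj \<tau> * z)"
  have "(bp_factor \<tau> has_field_derivative b') (at z)"
    unfolding bp_factor_def[abs_def] b'_def by (auto intro!: derivative_eq_intros simp: algebra_simps)
  moreover have "(p has_field_derivative deriv p z) (at z)" by (rule holomorphic_derivI[OF p(1) open_ball z])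
  ultimately have "((\<lambda>z. bp_factor \<tau> z * p z) has_field_derivative b' * p z + deriv p z * bp_factor \<tau> z) (at z)"
    by (rule DERIV_mult)
  then have "(G has_field_derivative b' * p z + deriv p z * bp_factor \<tau> z) (at z)"
    by (rule has_field_derivative_transform_within_open[OF _ open_ball z]) (simp add: G)
  then have dG: "deriv G z = b' * p z + deriv p z * bp_factor \<tau> z" by (rule DERIV_imp_deriv)
  have id: "of_real (1 - (cmod z)\<^sup>2) * b' + 2 * (cnj z * bp_factor \<tau> z) = - of_real (A\<^sup>2 + B\<^sup>2)"
    unfolding A_def B_def b'_def bp_factor_def of_real_add of_real_diff complex_norm_square
    by (simp add: algebra_simps)
  have "(1 - (cmod z)\<^sup>2) * Re (deriv G z) + 2 * Re (cnj z * G z)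
      = Re (of_real (1 - (cmod z)\<^sup>2) * deriv G z + 2 * (cnj z * G z))" by simp
  also have "of_real (1 - (cmod z)\<^sup>2) * deriv G z + 2 * (cnj z * G z)
      = (of_real (1 - (cmod z)\<^sup>2) * b' + 2 * (cnj z * bp_factor \<tau> z)) * p z + of_real (1 - (cmod z)\<^sup>2) * (deriv p z * bp_factor \<tau> z)"
    unfolding dG G[OF z] by (simp add: algebra_simps)
  also have "Re \<dots> = - (A\<^sup>2 + B\<^sup>2) * Re (p z) + (1 - (cmod z)\<^sup>2) * Re (deriv p z * bp_factor \<tau> z)"
    unfolding id by simp
  also have "(1 - (cmod z)\<^sup>2) * Re (deriv p z * bp_factor \<tau> z) \<le> (1 - (cmod z)\<^sup>2) * (cmod (deriv p z) * (A * B))"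
    using z complex_Re_le_cmod[of "deriv p z * bp_factor \<tau> z"]
    by (intro mult_left_mono) (auto simp: norm_mult bp_factor_def A_def B_def abs_square_le_1)
  also have "\<dots> = (1 - (cmod z)\<^sup>2) * cmod (deriv p z) * (A * B)" by simp
  also have "\<dots> \<le> 2 * Re (p z) * (A * B)"
    using deriv_bound_half_plane[OF p z] by (intro mult_right_mono) (auto simp: A_def B_def)
  finally have "(1 - (cmod z)\<^sup>2) * Re (deriv G z) + 2 * Re (cnj z * G z) \<le> - ((A - B)\<^sup>2 * Re (p z))"
    by (simp add: power2_eq_square algebra_simps)
  also have "\<dots> \<le> 0" using p(2)[OF z] by simp
  finally show ?thesis .
qed

section \<open>The Denjoy--Wolff point of the constructed flow\<close>

lemma Re_inverse_sphere:
  assumes "cmod \<tau> = 1" "w \<in> unit_disk"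
  shows "2 * Re (1 / (1 - cnj \<tau> * w)) - 1 = (1 - (cmod w)\<^sup>2) / (cmod (\<tau> - w))\<^sup>2"
proof -
  have n: "1 - cnj \<tau> * w \<noteq> 0" using one_minus_cnj_mult_nonzero[of \<tau> w] assms by simp
  define q where "q = 1 / (1 - cnj \<tau> * w)"
  have "kern \<tau> w = 2 * q - 1"
    using kern_mult[OF assms] n by (simp add: q_def field_simps)
  then have "Re (kern \<tau> w) = 2 * Re q - 1" by simp
  then show ?thesis by (simp add: Re_kern[OF assms(1)] q_def)
qed

text \<open>In the half-plane coordinate 1 / (1 - cnj \<tau> w) the field becomes \<open>p\<close>,
  so the real part \<open>V\<close> of this coordinate is a strict Lyapunov function whose level
  sets are horocycles at \<tau>. A limit point other than \<tau> would be interior and realise the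
  supremum of \<open>V\<close> along the orbit, yet flowing on for time 1 would exceed it.\<close>

lemma flow_boundary_dw:
  assumes sg: "hol_semigroup \<phi>" and gen: "generates G \<phi>" and \<tau>: "cmod \<tau> = 1"
    and p: "\<And>z. z \<in> unit_disk \<Longrightarrow> 0 < Re (p z)"
    and G: "\<And>z. z \<in> unit_disk \<Longrightarrow> G z = bp_factor \<tau> z * p z" and z: "z \<in> unit_disk"
  shows "((\<lambda>t. \<phi> t z) \<longlongrightarrow> \<tau>) at_top"
proof -
  define V where "V = (\<lambda>w. Re (1 / (1 - cnj \<tau> * w)))"
  have nz: "1 - cnj \<tau> * w \<noteq> 0" if "w \<in> unit_disk" for w
    using one_minus_cnj_mult_nonzero[of \<tau> w] \<tau> that by simp
  have mono: "V (\<phi> a w) < V (\<phi> b w)" if w: "w \<in> unit_disk" and ab: "0 \<le> a" "a < b" for w a b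
  proof -
    have sol: "solves G (\<lambda>t. \<phi> t w) {0..}" by (rule generates_solves[OF sg gen w])
    have d: "((\<lambda>t. V (\<phi> t w)) has_real_derivative Re (p (\<phi> t w))) (at t within {0..})" if t: "t \<in> {0..}" for t
    proof -
      have x: "\<phi> t w \<in> unit_disk" and dx: "((\<lambda>t. \<phi> t w) has_vector_derivative G (\<phi> t w)) (at t within {0..})"
        using sol t by (auto simp: solves_def)
      have "((\<lambda>w. 1 / (1 - cnj \<tau> * w)) has_field_derivative cnj \<tau> / (1 - cnj \<tau> * \<phi> t w)\<^sup>2)
         (at (\<phi> t w) within (\<lambda>t. \<phi> t w) ` {0..})"
        using nz[OF x] by (auto intro!: derivative_eq_intros simp: power2_eq_square)
      from field_vector_diff_chain_within[OF dx this]
      have "((\<lambda>t. 1 / (1 - cnj \<tau> * \<phi> t w)) has_vector_derivative G (\<phi> t w) * (cnj \<tau> / (1 - cnj \<tau> * \<phi> t w)\<^sup>2)) (at t within {0..})"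
        by (simp add: o_def)
      moreover have "G (\<phi> t w) * (cnj \<tau> / (1 - cnj \<tau> * \<phi> t w)\<^sup>2) = p (\<phi> t w)"
      proof -
        have "\<tau> * cnj \<tau> = 1" using \<tau> by (simp add: complex_norm_square[symmetric])
        moreover have "G (\<phi> t w) = \<tau> * (1 - cnj \<tau> * \<phi> t w)\<^sup>2 * p (\<phi> t w)"
          using G[OF x] by (simp add: bp_factor_sphere(1)[OF \<tau>])
        ultimately show ?thesis using nz[OF x] by (simp add: mult_ac)
      qed
      ultimately show ?thesis by (simp add: V_def has_vector_derivative_complex_iff)
    qed
    have "continuous_on {a..b} (\<lambda>t. V (\<phi> t w))"
    proof (rule continuous_on_subset)
      show "continuous_on {0..} (\<lambda>t. V (\<phi> t w))"
        using d by (meson DERIV_continuous continuous_on_eq_continuous_within)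
    qed (use ab in auto)
    moreover have "\<exists>y. DERIV (\<lambda>t. V (\<phi> t w)) x :> y \<and> 0 < y" if "a < x" "x < b" for x
    proof -
      have "x \<in> interior {0..}" using that ab by (simp add: interior_Ici[of "-1"])
      then have "at x within {0..} = at x" by (rule at_within_interior)
      moreover have "\<phi> x w \<in> unit_disk" using that ab w by (intro semigroup_disk[OF sg]) auto
      ultimately show ?thesis using d[of x] p that ab by auto
    qed
    ultimately show ?thesis using DERIV_pos_imp_increasing_open[OF ab(2)] by blast
  qed
  show ?thesis
  proof (rule ccontr)
    assume "\<not> ?thesis"
    then obtain e where e: "e > 0" "\<not> (\<forall>\<^sub>F t in at_top. dist (\<phi> t z) \<tau> < e)"
      unfolding tendsto_iff by blast
    have "\<forall>k. \<exists>t. t \<ge> real k \<and> dist (\<phi> t z) \<tau> \<ge> e"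
      using e(2) unfolding eventually_at_top_linorder by (meson not_le)
    then obtain t where t: "\<And>k. t k \<ge> real k" "\<And>k. dist (\<phi> (t k) z) \<tau> \<ge> e" by metis
    have t0: "t k \<ge> 0" for k using t(1)[of k] by (meson of_nat_0_le_iff order_trans)
    have xd: "\<phi> (t k) z \<in> unit_disk" for k by (rule semigroup_disk[OF sg t0 z])
    have "\<forall>k. \<phi> (t k) z \<in> cball 0 1" using xd by (auto intro: less_imp_le)
    then obtain w r where w: "w \<in> cball 0 1" "strict_mono r" "((\<lambda>k. \<phi> (t k) z) \<circ> r) \<longlonglongrightarrow> w"
      using compact_cball[of "0::complex" 1] unfolding compact_def by metis
    define x where "x = (\<lambda>k. \<phi> (t (r k)) z)"
    have xl: "x \<longlonglongrightarrow> w" using w(3) by (simp add: x_def o_def)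
    have "(\<lambda>k. dist (x k) \<tau>) \<longlonglongrightarrow> dist w \<tau>" by (intro tendsto_intros xl)
    then have we: "e \<le> dist w \<tau>" by (rule tendsto_lowerbound) (use t(2) in \<open>auto simp: x_def\<close>)
    have Vmono: "V z \<le> V (\<phi> s z)" if "s \<ge> 0" for s
      using mono[OF z, of 0 s] that sg z by (cases "s = 0") (auto simp: hol_semigroup_def)
    \<comment> \<open>As \<open>V\<close> does not decrease, the orbit stays in the horodisk c
      |\<tau> - x|^2 \<le> 1 - |x|^2, whose closure meets the circle only at \<tau>.\<close>
    define c where "c = 2 * V z - 1"
    have c: "c > 0"
      using Re_inverse_sphere[OF \<tau> z] z sphere_neq_disk[OF \<tau> z] by (simp add: c_def V_def abs_square_less_1)
    have "c * (cmod (\<tau> - x k))\<^sup>2 \<le> 1 - (cmod (x k))\<^sup>2" for k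
    proof -
      have xk: "x k \<in> unit_disk" using xd by (simp add: x_def)
      have "c \<le> 2 * V (x k) - 1" using Vmono[OF t0] by (simp add: c_def x_def)
      then show ?thesis
        using Re_inverse_sphere[OF \<tau> xk] sphere_neq_disk[OF \<tau> xk] by (simp add: V_def pos_le_divide_eq)
    qed
    then have "c * (cmod (\<tau> - w))\<^sup>2 \<le> 1 - (cmod w)\<^sup>2"
      by (intro LIMSEQ_le[of "\<lambda>k. c * (cmod (\<tau> - x k))\<^sup>2" _ "\<lambda>k. 1 - (cmod (x k))\<^sup>2"] tendsto_intros xl) auto
    moreover have "w \<noteq> \<tau>" using e(1) we by auto
    then have "c * (cmod (\<tau> - w))\<^sup>2 > 0" using c by simp
    ultimately have "(cmod w)\<^sup>2 < 1" by linarith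
    then have wd: "w \<in> unit_disk" by (simp add: abs_square_less_1)
    have "continuous_on unit_disk V"
      unfolding V_def using nz by (intro continuous_intros) auto
    then have Vc: "isCont V y" if "y \<in> unit_disk" for y
      using that by (simp add: continuous_on_eq_continuous_at)
    have "(\<lambda>k. V (x k)) \<longlonglongrightarrow> V w" by (rule isCont_tendsto_compose[OF Vc[OF wd] xl])
    moreover have sup: "V (\<phi> s z) \<le> V w" if s: "s \<ge> 0" for s
    proof (rule tendsto_lowerbound[OF calculation])
      obtain k0 where k0: "s < real k0" using reals_Archimedean2 by blast
      have "V (\<phi> s z) \<le> V (x k)" if "k \<ge> k0" for k
      proof -
        have "real k0 \<le> real (r k)" using that seq_suble[OF w(2), of k] by simp
        then have "s < t (r k)" using t(1)[of "r k"] k0 by linarith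
        then show ?thesis using mono[OF z s] by (auto simp: x_def intro: less_imp_le)
      qed
      then show "\<forall>\<^sub>F k in sequentially. V (\<phi> s z) \<le> V (x k)" by (auto simp: eventually_sequentially)
    qed simp
    have "isCont (\<phi> 1) w"
      using sg wd holomorphic_on_imp_continuous_on[of "\<phi> 1" unit_disk]
      by (auto simp: hol_semigroup_def continuous_on_eq_continuous_at)
    then have "(\<lambda>k. \<phi> 1 (x k)) \<longlonglongrightarrow> \<phi> 1 w" by (rule isCont_tendsto_compose[OF _ xl])
    then have "(\<lambda>k. V (\<phi> 1 (x k))) \<longlonglongrightarrow> V (\<phi> 1 w)"
      by (rule isCont_tendsto_compose[OF Vc[OF semigroup_disk[OF sg zero_le_one wd]]])
    moreover have "V (\<phi> 1 (x k)) \<le> V w" for k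
    proof -
      have "\<phi> 1 (x k) = \<phi> (1 + t (r k)) z" using sg z t0 by (simp add: hol_semigroup_def x_def)
      then show ?thesis using sup[of "1 + t (r k)"] t0[of "r k"] by simp
    qed
    ultimately have "V (\<phi> 1 w) \<le> V w" by (intro tendsto_upperbound) auto
    moreover have "V (\<phi> 0 w) < V (\<phi> 1 w)" by (rule mono[OF wd]) auto
    moreover have "\<phi> 0 w = w" using sg wd by (simp add: hol_semigroup_def)
    ultimately show False by simp
  qed
qed

lemma flow_interior_dw:
  assumes sg: "hol_semigroup \<phi>" and gen: "generates G \<phi>" and \<tau>: "\<tau> \<in> unit_disk" "G \<tau> = 0" and t: "t \<ge> 0"
  shows "\<phi> t \<tau> = \<tau>"
proof -
  have "solves G (\<lambda>_. \<tau>) {0..t}" using \<tau> by (simp add: solves_def)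
  moreover have "solves G (\<lambda>t. \<phi> t \<tau>) {0..t}" by (rule solves_subset[OF generates_solves[OF sg gen \<tau>(1)]]) auto
  moreover have "G holomorphic_on unit_disk" using gen by (simp add: generates_def)
  moreover have "\<phi> 0 \<tau> = \<tau>" using sg \<tau> by (simp add: hol_semigroup_def)
  ultimately show ?thesis using solves_unique[of G "\<lambda>t. \<phi> t \<tau>" t "\<lambda>_. \<tau>" t] t by simp
qed

section \<open>Boundary regular fixed points of the constructed flow\<close>

lemma stolz_kern_bound:
  assumes s: "cmod s = 1" and z: "z \<in> stolz s K"
  shows "cmod (kern s z) \<le> K * Re (kern s z)"
proof -
  have zd: "z \<in> unit_disk" and st: "cmod (s - z) < K * (1 - cmod z)" using z by (auto simp: stolz_def)
  define d where "d = cmod (s - z)"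
  have d: "d > 0" using sphere_neq_disk[OF s zd] by (simp add: d_def)
  have "cmod (s + z) * d \<le> (1 + cmod z) * (K * (1 - cmod z))"
    using norm_triangle_ineq[of s z] s st d by (intro mult_mono) (auto simp: d_def)
  then have "cmod (s + z) * d / d\<^sup>2 \<le> K * (1 - (cmod z)\<^sup>2) / d\<^sup>2"
    by (intro divide_right_mono) (auto simp: power2_eq_square algebra_simps)
  then show ?thesis
    using d unfolding Re_kern[OF s] by (simp add: kern_def norm_divide d_def[symmetric] power2_eq_square)
qed

text \<open>Converse of \<open>stolz_kern_bound\<close>: near \<open>s\<close>, Stolz regions
  correspond to sectors |u| \<le> K Re u in the coordinate u = kern s. The constant comes from |s +
  w| \<ge> 1 and 1 - |w|^2 \<le> 2 (1 - |w|), with 3 instead of 2 for strictness.\<close>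

lemma kern_bound_stolz:
  assumes s: "cmod s = 1" and w: "w \<in> unit_disk" and near: "cmod (s - w) \<le> 1"
    and b: "cmod (kern s w) \<le> K * Re (kern s w)"
  shows "w \<in> stolz s (3 * K)"
proof -
  define d where "d = cmod (s - w)"
  have d: "d > 0" using sphere_neq_disk[OF s w] by (simp add: d_def)
  have W: "1 - cmod w > 0" using w by simp
  have "cmod (s + w) \<ge> 1"
    using norm_triangle_ineq2[of "2 * s" "s - w"] near s by (simp add: norm_mult)
  have "cmod (s + w) / d \<le> K * ((1 - (cmod w)\<^sup>2) / d\<^sup>2)"
    using b unfolding Re_kern[OF s] by (simp add: kern_def norm_divide d_def)
  then have "cmod (s + w) / d * d\<^sup>2 \<le> K * ((1 - (cmod w)\<^sup>2) / d\<^sup>2) * d\<^sup>2"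
    by (rule mult_right_mono) simp
  then have le: "cmod (s + w) * d \<le> K * (1 - (cmod w)\<^sup>2)" using d by (simp add: power2_eq_square)
  have "1 * d \<le> cmod (s + w) * d" using \<open>cmod (s + w) \<ge> 1\<close> d by (intro mult_right_mono) auto
  with le have dK: "d \<le> K * (1 - (cmod w)\<^sup>2)" by simp
  have w2: "1 - (cmod w)\<^sup>2 > 0" using w by (simp add: abs_square_less_1)
  have K: "K > 0" using dK d w2 by (smt (verit) mult_nonpos_nonneg)
  have "1 - (cmod w)\<^sup>2 = (1 + cmod w) * (1 - cmod w)" by (simp add: power2_eq_square algebra_simps)
  also have "\<dots> \<le> 2 * (1 - cmod w)" using W by (intro mult_right_mono) auto
  finally have "d \<le> K * (2 * (1 - cmod w))" using dK K by (smt (verit) mult_left_mono)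
  also have "\<dots> < 3 * K * (1 - cmod w)" using K W by simp
  finally show ?thesis using w by (simp add: stolz_def d_def)
qed

lemma kern_plus_1: "s \<noteq> z \<Longrightarrow> kern s z + 1 = 2 * s / (s - z)"
  by (simp add: kern_def field_simps)

text \<open>In the half plane coordinate \<open>u = kern s (\<phi> t z)\<close> the flow solves \<open>u' = Q u\<close> with \<open>Q \<rightarrow> l\<close>
  in Stolz regions, so \<open>u\<close> stays close to \<open>exp (l t) u(0)\<close>; a continuity argument keeps the
  trajectory in a larger Stolz region.\<close>

lemma flow_kern_asymptotic:
  assumes sg: "hol_semigroup \<phi>" and gen: "generates G \<phi>" and s: "cmod s = 1" and l: "l \<le> 0"
    and Q: "\<And>K. K > 1 \<Longrightarrow> ((\<lambda>z. 2 * s * G z / ((s - z) * (s + z))) \<longlongrightarrow> complex_of_real l) (at s within stolz s K)"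
    and K: "K > 1" and T: "T \<ge> 0"
  shows "((\<lambda>z. kern s (\<phi> T z) / kern s z) \<longlongrightarrow> complex_of_real (exp (l * T))) (at s within stolz s K)"
proof (rule tendstoI)
  fix e0 :: real assume e0: "e0 > 0"
  \<comment> \<open>The relative error allowed for \<open>v\<close> around \<open>u0\<close>. The
    bound 1 / (2 K) costs at most half of the lower bound |u0| / K for Re u0, so \<open>v\<close>
    stays in a sector of constant 4 K and the trajectory in the Stolz region of constant 12
    K.\<close>
  define \<delta> where "\<delta> = min e0 (1 / (2 * K))"
  have \<delta>: "\<delta> > 0" "\<delta> \<le> e0" "\<delta> \<le> 1 / (2 * K)" using e0 K by (auto simp: \<delta>_def)
  have \<delta>2: "\<delta> \<le> 1/2"
  proof -
    have "1 / (2 * K) \<le> 1/2" using K by (simp add: field_simps)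
    then show ?thesis using \<delta>(3) by linarith
  qed
  \<comment> \<open>A drift of speed at most 2 \<epsilon> |u0| over time \<open>T\<close> adds up to
    less than \<delta> |u0|.\<close>
  define \<epsilon> where "\<epsilon> = \<delta> / (4 * (T + 1))"
  have \<epsilon>: "\<epsilon> > 0" using \<delta> T by (simp add: \<epsilon>_def)
  have \<epsilon>T: "2 * \<epsilon> * T < \<delta>"
  proof -
    have "2 * \<epsilon> * T = \<delta> * (T / (2 * (T + 1)))" using T by (simp add: \<epsilon>_def field_simps)
    also have "\<dots> < \<delta> * 1" using \<delta> T by (intro mult_strict_left_mono) (auto simp: field_simps)
    finally show ?thesis by simp
  qed
  define q where "q = (\<lambda>z. 2 * s * G z / ((s - z) * (s + z)))"
  have "\<forall>\<^sub>F w in at s within stolz s (12 * K). dist (q w) (of_real l) < \<epsilon>"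
    using Q[of "12 * K"] K \<epsilon> unfolding q_def tendsto_iff by auto
  then obtain \<eta> where \<eta>: "\<eta> > 0" "\<And>w. w \<in> stolz s (12 * K) \<Longrightarrow> w \<noteq> s \<Longrightarrow> dist w s < \<eta> \<Longrightarrow> dist (q w) (of_real l) < \<epsilon>"
    unfolding eventually_at by auto
  \<comment> \<open>As |s - w| = 2 / |kern s w + 1|, a kernel value of modulus at least
    \<open>R\<close> places \<open>w\<close> within \<eta> and within 1 of \<open>s\<close>.\<close>
  define R where "R = 2 / min \<eta> 1 + 2"
  have R: "R > 2" using \<eta>(1) by (simp add: R_def)
  have R\<eta>: "2 / (R - 1) < \<eta>" "2 / (R - 1) \<le> 1"
  proof -
    have m: "0 < min \<eta> 1" using \<eta> by simp
    have "2 / (R - 1) < 2 / (2 / min \<eta> 1)"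
    proof (rule divide_strict_left_mono)
      show "2 / min \<eta> 1 < R - 1" by (simp add: R_def)
      show "0 < (R - 1) * (2 / min \<eta> 1)" using m R by (intro mult_pos_pos) auto
    qed simp
    also have "2 / (2 / min \<eta> 1) = min \<eta> 1" by simp
    finally show "2 / (R - 1) < \<eta>" "2 / (R - 1) \<le> 1" by auto
  qed
  \<comment> \<open>\<open>v\<close> may drop to half of |u0|, and the factor exp (l t) is at least
    exp (l T); hence |u0| \<ge> U keeps |u t| \<ge> R up to time \<open>T\<close>.\<close>
  define U where "U = 2 * R * exp (- l * T)"
  have U: "U > 0" using R by (simp add: U_def)
  have close: "cmod (kern s (\<phi> T z) / kern s z - of_real (exp (l * T))) < e0"
    if z: "z \<in> stolz s K" and zs: "dist z s < 2 / (U + 1)" for z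
  proof -
    have zd: "z \<in> unit_disk" using z by (simp add: stolz_def)
    define u where "u = (\<lambda>t. kern s (\<phi> t z))"
    define v where "v = (\<lambda>t. u t * exp (of_real (- l * t)))"
    define u0 where "u0 = kern s z"
    have sol: "solves G (\<lambda>t. \<phi> t z) {0..T}"
      by (rule solves_subset[OF generates_solves[OF sg gen zd]]) auto
    have xd: "\<phi> t z \<in> unit_disk" if "t \<in> {0..T}" for t using sol that by (simp add: solves_def)
    have v0: "v 0 = u0" using sg zd by (simp add: v_def u_def u0_def hol_semigroup_def)
    have u0U: "cmod u0 \<ge> U"
    proof -
      have d: "0 < cmod (s - z)" using sphere_neq_disk[OF s zd] by simp
      have "U + 1 \<le> 2 / cmod (s - z)"
        using zs d U by (simp add: dist_norm norm_minus_commute field_simps)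
      also have "\<dots> = cmod (u0 + 1)"
        using kern_plus_1[of s z] d s by (simp add: u0_def norm_divide norm_mult)
      also have "\<dots> \<le> cmod u0 + 1" using norm_triangle_ineq[of u0 1] by simp
      finally show ?thesis by simp
    qed
    then have u00: "cmod u0 > 0" using U by linarith
    have Ru0: "cmod u0 \<le> K * Re u0" unfolding u0_def by (rule stolz_kern_bound[OF s z])
    have near: "cmod (q (\<phi> t z) - of_real l) \<le> \<epsilon> \<and> cmod (v t) \<le> 2 * cmod u0"
      if t: "t \<in> {0..T}" and c: "cmod (v t - u0) \<le> \<delta> * cmod u0" for t
    proof -
      define w where "w = \<phi> t z"
      have wd: "w \<in> unit_disk" using xd[OF t] by (simp add: w_def)
      have ws: "s \<noteq> w" using sphere_neq_disk[OF s wd] by auto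
      have b2: "\<delta> * cmod u0 \<le> 1/2 * cmod u0" using \<delta>2 u00 by (intro mult_right_mono) auto
      have vle: "cmod (v t) \<le> 2 * cmod u0" and vge: "cmod (v t) \<ge> cmod u0 / 2"
        using norm_triangle_ineq3[of "v t" u0] c b2 u00 by linarith+
      have "Re (u0 - v t) \<le> \<delta> * cmod u0"
        using complex_Re_le_cmod[of "u0 - v t"] c by (simp add: norm_minus_commute)
      also have "\<dots> \<le> 1 / (2 * K) * cmod u0" using \<delta>(3) u00 by (intro mult_right_mono) auto
      finally have "Re u0 - cmod u0 / (2 * K) \<le> Re (v t)" by simp
      moreover have "cmod u0 / K \<le> Re u0" using Ru0 K by (simp add: pos_divide_le_eq mult.commute)
      moreover have "cmod u0 / K = 2 * (cmod u0 / (2 * K))" using K by simp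
      ultimately have "cmod u0 / (2 * K) \<le> Re (v t)" by linarith
      then have "cmod u0 \<le> 2 * K * Re (v t)" using K by (simp add: pos_divide_le_eq mult.commute)
      then have vK: "cmod (v t) \<le> 4 * K * Re (v t)" using vle by linarith
      have uv: "u t = v t * of_real (exp (l * t))"
        by (simp add: v_def exp_minus exp_of_real[symmetric] field_simps)
      have "cmod (v t) * exp (l * t) \<le> 4 * K * Re (v t) * exp (l * t)" using vK by (intro mult_right_mono) auto
      then have uK: "cmod (kern s w) \<le> 4 * K * Re (kern s w)"
        using uv by (simp add: u_def w_def norm_mult mult_ac)
      have "R = U / 2 * exp (l * T)" by (simp add: U_def exp_minus field_simps)
      also have "\<dots> \<le> cmod (v t) * exp (l * t)"
        using u0U vge l t U by (intro mult_mono) (auto intro: mult_left_mono_neg)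
      also have "\<dots> = cmod (kern s w)" using uv by (simp add: u_def w_def norm_mult)
      finally have kR: "R - 1 \<le> cmod (kern s w + 1)"
        using norm_triangle_ineq2[of "kern s w" "-1"] by simp
      have "cmod (s - w) = 2 / cmod (kern s w + 1)"
        using kern_plus_1[OF ws] s ws by (simp add: norm_divide norm_mult)
      also have "\<dots> \<le> 2 / (R - 1)" using kR R by (intro divide_left_mono) (auto intro!: mult_pos_pos)
      finally have sw: "cmod (s - w) \<le> 2 / (R - 1)" .
      have "w \<in> stolz s (3 * (4 * K))"
        by (rule kern_bound_stolz[OF s wd _ uK]) (use sw R\<eta> in linarith)
      then have "dist (q w) (of_real l) < \<epsilon>"
        using ws sw R\<eta> by (intro \<eta>(2)) (auto simp: dist_norm norm_minus_commute)
      then show ?thesis using vle by (simp add: dist_norm w_def)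
    qed
    have dv: "(v has_vector_derivative (q (\<phi> t z) - of_real l) * v t) (at t within {0..T})" if t: "t \<in> {0..T}" for t
    proof -
      define w where "w = \<phi> t z"
      have wd: "w \<in> unit_disk" using xd[OF t] by (simp add: w_def)
      have n: "s - w \<noteq> 0" by (rule sphere_neq_disk[OF s wd])
      have n2: "s + w \<noteq> 0" using sphere_neq_disk[of "-s" w] s wd by (auto simp: add_eq_0_iff)
      have dx: "((\<lambda>t. \<phi> t z) has_vector_derivative G w) (at t within {0..T})"
        using sol t by (simp add: solves_def w_def)
      have "(kern s has_field_derivative 2 * s / (s - w)\<^sup>2) (at w within (\<lambda>t. \<phi> t z) ` {0..T})"
        unfolding kern_def[abs_def] using n
        by (auto intro!: derivative_eq_intros simp: power2_eq_square field_simps)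
      from field_vector_diff_chain_within[OF dx[unfolded w_def] this[unfolded w_def]]
      have du: "(u has_vector_derivative G w * (2 * s / (s - w)\<^sup>2)) (at t within {0..T})"
        by (simp add: u_def o_def w_def)
      have "G w * (2 * s / (s - w)\<^sup>2) = q w * u t"
        using n n2 by (simp add: q_def u_def kern_def w_def[symmetric] power2_eq_square)
      note du[unfolded this]
      moreover have "((\<lambda>t. exp (complex_of_real (- l * t))) has_vector_derivative - of_real l * exp (complex_of_real (- l * t))) (at t within {0..T})"
      proof -
        have "((\<lambda>t. complex_of_real (- l) * of_real t) has_vector_derivative of_real (- l)) (at t within {0..T})"
          by (auto intro!: derivative_eq_intros)
        from field_vector_diff_chain_within[OF this has_field_derivative_at_within[OF DERIV_exp]] show ?thesis
          by (simp add: o_def)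
      qed
      ultimately have "(v has_vector_derivative u t * (- of_real l * exp (of_real (- l * t))) + q w * u t * exp (of_real (- l * t))) (at t within {0..T})"
        unfolding v_def by (rule has_vector_derivative_mult)
      then show ?thesis by (simp add: v_def w_def algebra_simps)
    qed
    have vc: "continuous_on {0..T} v"
      using dv by (meson continuous_on_eq_continuous_within has_vector_derivative_continuous)
    \<comment> \<open>Continuity argument: up to the first time at which the error equals \<delta>
      |u0| the estimate \<open>near\<close> is available, and it shows that the error is still
      smaller.\<close>
    have bound: "cmod (v T - u0) < \<delta> * cmod u0"
    proof (rule ccontr)
      assume a: "\<not> ?thesis"
      have fc: "continuous_on {0..T} (\<lambda>t. cmod (v t - u0))" by (intro continuous_intros vc)
      obtain t1 where t1: "t1 \<in> {0..T}" "cmod (v t1 - u0) = \<delta> * cmod u0" "\<And>t. t \<in> {0..t1} \<Longrightarrow> cmod (v t - u0) \<le> \<delta> * cmod u0"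
        using first_hitting_time[OF fc, of "\<delta> * cmod u0" T] a v0 \<delta> u00 T by auto
      have "cmod (v t1 - v 0) \<le> \<epsilon> * (2 * cmod u0) * t1"
      proof (rule norm_diff_bound_of_vector_derivative[where T=t1 and f'="\<lambda>t. (q (\<phi> t z) - of_real l) * v t"])
        fix t assume t: "t \<in> {0..t1}"
        then have tT: "t \<in> {0..T}" using t1(1) by auto
        show "(v has_vector_derivative (q (\<phi> t z) - of_real l) * v t) (at t within {0..t1})"
          by (rule has_vector_derivative_within_subset[OF dv[OF tT]]) (use t1(1) in auto)
        show "cmod ((q (\<phi> t z) - of_real l) * v t) \<le> \<epsilon> * (2 * cmod u0)"
          unfolding norm_mult using near[OF tT t1(3)[OF t]] \<epsilon> by (intro mult_mono) auto
      qed (use t1(1) in auto)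
      also have "\<dots> \<le> \<epsilon> * (2 * cmod u0) * T" using t1(1) \<epsilon> by (intro mult_left_mono) auto
      also have "\<dots> = (2 * \<epsilon> * T) * cmod u0" by simp
      also have "\<dots> < \<delta> * cmod u0" using \<epsilon>T u00 by (intro mult_strict_right_mono)
      finally show False using t1(2) v0 by simp
    qed
    have "kern s (\<phi> T z) / kern s z - of_real (exp (l * T)) = (v T - u0) * of_real (exp (l * T)) / u0"
      using u00 by (simp add: v_def u_def[symmetric] u0_def[symmetric] exp_of_real[symmetric] exp_minus field_simps)
        (simp add: u_def)
    then have "cmod (kern s (\<phi> T z) / kern s z - of_real (exp (l * T))) = cmod (v T - u0) * exp (l * T) / cmod u0"
      by (simp add: norm_mult norm_divide)
    also have "\<dots> \<le> cmod (v T - u0) * 1 / cmod u0"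
      using l T by (intro divide_right_mono mult_left_mono) (auto simp: mult_nonpos_nonneg)
    also have "\<dots> < \<delta>" using bound u00 by (simp add: pos_divide_less_eq)
    finally show ?thesis using \<delta>(2) by linarith
  qed
  show "\<forall>\<^sub>F z in at s within stolz s K. dist (kern s (\<phi> T z) / kern s z) (of_real (exp (l * T))) < e0"
    unfolding eventually_at
    by (rule exI[of _ "2 / (U + 1)"]) (use close U in \<open>auto simp: dist_norm\<close>)
qed

lemma flow_brfp:
  assumes sg: "hol_semigroup \<phi>" and gen: "generates G \<phi>" and s: "cmod s = 1" and l: "l \<le> 0"
    and Q: "\<And>K. K > 1 \<Longrightarrow> ((\<lambda>z. 2 * s * G z / ((s - z) * (s + z))) \<longlongrightarrow> complex_of_real l) (at s within stolz s K)"
  shows "brfp \<phi> s l"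
proof -
  have s0: "s \<noteq> 0" using s by auto
  have lims: "((\<lambda>z. (\<phi> t z - s) / (z - s)) \<longlongrightarrow> complex_of_real (exp (- l * t))) (at s within stolz s K)
      \<and> (\<phi> t \<longlongrightarrow> s) (at s within stolz s K)"
    if t: "t \<ge> 0" and K: "K > 1" for t K
  proof -
    define F where "F = at s within stolz s K"
    define E where "E = complex_of_real (exp (l * t))"
    have E: "E \<noteq> 0" by (simp add: E_def)
    have l1: "((\<lambda>z. kern s (\<phi> t z) / kern s z) \<longlongrightarrow> E) F"
      unfolding F_def E_def by (rule flow_kern_asymptotic[OF sg gen s l Q K t])
    have "((\<lambda>z. (s - z) / (s + z)) \<longlongrightarrow> (s - s) / (s + s)) F"
      unfolding F_def using s0 by (intro tendsto_intros) auto
    then have l2: "((\<lambda>z. (s - z) / (s + z)) \<longlongrightarrow> 0) F" by simp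
    \<comment> \<open>With u0 and u the kernel values of z and \<phi> t z, the wanted quotient is
      (u0 + 1) / (u + 1). Dividing through by u0 leaves only u / u0 and 1 / u0, where the latter
      tends to 0; the inversion turns exp (l t) into exp (- l t).\<close>
    have "((\<lambda>z. (1 + (s - z) / (s + z)) / (kern s (\<phi> t z) / kern s z + (s - z) / (s + z))) \<longlongrightarrow> (1 + 0) / (E + 0)) F"
      using E by (intro tendsto_intros l1 l2) simp
    moreover have "\<forall>\<^sub>F z in F. (1 + (s - z) / (s + z)) / (kern s (\<phi> t z) / kern s z + (s - z) / (s + z)) = (\<phi> t z - s) / (z - s)"
      using eventually_stolz_disk[of s K] unfolding F_def
    proof eventually_elim
      case (elim z)
      then have zd: "z \<in> unit_disk" by simp
      define u0 where "u0 = kern s z"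
      define u where "u = kern s (\<phi> t z)"
      have pd: "\<phi> t z \<in> unit_disk" by (rule semigroup_disk[OF sg t zd])
      have p0: "Re u0 > 0" "Re u > 0" unfolding u0_def u_def by (rule Re_kern_pos[OF s zd], rule Re_kern_pos[OF s pd])
      then have n0: "u0 \<noteq> 0" "u0 + 1 \<noteq> 0" "u + 1 \<noteq> 0" by (auto simp: complex_eq_iff)
      have nz: "s - z \<noteq> 0" "s - \<phi> t z \<noteq> 0" using sphere_neq_disk[OF s zd] sphere_neq_disk[OF s pd] by auto
      have k: "u0 + 1 = 2 * s / (s - z)" "u + 1 = 2 * s / (s - \<phi> t z)"
        unfolding u0_def u_def using nz by (auto intro!: kern_plus_1)
      have "(s - z) / (s + z) = 1 / u0" by (simp add: u0_def kern_def)
      then have "(1 + (s - z) / (s + z)) / (u / u0 + (s - z) / (s + z)) = (1 + 1 / u0) / (u / u0 + 1 / u0)" by simp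
      also have "\<dots> = (u0 + 1) / (u + 1)" using n0 by (simp add: add_divide_distrib[symmetric] divide_simps)
      also have "\<dots> = (s - \<phi> t z) / (s - z)" unfolding k using s0 by simp
      also have "\<dots> = (\<phi> t z - s) / (z - s)" by (metis minus_diff_eq minus_divide_divide)
      finally show ?case by (simp only: u_def u0_def)
    qed
    ultimately have "((\<lambda>z. (\<phi> t z - s) / (z - s)) \<longlongrightarrow> (1 + 0) / (E + 0)) F"
      by (rule Lim_transform_eventually)
    moreover have "(1 + 0) / (E + 0) = complex_of_real (exp (- l * t))"
      by (simp add: E_def exp_minus field_simps flip: of_real_inverse)
    ultimately have r: "((\<lambda>z. (\<phi> t z - s) / (z - s)) \<longlongrightarrow> complex_of_real (exp (- l * t))) F"
      by simp
    have "((\<lambda>z. s + (\<phi> t z - s) / (z - s) * (z - s)) \<longlongrightarrow> s + complex_of_real (exp (- l * t)) * (s - s)) F"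
      by (intro tendsto_intros r) (simp add: F_def)
    moreover have "\<forall>\<^sub>F z in F. s + (\<phi> t z - s) / (z - s) * (z - s) = \<phi> t z"
      unfolding F_def eventually_at_filter by (auto intro: always_eventually)
    ultimately have "(\<phi> t \<longlongrightarrow> s + complex_of_real (exp (- l * t)) * (s - s)) F"
      by (rule Lim_transform_eventually)
    with r show ?thesis by (simp add: F_def)
  qed
  then show ?thesis by (simp add: brfp_def angular_limit_def)
qed

text \<open>On the radius (1 - r) Re (kern (\<sigma> k) z) = 1 + r. Multiplying the class inequality
  by 1 - r and letting r tend to 1 compares the weight with the actual mass \<open>M\<close> of
  \<open>1 / p\<close>.\<close>

lemma bp_class_atom:
  assumes p: "bp_class \<tau> n \<sigma> \<Lambda> p" and \<sigma>: "\<forall>k<n. \<sigma> k \<in> sphere 0 1" and k: "k < n"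
  obtains M where "M \<ge> atom_weight \<tau> (\<sigma> k) (\<Lambda> k)"
    "angular_limit (\<lambda>z. (1 - cnj (\<sigma> k) * z) * (1 / p z)) (\<sigma> k) (2 * of_real M)"
proof -
  define s where "s = \<sigma> k"
  define c where "c = atom_weight \<tau> (\<sigma> k) (\<Lambda> k)"
  have s: "cmod s = 1" using \<sigma> k by (simp add: s_def)
  have hp: "p holomorphic_on unit_disk" and rp: "\<And>z. z \<in> unit_disk \<Longrightarrow> 0 < Re (p z)"
    and cp: "\<And>z. z \<in> unit_disk \<Longrightarrow> c * Re (kern s z) \<le> Re (1 / p z)"
    using p k by (auto simp: bp_class_def s_def c_def)
  have nz: "p z \<noteq> 0" if "z \<in> unit_disk" for z using rp[OF that] by auto
  have hq: "(\<lambda>z. 1 / p z) holomorphic_on unit_disk" using nz by (intro holomorphic_intros hp)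
  have req: "0 \<le> Re (1 / p z)" if "z \<in> unit_disk" for z
    using rp[OF that] by (simp add: Re_divide_alt)
  obtain M where M: "M \<ge> 0" "\<And>z. z \<in> unit_disk \<Longrightarrow> M * Re (kern s z) \<le> Re (1 / p z)"
    "angular_limit (\<lambda>z. (1 - cnj s * z) * (1 / p z)) s (2 * of_real M)"
    using julia_caratheodory[OF hq req s] by blast
  have cs: "cnj s * s = 1" using s by (simp add: complex_norm_square[symmetric] mult.commute)
  have "((\<lambda>r. Re ((1 - cnj s * (of_real r * s)) * (1 / p (of_real r * s)))) \<longlongrightarrow> Re (2 * of_real M)) (at_left 1)"
    by (intro tendsto_Re angular_limit_radial[OF M(3) s])
  moreover have "((\<lambda>r. c * (1 + r)) \<longlongrightarrow> c * (1 + 1)) (at_left 1)" by (intro tendsto_intros)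
  moreover have "\<forall>\<^sub>F r in at_left (1::real). c * (1 + r) \<le> Re ((1 - cnj s * (of_real r * s)) * (1 / p (of_real r * s)))"
    using eventually_radial
  proof eventually_elim
    case (elim r)
    define z where "z = complex_of_real r * s"
    have z: "z \<in> unit_disk" using elim s by (simp add: z_def norm_mult)
    have e: "cnj s * z = of_real r" using cs by (simp add: z_def mult.left_commute)
    have "of_real (1 - r) * kern s z = of_real (1 + r)" using kern_mult[OF s z] by (simp add: e)
    then have "Re (of_real (1 - r) * kern s z) = 1 + r" by simp
    then have k1: "(1 - r) * Re (kern s z) = 1 + r" by simp
    have "(1 - r) * (c * Re (kern s z)) \<le> (1 - r) * Re (1 / p z)"
      using cp[OF z] elim by (intro mult_left_mono) auto
    also have "\<dots> = Re ((1 - cnj s * z) * (1 / p z))"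
    proof -
      have e1: "1 - cnj s * z = of_real (1 - r)" by (simp add: e)
      define q where "q = 1 / p z"
      show ?thesis unfolding e1 q_def[symmetric] by simp
    qed
    finally show ?case using k1 by (simp add: z_def mult.left_commute)
  qed
  ultimately have "c * (1 + 1) \<le> Re (2 * of_real M)" by (intro tendsto_le[of "at_left (1::real)"]) auto
  then have "c \<le> M" by simp
  with M(3) show thesis using that by (simp add: s_def c_def)
qed

text \<open>Converse of \<open>generator_imp_bp_class\<close>: perturbations are built as
  Berkson--Porta functions and have to be recognised as members of the convex set before extremality
  can be applied to them.\<close>

theorem bp_class_imp_generator:
  assumes p: "bp_class \<tau> n \<sigma> \<Lambda> p" and \<sigma>: "\<forall>k<n. \<sigma> k \<in> sphere 0 1" and \<Lambda>: "\<forall>k<n. \<Lambda> k < 0"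
    and \<tau>: "\<tau> \<in> cball 0 1" "\<tau> \<notin> \<sigma> ` {..<n}"
    and G: "\<And>z. z \<in> unit_disk \<Longrightarrow> G z = bp_factor \<tau> z * p z" "\<And>z. z \<notin> unit_disk \<Longrightarrow> G z = 0"
  shows "G \<in> Gen_FL \<tau> n \<sigma> \<Lambda>"
proof -
  have hp: "p holomorphic_on unit_disk" and rp: "\<And>z. z \<in> unit_disk \<Longrightarrow> 0 < Re (p z)"
    using p by (auto simp: bp_class_def)
  have nz: "p z \<noteq> 0" if "z \<in> unit_disk" for z using rp[OF that] by auto
  have "(\<lambda>z. bp_factor \<tau> z * p z) holomorphic_on unit_disk"
    unfolding bp_factor_def by (intro holomorphic_intros hp)
  then have hG: "G holomorphic_on unit_disk" by (rule holomorphic_transform) (simp add: G)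
  have "contracting G"
    unfolding contracting_def using bp_field_contracting[OF hp less_imp_le[OF rp] G(1)] by blast
  then obtain \<phi> where sg: "hol_semigroup \<phi>" and gen: "generates G \<phi>"
    using semigroup_of_contracting_field[OF hG] by blast
  have dw: "dw_point \<phi> \<tau>"
  proof (cases "\<tau> \<in> unit_disk")
    case True
    have "G \<tau> = 0" using G(1)[OF True] by (simp add: bp_factor_def)
    then show ?thesis using flow_interior_dw[OF sg gen True] True by (simp add: dw_point_def)
  next
    case False
    then have "cmod \<tau> = 1" using \<tau>(1) by simp
    then show ?thesis using flow_boundary_dw[OF sg gen _ rp G(1)] by (simp add: dw_point_def)
  qed
  have "\<exists>lam. \<Lambda> k \<le> lam \<and> lam \<le> 0 \<and> brfp \<phi> (\<sigma> k) lam" if k: "k < n" for k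
  proof -
    define s where "s = \<sigma> k"
    have s: "cmod s = 1" using \<sigma> k by (simp add: s_def)
    have s0: "s \<noteq> 0" using s by auto
    have ts: "\<tau> \<noteq> s" using \<tau>(2) k by (auto simp: s_def)
    define d where "d = (cmod (\<tau> - s))\<^sup>2"
    have d: "d > 0" using ts by (simp add: d_def)
    have Lk: "\<Lambda> k < 0" using \<Lambda> k by blast
    obtain M where M: "M \<ge> d / (2 * \<bar>\<Lambda> k\<bar>)"
      "angular_limit (\<lambda>z. (1 - cnj s * z) * (1 / p z)) s (2 * of_real M)"
      using bp_class_atom[OF p \<sigma> k] by (metis atom_weight_def d_def s_def)
    have "d / (2 * \<bar>\<Lambda> k\<bar>) > 0" using d Lk by (intro divide_pos_pos) auto
    then have M0: "M > 0" using M(1) by linarith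
    define l where "l = - d / (2 * M)"
    have l0: "l \<le> 0" using d M0 by (simp add: l_def)
    have a: "2 * \<bar>\<Lambda> k\<bar> > 0" using Lk by simp
    have "d \<le> M * (2 * \<bar>\<Lambda> k\<bar>)" using M(1) unfolding pos_divide_le_eq[OF a] .
    then have "d \<le> \<bar>\<Lambda> k\<bar> * (2 * M)" by (simp add: mult_ac)
    then have "d / (2 * M) \<le> \<bar>\<Lambda> k\<bar>" using M0 by (subst pos_divide_le_eq) auto
    then have lk: "\<Lambda> k \<le> l" using Lk by (simp add: l_def)
    have "((\<lambda>z. 2 * s * G z / ((s - z) * (s + z))) \<longlongrightarrow> complex_of_real l) (at s within stolz s K)" if K: "K > 1" for K
    proof -
      have lq: "((\<lambda>z. (1 - cnj s * z) * (1 / p z)) \<longlongrightarrow> 2 * of_real M) (at s within stolz s K)"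
        using M(2) K by (simp add: angular_limit_def)
      have lb: "(bp_factor \<tau> \<longlongrightarrow> bp_factor \<tau> s) (at s within stolz s K)"
        unfolding bp_factor_def[abs_def] by (intro tendsto_intros)
      have "((\<lambda>z. 2 * bp_factor \<tau> z / ((s + z) * ((1 - cnj s * z) * (1 / p z)))) \<longlongrightarrow> 2 * bp_factor \<tau> s / ((s + s) * (2 * of_real M))) (at s within stolz s K)"
        using s0 M0 by (intro tendsto_intros lq lb) auto
      moreover have "\<forall>\<^sub>F z in at s within stolz s K. 2 * bp_factor \<tau> z / ((s + z) * ((1 - cnj s * z) * (1 / p z))) = 2 * s * G z / ((s - z) * (s + z))"
        using eventually_stolz_disk[of s K]
      proof eventually_elim
        case (elim z)
        then have z: "z \<in> unit_disk" by simp
        show ?case unfolding diff_sphere_eq(1)[OF s] G(1)[OF z] using nz[OF z] s0 by (simp add: mult_ac)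
      qed
      ultimately have "((\<lambda>z. 2 * s * G z / ((s - z) * (s + z))) \<longlongrightarrow> 2 * bp_factor \<tau> s / ((s + s) * (2 * of_real M))) (at s within stolz s K)"
        by (rule Lim_transform_eventually)
      moreover have "2 * bp_factor \<tau> s / ((s + s) * (2 * of_real M)) = complex_of_real l"
        unfolding bp_factor_sphere(2)[OF s] d_def[symmetric] using s0 M0 by (simp add: l_def field_simps)
      ultimately show ?thesis by simp
    qed
    then have "brfp \<phi> s l" by (rule flow_brfp[OF sg gen s l0])
    then show ?thesis using l0 lk by (auto simp: s_def)
  qed
  then show ?thesis using sg gen dw G(2) unfolding Gen_FL_def by blast
qed

section \<open>Extreme points\<close>

text \<open>Written as a real-linear functional Sum Re (c k * u k) of the coefficients, the shape in
  which conditions on \<open>c\<close> enter \<open>underdetermined_homogeneous_complex\<close>. The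
  same shape recurs for the value and the slope of R.\<close>

lemma trig_circle:
  assumes s: "cmod s = 1"
  shows "trig n c s = of_real (\<Sum>k\<le>n. Re (c k * (2 * s ^ k)))"
proof -
  have "1 / s = cnj s"
    using s by (simp add: divide_eq_eq complex_norm_square[symmetric] mult.commute)
  then have "x / s ^ k = x * cnj s ^ k" for x k by (metis divide_inverse inverse_eq_divide power_inverse)
  then have "c k * s ^ k + cnj (c k) / s ^ k = of_real (Re (c k * (2 * s ^ k)))" for k
    using complex_add_cnj[of "c k * s ^ k"] by simp
  then show ?thesis by (simp only: trig_def of_real_sum)
qed

text \<open>Each inner sum over \<open>j\<close> is w - cnj w = 2 i Im w, and the extra term at k =
  0 encodes Im (c 0) = Re (- i c 0).\<close>

lemma trig_corr_circle:
  assumes s: "cmod s = 1"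
  shows "trig_corr n c f s = \<i> * of_real (\<Sum>k\<le>n. Re (c k * ((if k = 0 then - \<i> else 0) - 2 * \<i> * (\<Sum>j<k. cnj (tcoeff f j) * s ^ (k - j)))))"
proof -
  have "1 / s = cnj s"
    using s by (simp add: divide_eq_eq complex_norm_square[symmetric] mult.commute)
  then have inv: "x / s ^ k = x * cnj s ^ k" for x k by (metis divide_inverse inverse_eq_divide power_inverse)
  have "(\<Sum>j<k. c k * cnj (tcoeff f j) * s ^ (k - j) - cnj (c k) * tcoeff f j / s ^ (k - j))
      = \<i> * of_real (Re (c k * (- 2 * \<i> * (\<Sum>j<k. cnj (tcoeff f j) * s ^ (k - j)))))" for k
  proof -
    define w where "w = c k * (\<Sum>j<k. cnj (tcoeff f j) * s ^ (k - j))"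
    have "(\<Sum>j<k. c k * cnj (tcoeff f j) * s ^ (k - j) - cnj (c k) * tcoeff f j / s ^ (k - j)) = w - cnj w"
      unfolding sum_subtractf w_def inv by (simp add: sum_distrib_left mult.assoc)
    also have "\<dots> = \<i> * of_real (Re (- 2 * \<i> * w))" by (simp add: complex_eq_iff)
    also have "- 2 * \<i> * w = c k * (- 2 * \<i> * (\<Sum>j<k. cnj (tcoeff f j) * s ^ (k - j)))"
      by (simp add: w_def)
    finally show ?thesis .
  qed
  note T = this
  have "\<i> * of_real (Im (c 0)) = \<i> * of_real (\<Sum>k\<le>n. Re (c k * (if k = 0 then - \<i> else 0)))"
    by (simp add: if_distrib[of Re] if_distrib[of "\<lambda>x. c _ * x"] sum.delta cong: if_cong)
  then have "trig_corr n c f s = \<i> * of_real ((\<Sum>k\<le>n. Re (c k * (if k = 0 then - \<i> else 0)))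
      + (\<Sum>k\<le>n. Re (c k * (- 2 * \<i> * (\<Sum>j<k. cnj (tcoeff f j) * s ^ (k - j))))))"
    unfolding trig_corr_def T by (simp add: sum_distrib_left distrib_left)
  also have "(\<Sum>k\<le>n. Re (c k * (if k = 0 then - \<i> else 0))) + (\<Sum>k\<le>n. Re (c k * (- 2 * \<i> * (\<Sum>j<k. cnj (tcoeff f j) * s ^ (k - j)))))
     = (\<Sum>k\<le>n. Re (c k * ((if k = 0 then - \<i> else 0) - 2 * \<i> * (\<Sum>j<k. cnj (tcoeff f j) * s ^ (k - j)))))"
    unfolding sum.distrib[symmetric] by (intro sum.cong refl) (simp only: distrib_left[symmetric] plus_complex.sel(1)[symmetric], simp)
  finally show ?thesis .
qed

lemma laurent_term_derivative:
  assumes s: "s \<noteq> 0"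
  shows "((\<lambda>z. a * z ^ m - b / z ^ m) has_field_derivative (of_nat m * (a * s ^ m + b / s ^ m)) / s) (at (s::complex))"
proof (cases m)
  case (Suc l)
  have "((\<lambda>z. a * z ^ m - b / z ^ m) has_field_derivative
      a * (of_nat m * s ^ l) - (0 * s ^ m - b * (of_nat m * s ^ l)) / (s ^ m * s ^ m)) (at s)"
  proof -
    have d: "((\<lambda>z. z ^ m) has_field_derivative of_nat m * s ^ l) (at s)"
      using DERIV_power[OF DERIV_ident, where n=m] by (simp add: Suc)
    show ?thesis by (intro DERIV_diff DERIV_cmult d DERIV_divide DERIV_const) (use s in simp)
  qed
  moreover have "a * (of_nat m * s ^ l) - (0 * s ^ m - b * (of_nat m * s ^ l)) / (s ^ m * s ^ m) = (of_nat m * (a * s ^ m + b / s ^ m)) / s"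
    using s unfolding Suc by (simp add: field_simps)
  ultimately show ?thesis by simp
qed simp

text \<open>On the circle R is i times a real function of the angle, so s R'(s) is real. As R(s) =
  0, the quotient by 1 - r tends to - s R'(s), which is again one real functional of
  \<open>c\<close>.\<close>

lemma trig_corr_radial:
  assumes s: "cmod s = 1" and z: "trig_corr n c f s = 0"
  shows "((\<lambda>r. trig_corr n c f (of_real r * s) / (1 - of_real r)) \<longlongrightarrow>
     - of_real (\<Sum>k\<le>n. Re (c k * (2 * (\<Sum>j<k. of_nat (k - j) * cnj (tcoeff f j) * s ^ (k - j)))))) (at_left 1)"
proof -
  have s0: "s \<noteq> 0" using s by auto
  have "1 / s = cnj s"
    using s by (simp add: divide_eq_eq complex_norm_square[symmetric] mult.commute)
  then have inv: "x / s ^ k = x * cnj s ^ k" for x k by (metis divide_inverse inverse_eq_divide power_inverse)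
  define D where "D = (\<Sum>k\<le>n. \<Sum>j<k. of_nat (k - j) * (c k * cnj (tcoeff f j) * s ^ (k - j) + cnj (c k) * tcoeff f j / s ^ (k - j)) / s)"
  have "(trig_corr n c f has_field_derivative 0 + D) (at s)"
    unfolding trig_corr_def[abs_def] D_def
    by (intro DERIV_add DERIV_const DERIV_sum laurent_term_derivative s0)
  then have "((\<lambda>w. (trig_corr n c f w - trig_corr n c f s) / (w - s)) \<longlongrightarrow> D) (at s)"
    by (simp add: has_field_derivative_iff)
  then have "((\<lambda>w. (trig_corr n c f w - trig_corr n c f s) / (w - s)) \<longlongrightarrow> D) (at s within stolz s 2)"
    by (rule tendsto_within_subset) simp
  then have "((\<lambda>r. (trig_corr n c f (of_real r * s) - trig_corr n c f s) / (of_real r * s - s)) \<longlongrightarrow> D) (at_left 1)"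
    by (rule filterlim_compose[OF _ filterlim_radial[OF s]]) simp
  then have "((\<lambda>r. - s * ((trig_corr n c f (of_real r * s) - trig_corr n c f s) / (of_real r * s - s))) \<longlongrightarrow> - s * D) (at_left 1)"
    by (intro tendsto_intros)
  moreover have "- s * ((trig_corr n c f (of_real r * s) - trig_corr n c f s) / (of_real r * s - s)) = trig_corr n c f (of_real r * s) / (1 - of_real r)" for r
  proof -
    have "of_real r * s - s = - s * (1 - of_real r)" by (simp add: algebra_simps)
    then show ?thesis using s0 z by simp
  qed
  ultimately have "((\<lambda>r. trig_corr n c f (of_real r * s) / (1 - of_real r)) \<longlongrightarrow> - s * D) (at_left 1)" by (simp only:)
  moreover have "s * D = of_real (\<Sum>k\<le>n. Re (c k * (2 * (\<Sum>j<k. of_nat (k - j) * cnj (tcoeff f j) * s ^ (k - j)))))"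
  proof -
    have "(\<Sum>j<k. s * (of_nat (k - j) * (c k * cnj (tcoeff f j) * s ^ (k - j) + cnj (c k) * tcoeff f j / s ^ (k - j)) / s))
       = of_real (Re (c k * (2 * (\<Sum>j<k. of_nat (k - j) * cnj (tcoeff f j) * s ^ (k - j)))))" for k
    proof -
      define w where "w = c k * (\<Sum>j<k. of_nat (k - j) * cnj (tcoeff f j) * s ^ (k - j))"
      have "(\<Sum>j<k. s * (of_nat (k - j) * (c k * cnj (tcoeff f j) * s ^ (k - j) + cnj (c k) * tcoeff f j / s ^ (k - j)) / s)) = w + cnj w"
      proof -
        have "(\<Sum>j<k. s * (of_nat (k - j) * (c k * cnj (tcoeff f j) * s ^ (k - j) + cnj (c k) * tcoeff f j / s ^ (k - j)) / s))
          = (\<Sum>j<k. of_nat (k - j) * (c k * cnj (tcoeff f j) * s ^ (k - j)) + of_nat (k - j) * (cnj (c k) * tcoeff f j * cnj s ^ (k - j)))"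
          unfolding inv by (intro sum.cong refl) (simp only: times_divide_eq_right nonzero_mult_div_cancel_left[OF s0], simp only: distrib_left)
        also have "\<dots> = w + cnj w"
          unfolding w_def sum.distrib by (simp add: sum_distrib_left mult_ac del: of_nat_diff)
        finally show ?thesis .
      qed
      also have "\<dots> = of_real (Re (2 * w))" by (simp add: complex_add_cnj)
      also have "2 * w = c k * (2 * (\<Sum>j<k. of_nat (k - j) * cnj (tcoeff f j) * s ^ (k - j)))" by (simp add: w_def)
      finally show ?thesis .
    qed
    then show ?thesis unfolding D_def sum_distrib_left of_real_sum by simp
  qed
  ultimately show ?thesis by simp
qed

section \<open>Clearing denominators: z^n T and z^n R as polynomials\<close>

definition trig_poly :: "nat \<Rightarrow> (nat \<Rightarrow> complex) \<Rightarrow> complex poly" where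
  "trig_poly n c = (\<Sum>k\<le>n. monom (c k) (n + k) + monom (cnj (c k)) (n - k))"

definition trig_corr_poly :: "nat \<Rightarrow> (nat \<Rightarrow> complex) \<Rightarrow> (complex \<Rightarrow> complex) \<Rightarrow> complex poly" where
  "trig_corr_poly n c f = monom (\<i> * of_real (Im (c 0))) n +
     (\<Sum>k\<le>n. \<Sum>j<k. monom (c k * cnj (tcoeff f j)) (n + (k - j)) - monom (cnj (c k) * tcoeff f j) (n - (k - j)))"

lemma poly_trig_poly: "z \<noteq> 0 \<Longrightarrow> poly (trig_poly n c) z = z ^ n * trig n c z"
  unfolding trig_poly_def trig_def poly_sum sum_distrib_left
  by (intro sum.cong refl) (auto simp: poly_monom power_add power_diff algebra_simps)

lemma poly_trig_corr_poly: "z \<noteq> 0 \<Longrightarrow> poly (trig_corr_poly n c f) z = z ^ n * trig_corr n c f z"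
  unfolding trig_corr_poly_def trig_corr_def poly_add poly_sum distrib_left sum_distrib_left
  by (intro arg_cong2[of _ _ _ _ "(+)"] sum.cong refl) (auto simp: poly_monom power_add power_diff algebra_simps)

lemma degree_trig_corr_poly: "degree (trig_corr_poly n c f) \<le> 2 * n"
  unfolding trig_corr_poly_def
  by (intro degree_add_le degree_sum_le degree_diff_le order_trans[OF degree_monom_le]) auto

text \<open>T determines \<open>c k\<close> for k > 0 and Re (c 0). The middle coefficient of z^n R
  is i Im (c 0), since j < k leaves no other term of that degree. Together they recover all of
  \<open>c\<close>.\<close>

lemma trig_polys_nonzero:
  assumes "\<exists>k\<le>n. c k \<noteq> 0"
  shows "trig_poly n c \<noteq> 0 \<or> trig_corr_poly n c f \<noteq> 0"
proof (rule ccontr)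
  assume "\<not> ?thesis"
  then have A: "coeff (trig_poly n c) m = 0" and B: "coeff (trig_corr_poly n c f) m = 0" for m by simp_all
  have "c k = 0" if k: "0 < k" "k \<le> n" for k
  proof -
    have "coeff (trig_poly n c) (n + k) = (\<Sum>i\<le>n. if i = k then c i else 0)"
      unfolding trig_poly_def coeff_sum using k by (intro sum.cong refl) auto
    then show ?thesis using A[of "n + k"] k by simp
  qed
  moreover have "c 0 = 0"
  proof -
    have "coeff (trig_poly n c) n = (\<Sum>i\<le>n. if i = 0 then c i + cnj (c i) else 0)"
      unfolding trig_poly_def coeff_sum by (intro sum.cong refl) auto
    then have "c 0 + cnj (c 0) = 0" using A[of n] by simp
    moreover have "coeff (trig_corr_poly n c f) n = \<i> * of_real (Im (c 0)) + (\<Sum>k\<le>n. \<Sum>j<k. 0)"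
      unfolding trig_corr_poly_def coeff_add coeff_sum
      by (intro arg_cong2[of _ _ _ _ "(+)"] sum.cong refl) auto
    then have "Im (c 0) = 0" using B[of n] by simp
    ultimately show ?thesis by (simp add: complex_eq_iff)
  qed
  ultimately show False using assms by (metis gr0I)
qed

lemma kern_radial:
  assumes s: "cmod s = 1" and t: "cmod t = 1"
  shows "((\<lambda>r. (1 - cnj t * (of_real r * t)) * kern s (of_real r * t)) \<longlongrightarrow> (if s = t then 2 else 0)) (at_left 1)"
proof (cases "s = t")
  case True
  have "((\<lambda>r. 1 + complex_of_real r) \<longlongrightarrow> 1 + of_real 1) (at_left 1)" by (intro tendsto_intros)
  moreover have "\<forall>\<^sub>F r in at_left 1. 1 + complex_of_real r = (1 - cnj t * (of_real r * t)) * kern s (of_real r * t)"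
    using eventually_radial
  proof eventually_elim
    case (elim r)
    show ?case using kern_mult[OF t radial_in_disk[OF t elim]] cnj_radial[OF t, of r] True by (simp only:)
  qed
  ultimately have "((\<lambda>r. (1 - cnj t * (of_real r * t)) * kern s (of_real r * t)) \<longlongrightarrow> 1 + of_real 1) (at_left 1)"
    by (rule Lim_transform_eventually)
  then show ?thesis using True by simp
next
  case False
  have "((\<lambda>r. (1 - complex_of_real r) * kern s (of_real r * t)) \<longlongrightarrow> (1 - of_real 1) * ((s + of_real 1 * t) / (s - of_real 1 * t))) (at_left 1)"
    unfolding kern_def using False by (intro tendsto_intros) auto
  then show ?thesis using False by (simp add: cnj_radial[OF t])
qed

text \<open>Atoms are removed one at a time: by \<open>kern_radial\<close> the kernel of
  \<open>s\<close> has no mass at another point \<open>t\<close>, so the hypotheses at the remaining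
  points survive each removal.\<close>

lemma subtract_atoms:
  assumes "finite Z" "f holomorphic_on unit_disk" "\<And>z. z \<in> unit_disk \<Longrightarrow> 0 \<le> Re (f z)"
    and "\<And>s. s \<in> Z \<Longrightarrow> cmod s = 1"
    and "\<And>s. s \<in> Z \<Longrightarrow> ((\<lambda>r. (1 - cnj s * (of_real r * s)) * f (of_real r * s)) \<longlongrightarrow> 2 * of_real (m s)) (at_left 1)"
    and "\<And>s. s \<in> Z \<Longrightarrow> c s \<le> m s" and "z \<in> unit_disk"
  shows "0 \<le> Re (f z - (\<Sum>s\<in>Z. of_real (c s) * kern s z))"
  using assms
proof (induction Z arbitrary: f z rule: finite_induct)
  case (insert s Z)
  have s: "cmod s = 1" using insert.prems by simp
  obtain m' where m': "\<And>z. z \<in> unit_disk \<Longrightarrow> m' * Re (kern s z) \<le> Re (f z)"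
    "angular_limit (\<lambda>z. (1 - cnj s * z) * f z) s (2 * of_real m')"
    using julia_caratheodory[OF insert.prems(1,2) s] by blast
  have "2 * complex_of_real (m s) = 2 * of_real m'"
    by (rule angular_limit_unique[OF m'(2) s]) (rule insert.prems(4), simp)
  then have "m s = m'" by simp
  then have cm: "c s \<le> m'" using insert.prems(5)[of s] by simp
  define g where "g = (\<lambda>z. f z - of_real (c s) * kern s z)"
  have "0 \<le> Re (g z - (\<Sum>s\<in>Z. of_real (c s) * kern s z))"
  proof (rule insert.IH)
    show "g holomorphic_on unit_disk" unfolding g_def using s by (intro holomorphic_intros insert.prems(1))
    show "0 \<le> Re (g z)" if z: "z \<in> unit_disk" for z
    proof -
      have "c s * Re (kern s z) \<le> m' * Re (kern s z)"
        using cm Re_kern_pos[OF s z] by (intro mult_right_mono) auto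
      then show ?thesis using m'(1)[OF z] by (simp add: g_def)
    qed
    fix t assume t: "t \<in> Z"
    then have t1: "cmod t = 1" "s \<noteq> t" using insert by auto
    have "((\<lambda>r. (1 - cnj t * (of_real r * t)) * f (of_real r * t) - of_real (c s) * ((1 - cnj t * (of_real r * t)) * kern s (of_real r * t)))
        \<longlongrightarrow> 2 * of_real (m t) - of_real (c s) * (if s = t then 2 else 0)) (at_left 1)"
      by (rule tendsto_diff[OF insert.prems(4) tendsto_mult[OF tendsto_const kern_radial[OF s t1(1)]]]) (use t in simp)
    then show "((\<lambda>r. (1 - cnj t * (of_real r * t)) * g (of_real r * t)) \<longlongrightarrow> 2 * of_real (m t)) (at_left 1)"
      using t1 by (simp add: g_def right_diff_distrib mult.left_commute)
  qed (use insert.prems in auto)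
  then show ?case using insert.hyps by (simp add: g_def diff_diff_eq)
qed simp

lemma imag_quot_cancel_prod:
  assumes "finite Y" "imag_quot ((\<Prod>s\<in>Y. [:-s, 1:]) * V) ((\<Prod>s\<in>Y. [:-s, 1:]) * W)"
  shows "imag_quot V W"
  using assms
proof (induction Y rule: finite_induct)
  case (insert s Y)
  show ?case
    by (rule insert.IH, rule imag_quot_cancel[where a=s]) (use insert in \<open>simp add: mult.assoc del: mult_pCons_left\<close>)
qed simp

text \<open>Membership is checked through slopes. The slope of \<open>p + e h\<close> at
  \<open>\<sigma> k\<close> is at most 1 / (2 M k) + |e| |\<beta> k|, and
  \<open>reciprocal_atom\<close> turns a slope at most 1 / (2 w) into a mass at least
  \<open>w\<close>. The real part stays positive because |e| C < 1.\<close>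

lemma bp_class_perturb:
  assumes p: "bp_class \<tau> n \<sigma> \<Lambda> p" and \<sigma>: "\<forall>k<n. \<sigma> k \<in> sphere 0 1"
    and h: "h holomorphic_on unit_disk" "\<And>z. z \<in> unit_disk \<Longrightarrow> \<bar>Re (h z)\<bar> \<le> C * Re (p z)"
    and lim: "\<And>k. k < n \<Longrightarrow> ((\<lambda>r. p (of_real r * \<sigma> k) / (1 - of_real r)) \<longlongrightarrow> of_real (1 / (2 * M k))) (at_left 1)"
      "\<And>k. k < n \<Longrightarrow> ((\<lambda>r. h (of_real r * \<sigma> k) / (1 - of_real r)) \<longlongrightarrow> \<beta> k) (at_left 1)"
    and c: "\<And>k. k < n \<Longrightarrow> 0 < atom_weight \<tau> (\<sigma> k) (\<Lambda> k)"
    and M: "\<And>k. k < n \<Longrightarrow> 0 < M k"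
    and e: "\<bar>e\<bar> * C < 1" "\<And>k. k < n \<Longrightarrow> 1 / (2 * M k) + \<bar>e\<bar> * cmod (\<beta> k) \<le> 1 / (2 * atom_weight \<tau> (\<sigma> k) (\<Lambda> k))"
  shows "bp_class \<tau> n \<sigma> \<Lambda> (\<lambda>z. p z + of_real e * h z)"
proof -
  define g where "g = (\<lambda>z. p z + of_real e * h z)"
  have hp: "p holomorphic_on unit_disk" and rp: "\<And>z. z \<in> unit_disk \<Longrightarrow> 0 < Re (p z)"
    using p by (auto simp: bp_class_def)
  have hg: "g holomorphic_on unit_disk" unfolding g_def by (intro holomorphic_intros hp h)
  have rg: "0 < Re (g z)" if z: "z \<in> unit_disk" for z
  proof -
    have "\<bar>e * Re (h z)\<bar> \<le> \<bar>e\<bar> * (C * Re (p z))"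
      unfolding abs_mult by (intro mult_left_mono h z) auto
    also have "\<dots> = (\<bar>e\<bar> * C) * Re (p z)" by simp
    also have "\<dots> < 1 * Re (p z)" using e(1) rp[OF z] by (intro mult_strict_right_mono)
    finally show ?thesis by (simp add: g_def)
  qed
  have "atom_weight \<tau> (\<sigma> k) (\<Lambda> k) * Re (kern (\<sigma> k) z) \<le> Re (1 / g z)" if k: "k < n" and z: "z \<in> unit_disk" for k z
  proof -
    define w where "w = atom_weight \<tau> (\<sigma> k) (\<Lambda> k)"
    have s: "cmod (\<sigma> k) = 1" using \<sigma> k by simp
    have "((\<lambda>r. p (of_real r * \<sigma> k) / (1 - of_real r) + of_real e * (h (of_real r * \<sigma> k) / (1 - of_real r)))
        \<longlongrightarrow> of_real (1 / (2 * M k)) + of_real e * \<beta> k) (at_left 1)"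
      by (intro tendsto_intros lim k)
    then have "((\<lambda>r. g (of_real r * \<sigma> k) / (1 - of_real r)) \<longlongrightarrow> of_real (1 / (2 * M k)) + of_real e * \<beta> k) (at_left 1)"
      by (simp add: g_def add_divide_distrib)
    then obtain M' where M': "M' > 0" "of_real (1 / (2 * M k)) + of_real e * \<beta> k = complex_of_real (1 / (2 * M'))"
      "\<And>z. z \<in> unit_disk \<Longrightarrow> M' * Re (kern (\<sigma> k) z) \<le> Re (1 / g z)"
      using reciprocal_atom[OF hg rg s] by blast
    have "1 / (2 * M') = cmod (complex_of_real (1 / (2 * M')))" unfolding norm_of_real using M'(1) by simp
    also have "\<dots> \<le> cmod (complex_of_real (1 / (2 * M k))) + cmod (of_real e * \<beta> k)"
      unfolding M'(2)[symmetric] by (rule norm_triangle_ineq)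
    also have "\<dots> = 1 / (2 * M k) + \<bar>e\<bar> * cmod (\<beta> k)" unfolding norm_mult norm_of_real using M[OF k] by simp
    also have "\<dots> \<le> 1 / (2 * w)" unfolding w_def by (rule e(2)[OF k])
    finally have "w \<le> M'" using M'(1) c[OF k] by (simp add: w_def field_simps)
    then have "w * Re (kern (\<sigma> k) z) \<le> M' * Re (kern (\<sigma> k) z)"
      using Re_kern_pos[OF s z] by (intro mult_right_mono) auto
    then show ?thesis using M'(3)[OF z] by (simp add: w_def)
  qed
  then show ?thesis using hg rg unfolding g_def by (simp add: bp_class_def)
qed

text \<open>\<open>p\<close> is the midpoint of \<open>p + e h\<close> and \<open>p - e h\<close>.
  Where the mass exceeds the weight there is room for any slope \<beta> k once \<open>e\<close> is
  small; where they agree the slope of \<open>p\<close> is already maximal, which is why \<beta> k =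
  0 is demanded. Finitely many conditions admit a common \<open>e\<close>.\<close>

lemma extreme_imp_no_perturbation:
  assumes ext: "extreme_pt G (Gen_FL \<tau> n \<sigma> \<Lambda>)"
    and p: "bp_class \<tau> n \<sigma> \<Lambda> p" and G: "\<And>z. z \<in> unit_disk \<Longrightarrow> G z = bp_factor \<tau> z * p z"
    and \<sigma>: "\<forall>k<n. \<sigma> k \<in> sphere 0 1" and \<Lambda>: "\<forall>k<n. \<Lambda> k < 0"
    and \<tau>: "\<tau> \<in> cball 0 1" "\<tau> \<notin> \<sigma> ` {..<n}"
    and h: "h holomorphic_on unit_disk" "\<And>z. z \<in> unit_disk \<Longrightarrow> \<bar>Re (h z)\<bar> \<le> C * Re (p z)"
    and lim: "\<And>k. k < n \<Longrightarrow> ((\<lambda>r. p (of_real r * \<sigma> k) / (1 - of_real r)) \<longlongrightarrow> of_real (1 / (2 * M k))) (at_left 1)"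
      "\<And>k. k < n \<Longrightarrow> ((\<lambda>r. h (of_real r * \<sigma> k) / (1 - of_real r)) \<longlongrightarrow> \<beta> k) (at_left 1)"
    and c: "\<And>k. k < n \<Longrightarrow> 0 < atom_weight \<tau> (\<sigma> k) (\<Lambda> k)"
    and M: "\<And>k. k < n \<Longrightarrow> atom_weight \<tau> (\<sigma> k) (\<Lambda> k) \<le> M k"
    and \<beta>: "\<And>k. k < n \<Longrightarrow> M k = atom_weight \<tau> (\<sigma> k) (\<Lambda> k) \<Longrightarrow> \<beta> k = 0"
    and z: "z \<in> unit_disk"
  shows "h z = 0"
proof -
  define w where "w = (\<lambda>k. atom_weight \<tau> (\<sigma> k) (\<Lambda> k))"
  have M0: "0 < M k" if "k < n" for k using c[OF that] M[OF that] by linarith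
  have ev1: "\<forall>\<^sub>F e in at_right (0::real). e * C < 1"
  proof (rule order_tendstoD(2))
    show "((\<lambda>e. e * C) \<longlongrightarrow> 0 * C) (at_right 0)" by (intro tendsto_intros)
  qed simp
  have "\<forall>\<^sub>F e in at_right (0::real). 1 / (2 * M k) + e * cmod (\<beta> k) \<le> 1 / (2 * w k)" if k: "k < n" for k
  proof (cases "M k = w k")
    case True
    then show ?thesis using \<beta>[OF k] by (simp add: w_def)
  next
    case False
    then have "w k < M k" using M[OF k] by (simp add: w_def)
    then have "1 / (2 * M k) < 1 / (2 * w k)" using c[OF k] by (simp add: w_def frac_less2)
    moreover have "((\<lambda>e. 1 / (2 * M k) + e * cmod (\<beta> k)) \<longlongrightarrow> 1 / (2 * M k) + 0 * cmod (\<beta> k)) (at_right 0)"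
      by (intro tendsto_intros)
    ultimately have "\<forall>\<^sub>F e in at_right (0::real). 1 / (2 * M k) + e * cmod (\<beta> k) < 1 / (2 * w k)"
      by (intro order_tendstoD(2)) auto
    then show ?thesis by eventually_elim simp
  qed
  then have "\<forall>\<^sub>F e in at_right (0::real). \<forall>k\<in>{..<n}. 1 / (2 * M k) + e * cmod (\<beta> k) \<le> 1 / (2 * w k)"
    by (intro eventually_ball_finite) auto
  with ev1 eventually_at_right_less[of 0]
  have "\<forall>\<^sub>F e in at_right (0::real). 0 < e \<and> e * C < 1 \<and> (\<forall>k<n. 1 / (2 * M k) + e * cmod (\<beta> k) \<le> 1 / (2 * w k))"
    by eventually_elim auto
  then obtain e :: real where e: "0 < e" "e * C < 1" "\<And>k. k < n \<Longrightarrow> 1 / (2 * M k) + e * cmod (\<beta> k) \<le> 1 / (2 * w k)"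
    using eventually_happens'[of "at_right (0::real)"] by auto
  define F where "F = (\<lambda>x z. if z \<in> unit_disk then bp_factor \<tau> z * (p z + complex_of_real x * h z) else 0)"
  have mem: "F x \<in> Gen_FL \<tau> n \<sigma> \<Lambda>" if "\<bar>x\<bar> = e" for x
  proof (rule bp_class_imp_generator[OF bp_class_perturb[OF p \<sigma> h lim c M0] \<sigma> \<Lambda> \<tau>])
    show "\<bar>x\<bar> * C < 1" using e that by simp
    show "1 / (2 * M k) + \<bar>x\<bar> * cmod (\<beta> k) \<le> 1 / (2 * atom_weight \<tau> (\<sigma> k) (\<Lambda> k))" if "k < n" for k
      using e(3)[OF that] \<open>\<bar>x\<bar> = e\<close> by (simp add: w_def)
  qed (auto simp: F_def)
  have off: "G z = 0" if "z \<notin> unit_disk" for z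
    using ext that unfolding extreme_pt_def Gen_FL_def by blast
  have "G = (\<lambda>z. of_real (1/2) * F e z + of_real (1 - 1/2) * F (- e) z)"
  proof
    fix z show "G z = of_real (1/2) * F e z + of_real (1 - 1/2) * F (- e) z"
      using G[of z] off[of z] by (cases "z \<in> unit_disk") (auto simp: F_def algebra_simps)
  qed
  moreover have "F e \<in> Gen_FL \<tau> n \<sigma> \<Lambda>" "F (- e) \<in> Gen_FL \<tau> n \<sigma> \<Lambda>" using e(1) by (auto intro!: mem)
  ultimately have FF: "F e = F (- e)"
    using ext unfolding extreme_pt_def by (metis zero_less_divide_1_iff zero_less_numeral half_gt_zero_iff field_sum_of_halves less_add_same_cancel1 zero_less_one)
  have t1: "cmod \<tau> \<le> 1" using \<tau> by simp
  have "h z = 0" if z: "z \<in> unit_disk" "z \<notin> {\<tau>}" for z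
  proof -
    have "bp_factor \<tau> z * (p z + of_real e * h z) = bp_factor \<tau> z * (p z + of_real (- e) * h z)"
      using fun_cong[OF FF, of z] z by (simp add: F_def)
    then have "p z + of_real e * h z = p z + of_real (- e) * h z"
      using bp_factor_nonzero[OF z(1) t1] z(2) by simp
    then show ?thesis using e(1) by simp
  qed
  \<comment> \<open>\<open>bp_factor\<close> vanishes at an interior \<tau>, so that point is
    reached by continuity.\<close>
  then show ?thesis
    using continuous_eq_off_finite[OF holomorphic_on_imp_continuous_on[OF h(1)] continuous_on_const[of _ 0], of "{\<tau>}" z] z by blast
qed

text \<open>The slope of T f + R at \<open>\<sigma> k\<close> is finite once R vanishes there: n
  equations. A second block of n asks for slope 0 outside \<open>X\<close> and for a zero of T on
  \<open>X\<close>, and one more for a zero of T at \<open>\<sigma> j\<close>, in all 2 n + 1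
  equations for 2 n + 2 real unknowns. On \<open>X\<close> a finite slope will be admissible, so the
  equation there is free to create a common zero of T and R.\<close>

lemma exists_constrained_trig:
  fixes \<sigma> :: "nat \<Rightarrow> complex" and \<alpha> :: "nat \<Rightarrow> real"
  assumes \<sigma>: "\<forall>k<n. cmod (\<sigma> k) = 1" and j: "j < n"
    and lim: "\<And>k. k < n \<Longrightarrow> ((\<lambda>r. f (of_real r * \<sigma> k) / (1 - of_real r)) \<longlongrightarrow> of_real (\<alpha> k)) (at_left 1)"
  obtains c \<beta> where "\<exists>k\<le>n. c k \<noteq> 0" "trig n c (\<sigma> j) = 0"
    "\<And>k. k \<in> X \<Longrightarrow> k < n \<Longrightarrow> trig n c (\<sigma> k) = 0"
    "\<And>k. k < n \<Longrightarrow> ((\<lambda>r. perturb n c f (of_real r * \<sigma> k) / (1 - of_real r)) \<longlongrightarrow> \<beta> k) (at_left 1)"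
    "\<And>k. k < n \<Longrightarrow> k \<notin> X \<Longrightarrow> \<beta> k = 0"
proof -
  define uT where "uT = (\<lambda>s k. 2 * s ^ k :: complex)"
  define uR where "uR = (\<lambda>s k. (if k = 0 then - \<i> else 0) - 2 * \<i> * (\<Sum>j<k. cnj (tcoeff f j) * s ^ (k - j)))"
  define uD where "uD = (\<lambda>s k. 2 * (\<Sum>j<k. of_nat (k - j) * cnj (tcoeff f j) * s ^ (k - j)))"
  define u where "u = (\<lambda>i k. if i < n then uR (\<sigma> i) k
     else if i < 2 * n then (if i - n \<in> X then uT (\<sigma> (i - n)) k else of_real (\<alpha> (i - n)) * uT (\<sigma> (i - n)) k - uD (\<sigma> (i - n)) k)
     else uT (\<sigma> j) k)"
  obtain c where c: "\<exists>k\<le>n. c k \<noteq> 0" "\<And>i. i < 2 * n + 1 \<Longrightarrow> (\<Sum>k\<le>n. Re (c k * u i k)) = 0"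
    using underdetermined_homogeneous_complex[of "2 * n + 1" n u] by auto
  have T: "trig n c s = of_real (\<Sum>k\<le>n. Re (c k * uT s k))" if "cmod s = 1" for s
    unfolding uT_def by (rule trig_circle[OF that])
  have R0: "trig_corr n c f (\<sigma> k) = 0" if k: "k < n" for k
  proof -
    have "cmod (\<sigma> k) = 1" using \<sigma> k by blast
    then have "trig_corr n c f (\<sigma> k) = \<i> * of_real (\<Sum>i\<le>n. Re (c i * uR (\<sigma> k) i))"
      unfolding uR_def by (rule trig_corr_circle)
    also have "(\<Sum>i\<le>n. Re (c i * uR (\<sigma> k) i)) = 0" using c(2)[of k] k by (simp add: u_def)
    finally show ?thesis by simp
  qed
  have Tj: "trig n c (\<sigma> j) = 0"
  proof -
    have "(\<Sum>i\<le>n. Re (c i * uT (\<sigma> j) i)) = 0" using c(2)[of "2 * n"] by (simp add: u_def)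
    moreover have "cmod (\<sigma> j) = 1" using \<sigma> j by blast
    ultimately show ?thesis by (simp only: T of_real_0)
  qed
  have TX: "trig n c (\<sigma> k) = 0" if "k \<in> X" "k < n" for k
  proof -
    have "(\<Sum>i\<le>n. Re (c i * uT (\<sigma> k) i)) = 0" using c(2)[of "n + k"] that by (simp add: u_def)
    moreover have "cmod (\<sigma> k) = 1" using \<sigma> that by blast
    ultimately show ?thesis by (simp only: T of_real_0)
  qed
  have "\<exists>\<beta>. ((\<lambda>r. perturb n c f (of_real r * \<sigma> k) / (1 - of_real r)) \<longlongrightarrow> \<beta>) (at_left 1) \<and> (k \<notin> X \<longrightarrow> \<beta> = 0)"
    if k: "k < n" for k
  proof -
    define s where "s = \<sigma> k"
    have s: "cmod s = 1" using \<sigma> k by (simp add: s_def)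
    have s0: "s \<noteq> 0" using s by auto
    \<comment> \<open>The slope of T f + R at \<open>s\<close>: the limit of T times the slope of
      \<open>f\<close>, plus the slope of R, which exists because R vanishes at
      \<open>s\<close>.\<close>
    define \<beta> where "\<beta> = trig n c s * of_real (\<alpha> k) + - of_real (\<Sum>i\<le>n. Re (c i * uD s i))"
    have "((\<lambda>z. trig n c z) \<longlongrightarrow> trig n c s) (at s within stolz s 2)"
      unfolding trig_def using s0 by (intro tendsto_intros) auto
    then have lT: "((\<lambda>r. trig n c (of_real r * s)) \<longlongrightarrow> trig n c s) (at_left 1)"
      by (rule filterlim_compose[OF _ filterlim_radial[OF s]]) simp
    have lR: "((\<lambda>r. trig_corr n c f (of_real r * s) / (1 - of_real r)) \<longlongrightarrow> - of_real (\<Sum>i\<le>n. Re (c i * uD s i))) (at_left 1)"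
      unfolding uD_def by (rule trig_corr_radial[OF s]) (use R0[OF k] in \<open>simp add: s_def\<close>)
    have "((\<lambda>r. trig n c (of_real r * s) * (f (of_real r * s) / (1 - of_real r)) + trig_corr n c f (of_real r * s) / (1 - of_real r)) \<longlongrightarrow> \<beta>) (at_left 1)"
      unfolding \<beta>_def by (intro tendsto_add tendsto_mult lT lR) (use lim[OF k] in \<open>simp add: s_def\<close>)
    moreover have "\<forall>\<^sub>F r in at_left (1::real). trig n c (of_real r * s) * (f (of_real r * s) / (1 - of_real r)) + trig_corr n c f (of_real r * s) / (1 - of_real r)
       = perturb n c f (of_real r * s) / (1 - of_real r)"
      using eventually_radial
    proof eventually_elim
      case (elim r)
      then have "of_real r * s \<noteq> 0" using s0 by simp
      then show ?case by (simp add: perturb_eq add_divide_distrib)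
    qed
    ultimately have "((\<lambda>r. perturb n c f (of_real r * s) / (1 - of_real r)) \<longlongrightarrow> \<beta>) (at_left 1)"
      by (rule Lim_transform_eventually)
    moreover have "\<beta> = 0" if "k \<notin> X"
    proof -
      have "0 = (\<Sum>i\<le>n. Re (c i * (of_real (\<alpha> k) * uT s i - uD s i)))"
        using c(2)[of "n + k"] k that by (simp add: u_def s_def)
      also have "\<dots> = \<alpha> k * (\<Sum>i\<le>n. Re (c i * uT s i)) - (\<Sum>i\<le>n. Re (c i * uD s i))"
        unfolding sum_distrib_left sum_subtractf[symmetric] by (intro sum.cong refl) (simp add: algebra_simps)
      finally have "(\<Sum>i\<le>n. Re (c i * uD s i)) = \<alpha> k * (\<Sum>i\<le>n. Re (c i * uT s i))" by simp
      then show ?thesis unfolding \<beta>_def T[OF s] by simp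
    qed
    ultimately show ?thesis unfolding s_def by blast
  qed
  then obtain \<beta> where \<beta>: "\<And>k. k < n \<Longrightarrow> ((\<lambda>r. perturb n c f (of_real r * \<sigma> k) / (1 - of_real r)) \<longlongrightarrow> \<beta> k) (at_left 1)"
    "\<And>k. k < n \<Longrightarrow> k \<notin> X \<Longrightarrow> \<beta> k = 0"
    by metis
  show thesis using that[OF c(1) Tj TX \<beta>] .
qed

section \<open>Rationality of \<open>p\<close> and the degree count\<close>

lemma vanishing_perturbation_polys:
  assumes p: "p holomorphic_on unit_disk" "\<And>z. z \<in> unit_disk \<Longrightarrow> perturb n c p z = 0" and z: "z \<in> unit_disk"
  shows "poly (trig_poly n c) z * p z = poly (- trig_corr_poly n c p) z"
proof (rule continuous_eq_off_finite[OF _ _ _ _ z, where S="{0}"])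
  show "continuous_on unit_disk (\<lambda>z. poly (trig_poly n c) z * p z)"
    by (intro continuous_intros holomorphic_on_imp_continuous_on[OF p(1)])
  show "continuous_on unit_disk (poly (- trig_corr_poly n c p))" by (intro continuous_intros)
  fix z :: complex assume z: "z \<in> unit_disk" "z \<notin> {0}"
  have "poly (trig_poly n c) z * p z + poly (trig_corr_poly n c p) z = z ^ n * perturb n c p z"
    using z by (simp add: poly_trig_poly poly_trig_corr_poly perturb_eq algebra_simps)
  then show "poly (trig_poly n c) z * p z = poly (- trig_corr_poly n c p) z"
    using p(2)[OF z(1)] by (simp add: add_eq_0_iff2)
qed simp

lemma trig_polys_imag_quot:
  assumes "cmod z = 1"
  shows "Re (poly (trig_poly n c) z * cnj (poly (trig_corr_poly n c f) z)) = 0"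
proof -
  have z0: "z \<noteq> 0" using assms by auto
  have "poly (trig_poly n c) z * cnj (poly (trig_corr_poly n c f) z) = (z ^ n * cnj (z ^ n)) * (trig n c z * cnj (trig_corr n c f z))"
    using z0 by (simp add: poly_trig_poly poly_trig_corr_poly mult_ac)
  also have "z ^ n * cnj (z ^ n) = of_real ((cmod (z ^ n))\<^sup>2)" by (simp only: complex_norm_square)
  finally show ?thesis unfolding trig_circle[OF assms] trig_corr_circle[OF assms] by simp
qed

lemma atom_weight_pos: "\<tau> \<noteq> s \<Longrightarrow> l \<noteq> 0 \<Longrightarrow> 0 < atom_weight \<tau> s l"
  by (simp add: atom_weight_def)

lemma p0_kern: "p0 n \<sigma> \<Lambda> \<tau> z = (\<Sum>k<n. of_real (atom_weight \<tau> (\<sigma> k) (\<Lambda> k)) * kern (\<sigma> k) z)"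
  by (simp add: p0_def atom_weight_def kern_def)

lemma prod_linear_kern:
  assumes "finite Z" "\<And>s. s \<in> Z \<Longrightarrow> s \<noteq> z"
  shows "poly (\<Prod>s\<in>Z. [:-s, 1:]) z * (\<Sum>s\<in>Z. of_real (c s) * kern s z)
     = poly (\<Sum>s\<in>Z. smult (- of_real (c s)) ([:s, 1:] * (\<Prod>t\<in>Z - {s}. [:-t, 1:]))) z"
  unfolding sum_distrib_left poly_sum
proof (intro sum.cong refl)
  fix s assume s: "s \<in> Z"
  have "(\<Prod>s\<in>Z. [:-s, 1:]) = [:-s, 1:] * (\<Prod>t\<in>Z - {s}. [:-t, 1:])"
    by (rule prod.remove[OF assms(1) s])
  then have "poly (\<Prod>s\<in>Z. [:-s, 1:]) z = (z - s) * poly (\<Prod>t\<in>Z - {s}. [:-t, 1:]) z"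
    by (simp only: poly_linear_mult)
  moreover have "(z - s) * kern s z = - (s + z)"
    using assms(2)[OF s] by (simp add: kern_def field_simps)
  ultimately have "poly (\<Prod>s\<in>Z. [:-s, 1:]) z * (of_real (c s) * kern s z) = of_real (c s) * (- (s + z)) * poly (\<Prod>t\<in>Z - {s}. [:-t, 1:]) z"
    by (metis (no_types, lifting) mult.assoc mult.commute)
  moreover have "poly (smult (- of_real (c s)) ([:s, 1:] * R)) z = of_real (c s) * (- (s + z)) * poly R z" for R
    by (simp add: algebra_simps)
  ultimately show "poly (\<Prod>s\<in>Z. [:-s, 1:]) z * (of_real (c s) * kern s z)
     = poly (smult (- of_real (c s)) ([:s, 1:] * (\<Prod>t\<in>Z - {s}. [:-t, 1:]))) z"
    by (simp only:)
qed

lemma poly_eq_0_of_disk: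
  assumes "\<And>z. z \<in> unit_disk \<Longrightarrow> poly P z = (0::complex)"
  shows "P = 0"
proof (rule ccontr)
  assume "P \<noteq> 0"
  then have "finite unit_disk" using assms by (intro finite_subset[OF _ poly_roots_finite]) auto
  then show False using finite_imp_not_open[of unit_disk] by simp
qed

lemma prod_linear_nonzero: "finite Z \<Longrightarrow> (\<Prod>s\<in>Z. [:-s, 1:] :: complex poly) \<noteq> 0"
  by (simp add: prod_zero_iff)

text \<open>T p + R = 0 gives p = - B / A with A = z^n T and B = z^n R. At the card X + 1 prescribed
  zeros of \<open>A\<close> also \<open>B\<close> vanishes, since \<open>p\<close> tends to 0 there;
  after cancelling, the remaining numerator still vanishes at all n points \<open>\<sigma> k\<close>
  for the same reason. So 2 n \<ge> (card X + 1) + n + degree B2.\<close>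

lemma rational_of_vanishing_perturbation:
  assumes \<sigma>: "inj_on \<sigma> {..<n}" "\<forall>k<n. cmod (\<sigma> k) = 1" and j: "j < n" "j \<notin> X" and X: "X \<subseteq> {..<n}"
    and p: "p holomorphic_on unit_disk" "\<And>z. z \<in> unit_disk \<Longrightarrow> p z \<noteq> 0"
    and lim: "\<And>k. k < n \<Longrightarrow> ((\<lambda>r. p (of_real r * \<sigma> k) / (1 - of_real r)) \<longlongrightarrow> of_real (\<alpha> k)) (at_left 1)"
    and c: "\<exists>k\<le>n. c k \<noteq> 0" "\<And>z. z \<in> unit_disk \<Longrightarrow> perturb n c p z = 0"
    and T: "trig n c (\<sigma> j) = 0" "\<And>k. k \<in> X \<Longrightarrow> trig n c (\<sigma> k) = 0"
  obtains A1 B2 where "B2 \<noteq> 0" "degree B2 + card X \<le> n - 1"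
    "\<And>z. z \<in> unit_disk \<Longrightarrow> poly A1 z * p z = poly ((\<Prod>s\<in>\<sigma> ` {..<n}. [:-s, 1:]) * B2) z"
    "imag_quot A1 ((\<Prod>s\<in>\<sigma> ` {..<n}. [:-s, 1:]) * B2)"
proof -
  define A B where "A = trig_poly n c" and "B = trig_corr_poly n c p"
  define Y where "Y = \<sigma> ` insert j X"
  define Z where "Z = \<sigma> ` {..<n}"
  have fin: "finite X" "finite Y" "finite Z" using X finite_subset by (auto simp: Y_def Z_def)
  have YZ: "Y \<subseteq> Z" using j X by (auto simp: Y_def Z_def)
  have Z1: "cmod s = 1" if "s \<in> Z" for s using that \<sigma> by (auto simp: Z_def)
  have cY: "card Y = Suc (card X)"
    unfolding Y_def using j X fin inj_on_subset[OF \<sigma>(1), of "insert j X"] by (subst card_image) auto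
  have cZ: "card Z = n" unfolding Z_def using \<sigma>(1) by (simp add: card_image)
  have pc: "continuous_on unit_disk p" by (rule holomorphic_on_imp_continuous_on[OF p(1)])
  have eq: "poly A z * p z = poly (- B) z" if "z \<in> unit_disk" for z
    unfolding A_def B_def by (rule vanishing_perturbation_polys[OF p(1) c(2) that])
  \<comment> \<open>\<open>p\<close> has no zeros, so B = 0 would force A = 0, and both cannot
    vanish for nontrivial \<open>c\<close>.\<close>
  have B0: "B \<noteq> 0"
  proof
    assume "B = 0"
    then have "A = 0" using eq p(2) by (intro poly_eq_0_of_disk) auto
    then show False using trig_polys_nonzero[OF c(1), of p] \<open>B = 0\<close> by (simp add: A_def B_def)
  qed
  have "poly A s = 0" if "s \<in> Y" for s
  proof -
    have "cmod s = 1" using that YZ Z1 by blast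
    then have "s \<noteq> 0" by auto
    moreover have "trig n c s = 0" using that T by (auto simp: Y_def)
    ultimately show ?thesis by (simp add: A_def poly_trig_poly)
  qed
  then obtain A1 where A1: "A = (\<Prod>s\<in>Y. [:-s, 1:]) * A1"
    using prod_linear_factors_dvd[OF fin(2)] by (metis dvdE)
  have p0: "((\<lambda>r. p (of_real r * s)) \<longlongrightarrow> 0) (at_left 1)" if s: "s \<in> Z" for s
  proof -
    obtain k where k: "k < n" "s = \<sigma> k" using s by (auto simp: Z_def)
    have "((\<lambda>r. (1 - of_real r) * (p (of_real r * \<sigma> k) / (1 - of_real r))) \<longlongrightarrow> (1 - of_real 1) * of_real (\<alpha> k)) (at_left 1)"
      by (intro tendsto_intros lim k)
    moreover have "\<forall>\<^sub>F r in at_left (1::real). (1 - of_real r) * (p (of_real r * \<sigma> k) / (1 - of_real r)) = p (of_real r * \<sigma> k)"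
      using eventually_radial by eventually_elim (use one_minus_of_real_nonzero in auto)
    ultimately have "((\<lambda>r. p (of_real r * \<sigma> k)) \<longlongrightarrow> (1 - of_real 1) * of_real (\<alpha> k)) (at_left 1)"
      by (rule Lim_transform_eventually)
    then show ?thesis by (simp add: k)
  qed
  obtain V1 where V1: "- B = (\<Prod>s\<in>Y. [:-s, 1:]) * V1" "\<And>z. z \<in> unit_disk \<Longrightarrow> poly A1 z * p z = poly V1 z"
  proof (rule poly_roots_of_no_atoms[OF fin(2) _ pc])
    show "cmod s = 1" if "s \<in> Y" for s using that YZ Z1 by blast
    show "poly ((\<Prod>s\<in>Y. [:-s, 1:]) * A1) z * p z = poly (- B) z" if "z \<in> unit_disk" for z
      using eq[OF that] A1 by simp
    show "((\<lambda>r. (1 - cnj s * (of_real r * s)) * p (of_real r * s)) \<longlongrightarrow> 0) (at_left 1)" if s: "s \<in> Y" for s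
    proof -
      have "s \<in> Z" using s YZ by blast
      then have "((\<lambda>r. (1 - cnj s * (of_real r * s)) * p (of_real r * s)) \<longlongrightarrow> (1 - cnj s * (of_real 1 * s)) * 0) (at_left 1)"
        by (intro tendsto_intros p0)
      then show ?thesis by simp
    qed
  qed blast
  have "poly V1 s = 0" if s: "s \<in> Z" for s
  proof -
    have "((\<lambda>r. poly A1 (of_real r * s) * p (of_real r * s)) \<longlongrightarrow> poly A1 (of_real 1 * s) * 0) (at_left 1)"
      by (intro tendsto_intros p0 s)
    moreover have "\<forall>\<^sub>F r in at_left (1::real). poly A1 (of_real r * s) * p (of_real r * s) = poly V1 (of_real r * s)"
      using eventually_radial by eventually_elim (use V1(2) radial_in_disk[OF Z1[OF s]] in blast)
    ultimately have "((\<lambda>r. poly V1 (of_real r * s)) \<longlongrightarrow> poly A1 (of_real 1 * s) * 0) (at_left 1)"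
      by (rule Lim_transform_eventually)
    moreover have "((\<lambda>r. poly V1 (of_real r * s)) \<longlongrightarrow> poly V1 (of_real 1 * s)) (at_left 1)" by (intro tendsto_intros)
    ultimately have "poly V1 (of_real 1 * s) = poly A1 (of_real 1 * s) * 0"
      by (intro tendsto_unique[OF trivial_limit_at_left_real])
    then show ?thesis by simp
  qed
  then obtain B2 where B2: "V1 = (\<Prod>s\<in>Z. [:-s, 1:]) * B2"
    using prod_linear_factors_dvd[OF fin(3)] by (metis dvdE)
  have n0: "V1 \<noteq> 0" "B2 \<noteq> 0" using B0 V1(1) B2 by auto
  have "degree (- B) = card Y + (card Z + degree B2)"
    unfolding V1(1) B2 using n0 fin prod_linear_nonzero
    by (subst degree_mult_eq, simp, simp add: B2)+ (simp add: degree_prod_linear_factors)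
  moreover have "degree B \<le> 2 * n" unfolding B_def by (rule degree_trig_corr_poly)
  ultimately have deg: "degree B2 + card X \<le> n - 1" by (simp add: cY cZ)
  have "imag_quot A1 V1"
  proof (rule imag_quotI[OF fin(2)])
    fix z assume z: "cmod z = 1" "z \<notin> Y"
    define D where "D = poly (\<Prod>s\<in>Y. [:-s, 1:]) z"
    have D: "D \<noteq> 0" unfolding D_def poly_prod using z fin(2) by (simp add: prod_zero_iff)
    have "poly A z * cnj (poly B z) = - ((D * cnj D) * (poly A1 z * cnj (poly V1 z)))"
    proof -
      have "poly A z = D * poly A1 z" unfolding A1 D_def by simp
      moreover have "- poly B z = D * poly V1 z" using arg_cong[OF V1(1), of "\<lambda>P. poly P z"] by (simp add: D_def)
      then have "poly B z = - (D * poly V1 z)" by (metis minus_minus)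
      ultimately show ?thesis by (simp add: mult_ac)
    qed
    also have "D * cnj D = of_real ((cmod D)\<^sup>2)" by (simp only: complex_norm_square)
    finally have "(cmod D)\<^sup>2 * Re (poly A1 z * cnj (poly V1 z)) = 0"
      using trig_polys_imag_quot[OF z(1), of n c p] by (simp add: A_def B_def)
    then show "Re (poly A1 z * cnj (poly V1 z)) = 0" using D by simp
  qed
  then show thesis using that[OF n0(2) deg] V1(2) unfolding B2 Z_def by blast
qed

text \<open>The denominator of \<open>1 / p\<close> is the product of all linear factors times
  \<open>B2\<close>. For k outside \<open>X\<close> subtracting \<open>p0\<close> removes the whole
  atom, so its factor cancels; for k in \<open>X\<close> the excess mass remains and so does the
  factor. The surviving degree is card X + degree B2 \<le> n - 1, and
  \<open>herglotz_rational\<close> turns it into a number of atoms, some of which may sit at points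
  of F.\<close>

lemma reciprocal_minus_p0_atoms:
  assumes \<sigma>: "inj_on \<sigma> {..<n}" "\<forall>k<n. cmod (\<sigma> k) = 1" and X: "X \<subseteq> {..<n}"
    and p: "p holomorphic_on unit_disk" "\<And>z. z \<in> unit_disk \<Longrightarrow> 0 < Re (p z)"
    and M: "\<And>k. k < n \<Longrightarrow> atom_weight \<tau> (\<sigma> k) (\<Lambda> k) \<le> M k"
      "\<And>k. k < n \<Longrightarrow> k \<notin> X \<Longrightarrow> M k = atom_weight \<tau> (\<sigma> k) (\<Lambda> k)"
    and lim: "\<And>k. k < n \<Longrightarrow> ((\<lambda>r. (1 - cnj (\<sigma> k) * (of_real r * \<sigma> k)) * (1 / p (of_real r * \<sigma> k))) \<longlongrightarrow> 2 * of_real (M k)) (at_left 1)"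
    and B2: "B2 \<noteq> 0" "degree B2 + card X \<le> n - 1"
    and A1: "\<And>z. z \<in> unit_disk \<Longrightarrow> poly A1 z * p z = poly ((\<Prod>s\<in>\<sigma> ` {..<n}. [:-s, 1:]) * B2) z"
      "imag_quot A1 ((\<Prod>s\<in>\<sigma> ` {..<n}. [:-s, 1:]) * B2)"
  shows "herglotz_atoms (n - 1) (\<lambda>z. 1 / p z - p0 n \<sigma> \<Lambda> \<tau> z)"
proof -
  define Z where "Z = \<sigma> ` {..<n}"
  \<comment> \<open>Products of linear factors run over points while weights are indexed by
    \<open>k\<close>; injectivity leads back from a point to its index.\<close>
  define \<kappa> where "\<kappa> = the_inv_into {..<n} \<sigma>"
  have \<kappa>: "\<kappa> (\<sigma> k) = k" if "k < n" for k unfolding \<kappa>_def using \<sigma>(1) that by (simp add: the_inv_into_f_f)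
  define w where "w = (\<lambda>s. atom_weight \<tau> (\<sigma> (\<kappa> s)) (\<Lambda> (\<kappa> s)))"
  define q0 where "q0 = (\<lambda>z. 1 / p z - (\<Sum>s\<in>Z. of_real (w s) * kern s z))"
  have q0: "1 / p z - p0 n \<sigma> \<Lambda> \<tau> z = q0 z" for z
    unfolding q0_def p0_kern Z_def sum.reindex[OF \<sigma>(1)] by (simp add: w_def \<kappa>)
  have finX: "finite X" using X finite_subset by blast
  have fin: "finite Z" by (simp add: Z_def)
  have Z1: "cmod s = 1" if "s \<in> Z" for s using that \<sigma> by (auto simp: Z_def)
  have pn: "p z \<noteq> 0" if "z \<in> unit_disk" for z using p(2)[OF that] by auto
  have hq: "(\<lambda>z. 1 / p z) holomorphic_on unit_disk" using pn by (intro holomorphic_intros p)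
  have hq0: "q0 holomorphic_on unit_disk" unfolding q0_def using Z1 by (intro holomorphic_intros hq)
  have re: "0 \<le> Re (q0 z)" if z: "z \<in> unit_disk" for z
    unfolding q0_def
  proof (rule subtract_atoms[OF fin hq, where m="\<lambda>s. M (\<kappa> s)"])
    show "0 \<le> Re (1 / p z)" if "z \<in> unit_disk" for z using p(2)[OF that] by (simp add: Re_divide_alt)
    show "((\<lambda>r. (1 - cnj s * (of_real r * s)) * (1 / p (of_real r * s))) \<longlongrightarrow> 2 * of_real (M (\<kappa> s))) (at_left 1)" if "s \<in> Z" for s
      using that lim \<kappa> by (auto simp: Z_def)
    show "w s \<le> M (\<kappa> s)" if "s \<in> Z" for s using that M(1) \<kappa> by (auto simp: Z_def w_def)
  qed (use Z1 z in auto)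
  have no_atom: "((\<lambda>r. (1 - cnj s * (of_real r * s)) * q0 (of_real r * s)) \<longlongrightarrow> 0) (at_left 1)"
    if s: "s \<in> \<sigma> ` ({..<n} - X)" for s
  proof -
    obtain k where k: "k < n" "k \<notin> X" "s = \<sigma> k" using s by auto
    have sZ: "s \<in> Z" using k by (auto simp: Z_def)
    have "((\<lambda>r. (1 - cnj s * (of_real r * s)) * (1 / p (of_real r * s)) - (\<Sum>t\<in>Z. of_real (w t) * ((1 - cnj s * (of_real r * s)) * kern t (of_real r * s))))
      \<longlongrightarrow> 2 * of_real (M k) - (\<Sum>t\<in>Z. of_real (w t) * (if t = s then 2 else 0))) (at_left 1)"
      using lim[OF k(1)] Z1 sZ unfolding k(3)
      by (intro tendsto_diff tendsto_sum tendsto_mult[OF tendsto_const] kern_radial) auto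
    moreover have "(\<Sum>t\<in>Z. of_real (w t) * (if t = s then 2 else 0)) = (2 * of_real (w s) :: complex)"
      using sZ fin by (simp add: if_distrib[of "\<lambda>x. _ * x"] sum.delta' cong: if_cong)
    moreover have "w s = M k" using M(2)[OF k(1,2)] \<kappa>[OF k(1)] by (simp add: w_def k(3))
    ultimately have "((\<lambda>r. (1 - cnj s * (of_real r * s)) * (1 / p (of_real r * s)) - (\<Sum>t\<in>Z. of_real (w t) * ((1 - cnj s * (of_real r * s)) * kern t (of_real r * s)))) \<longlongrightarrow> 0) (at_left 1)"
      by simp
    then show ?thesis
      unfolding q0_def right_diff_distrib sum_distrib_left by (simp only: mult.left_commute)
  qed
  define V1 where "V1 = (\<Prod>s\<in>Z. [:-s, 1:]) * B2"
  \<comment> \<open>The numerator of \<open>p0\<close> over the product of the linear factors. Thus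
    \<open>V0\<close> is the numerator of 1 / p - p0 over the denominator \<open>V1\<close>.\<close>
  define P where "P = (\<Sum>s\<in>Z. smult (- of_real (w s)) ([:s, 1:] * (\<Prod>t\<in>Z - {s}. [:-t, 1:])))"
  define V0 where "V0 = A1 - P * B2"
  have PB: "poly (P * B2) z = poly V1 z * (\<Sum>s\<in>Z. of_real (w s) * kern s z)" if "z \<notin> Z" for z
  proof -
    have "poly P z = poly (\<Prod>s\<in>Z. [:-s, 1:]) z * (\<Sum>s\<in>Z. of_real (w s) * kern s z)"
      unfolding P_def by (rule prod_linear_kern[OF fin, symmetric]) (use that in auto)
    then show ?thesis by (simp add: V1_def)
  qed
  have V0: "poly V1 z * q0 z = poly V0 z" if z: "z \<in> unit_disk" for z
  proof -
    have "z \<notin> Z" using z Z1 by fastforce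
    moreover have "poly V1 z * (1 / p z) = poly A1 z"
      using A1(1)[OF z] pn[OF z] by (simp add: V1_def Z_def nonzero_divide_eq_eq flip: A1(1)[OF z])
    ultimately show ?thesis by (simp add: q0_def V0_def right_diff_distrib PB del: poly_mult)
  qed
  have "imag_quot V0 V1"
  proof (rule imag_quotI[OF fin])
    fix z assume z: "cmod z = 1" "z \<notin> Z"
    define S where "S = (\<Sum>s\<in>Z. of_real (w s) * kern s z)"
    have "Re (kern s z) = 0" if "s \<in> Z" for s using Re_kern[OF Z1[OF that], of z] z by simp
    then have S: "Re S = 0" by (simp add: S_def)
    have "poly V0 z * cnj (poly V1 z) = poly A1 z * cnj (poly V1 z) - S * (poly V1 z * cnj (poly V1 z))"
    proof -
      have e: "poly V0 z = poly A1 z - poly V1 z * S"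
        unfolding V0_def poly_diff PB[OF z(2)] S_def ..
      show ?thesis unfolding e by (simp add: algebra_simps)
    qed
    also have "poly V1 z * cnj (poly V1 z) = of_real ((cmod (poly V1 z))\<^sup>2)" by (simp only: complex_norm_square)
    finally show "Re (poly V0 z * cnj (poly V1 z)) = 0"
      using S imag_quot_circle[OF A1(2) z(1)] by (simp add: V1_def Z_def)
  qed
  define W where "W = (\<Prod>s\<in>\<sigma> ` X. [:-s, 1:]) * B2"
  define Z' where "Z' = \<sigma> ` ({..<n} - X)"
  have ZZ: "Z = Z' \<union> \<sigma> ` X" "Z' \<inter> \<sigma> ` X = {}"
    using X \<sigma>(1) by (auto simp: Z_def Z'_def inj_on_def)
  have VW: "V1 = (\<Prod>s\<in>Z'. [:-s, 1:]) * W"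
    unfolding V1_def W_def ZZ(1) using finX ZZ(2)
    by (subst prod.union_disjoint) (auto simp: Z'_def mult.assoc)
  obtain V2 where V2: "V0 = (\<Prod>s\<in>Z'. [:-s, 1:]) * V2" "\<And>z. z \<in> unit_disk \<Longrightarrow> poly W z * q0 z = poly V2 z"
  proof (rule poly_roots_of_no_atoms)
    show "finite Z'" by (simp add: Z'_def)
    show "cmod s = 1" if "s \<in> Z'" for s using that Z1 ZZ by blast
    show "continuous_on unit_disk q0" by (rule holomorphic_on_imp_continuous_on[OF hq0])
    show "poly ((\<Prod>s\<in>Z'. [:-s, 1:]) * W) z * q0 z = poly V0 z" if "z \<in> unit_disk" for z
      using V0[OF that] unfolding VW .
    show "((\<lambda>r. (1 - cnj s * (of_real r * s)) * q0 (of_real r * s)) \<longlongrightarrow> 0) (at_left 1)" if "s \<in> Z'" for s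
      using no_atom that by (simp add: Z'_def)
  qed blast
  have W0: "W \<noteq> 0" unfolding W_def using B2(1) prod_linear_nonzero[of "\<sigma> ` X"] finX by simp
  have "imag_quot V2 W"
    using \<open>imag_quot V0 V1\<close> unfolding V2 VW by (rule imag_quot_cancel_prod[rotated]) (simp add: Z'_def)
  then have "herglotz_atoms (degree W) q0"
    using herglotz_rational[OF hq0 re W0 V2(2)] by blast
  moreover have "degree W \<le> n - 1"
  proof -
    have "degree W \<le> degree (\<Prod>s\<in>\<sigma> ` X. [:-s, 1:]) + degree B2" unfolding W_def by (rule degree_mult_le)
    also have "\<dots> = card (\<sigma> ` X) + degree B2" by (simp only: degree_prod_linear_factors)
    also have "\<dots> \<le> n - 1" using card_image_le[OF finX, of \<sigma>] B2(2) by linarith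
    finally show ?thesis .
  qed
  ultimately have "herglotz_atoms (n - 1) q0" by (rule herglotz_atoms_mono)
  then show ?thesis unfolding q0 .
qed

theorem theorem6p12:
  fixes n :: nat and \<sigma> :: "nat \<Rightarrow> complex" and \<Lambda> :: "nat \<Rightarrow> real"
    and \<tau> :: complex and G :: "complex \<Rightarrow> complex"
  assumes "n \<ge> 1"
    and "inj_on \<sigma> {..<n}"
    and "\<forall>k<n. \<sigma> k \<in> sphere 0 1"
    and "\<forall>k<n. \<Lambda> k < 0"
    and "\<tau> \<in> cball 0 1" and "\<tau> \<notin> \<sigma> ` {..<n}"
    and "extreme_pt G (Gen_FL \<tau> n \<sigma> \<Lambda>)"
    and "\<exists>z. G z \<noteq> 0"
  shows "\<exists>s a b. (\<forall>j<n-1. s j \<in> sphere 0 1 \<and> (a j :: real) \<ge> 0) \<and>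
     (\<forall>z\<in>unit_disk. G z = (\<tau> - z) * (1 - cnj \<tau> * z) /
        (\<i> * of_real (b::real) + (\<Sum>j<n-1. of_real (a j) * ((s j + z) / (s j - z))) + p0 n \<sigma> \<Lambda> \<tau> z))"
proof -
  note \<sigma> = assms(3) and \<Lambda> = assms(4) and \<tau> = assms(5,6) and ext = assms(7)
  have "G \<in> Gen_FL \<tau> n \<sigma> \<Lambda>" using ext by (simp add: extreme_pt_def)
  then obtain p where bp: "bp_class \<tau> n \<sigma> \<Lambda> p" and G: "\<And>z. z \<in> unit_disk \<Longrightarrow> G z = bp_factor \<tau> z * p z"
    using generator_imp_bp_class[OF assms(1) \<sigma> \<tau> _ assms(8)] by blast
  have hp: "p holomorphic_on unit_disk" and rp: "\<And>z. z \<in> unit_disk \<Longrightarrow> 0 < Re (p z)"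
    using bp by (auto simp: bp_class_def)
  have pn: "p z \<noteq> 0" if "z \<in> unit_disk" for z using rp[OF that] by auto
  have s1: "cmod (\<sigma> k) = 1" if "k < n" for k using \<sigma> that by simp
  then have s1': "\<forall>k<n. cmod (\<sigma> k) = 1" by blast
  define w where "w = (\<lambda>k. atom_weight \<tau> (\<sigma> k) (\<Lambda> k))"
  have w0: "0 < w k" if "k < n" for k
    unfolding w_def using \<tau>(2) \<Lambda> that by (intro atom_weight_pos) auto
  have "\<forall>k. \<exists>M. k < n \<longrightarrow> w k \<le> M \<and> angular_limit (\<lambda>z. (1 - cnj (\<sigma> k) * z) * (1 / p z)) (\<sigma> k) (2 * of_real M)"
    unfolding w_def using bp_class_atom[OF bp \<sigma>] by metis
  then obtain M where M: "\<And>k. k < n \<Longrightarrow> w k \<le> M k"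
    "\<And>k. k < n \<Longrightarrow> angular_limit (\<lambda>z. (1 - cnj (\<sigma> k) * z) * (1 / p z)) (\<sigma> k) (2 * of_real (M k))"
    by metis
  have limq: "((\<lambda>r. (1 - cnj (\<sigma> k) * (of_real r * \<sigma> k)) * (1 / p (of_real r * \<sigma> k))) \<longlongrightarrow> 2 * of_real (M k)) (at_left 1)"
    if "k < n" for k
    by (rule angular_limit_radial[OF M(2)[OF that] s1[OF that]])
  have limp: "((\<lambda>r. p (of_real r * \<sigma> k) / (1 - of_real r)) \<longlongrightarrow> of_real (1 / (2 * M k))) (at_left 1)" if k: "k < n" for k
  proof -
    have "2 * complex_of_real (M k) \<noteq> 0" using w0[OF k] M(1)[OF k] by simp
    then have "((\<lambda>r. inverse ((1 - cnj (\<sigma> k) * (of_real r * \<sigma> k)) * (1 / p (of_real r * \<sigma> k)))) \<longlongrightarrow> inverse (2 * of_real (M k))) (at_left 1)"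
      by (rule tendsto_inverse[OF limq[OF k]])
    then show ?thesis by (simp add: cnj_radial[OF s1[OF k]] divide_simps)
  qed
  \<comment> \<open>The points whose atom is strictly heavier than required; there both signs of a
    small perturbation have room.\<close>
  define X where "X = {k. k < n \<and> M k \<noteq> w k}"
  have XX: "X \<subseteq> {..<n}" by (auto simp: X_def)
  \<comment> \<open>If no atom were minimal, then h = p itself would be an admissible direction,
    with C = 1 and its own slopes, and extremality would give p = 0. The minimal atom found here
    carries the additional zero of T that lowers the count from n to n - 1.\<close>
  obtain j where j: "j < n" "j \<notin> X"
  proof (rule ccontr)
    assume "\<not> thesis"
    then have all: "M k \<noteq> w k" if "k < n" for k using that \<open>\<And>j. j < n \<Longrightarrow> j \<notin> X \<Longrightarrow> thesis\<close> by (auto simp: X_def)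
    have "p 0 = 0"
      by (rule extreme_imp_no_perturbation[OF ext bp G \<sigma> \<Lambda> \<tau> hp _ limp limp, where C=1])
         (use rp w0 M(1) all in \<open>auto simp: w_def less_imp_le\<close>)
    then show False using pn[of 0] by simp
  qed
  obtain c \<beta> where c: "\<exists>k\<le>n. c k \<noteq> 0" "trig n c (\<sigma> j) = 0" "\<And>k. k \<in> X \<Longrightarrow> k < n \<Longrightarrow> trig n c (\<sigma> k) = 0"
    and \<beta>: "\<And>k. k < n \<Longrightarrow> ((\<lambda>r. perturb n c p (of_real r * \<sigma> k) / (1 - of_real r)) \<longlongrightarrow> \<beta> k) (at_left 1)"
    "\<And>k. k < n \<Longrightarrow> k \<notin> X \<Longrightarrow> \<beta> k = 0"
    by (rule exists_constrained_trig[OF s1' j(1) limp, where X=X]) (assumption | rule that)+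
  \<comment> \<open>Outside \<open>X\<close> the slopes vanish by construction, and on
    \<open>X\<close> the masses have room, so \<open>perturb n c p\<close> is an admissible
    direction.\<close>
  have zero: "perturb n c p z = 0" if z: "z \<in> unit_disk" for z
  proof (rule extreme_imp_no_perturbation[OF ext bp G \<sigma> \<Lambda> \<tau> perturb_holomorphic[OF hp] _ limp \<beta>(1) _ _ _ z])
    show "\<bar>Re (perturb n c p z)\<bar> \<le> 2 * (\<Sum>k\<le>n. cmod (c k)) * Re (p z)" if "z \<in> unit_disk" for z
      using perturb_bound[OF hp _ that] rp less_imp_le by blast
  qed (use w0 M(1) \<beta>(2) in \<open>auto simp: w_def X_def\<close>)
  have c3: "trig n c (\<sigma> k) = 0" if "k \<in> X" for k using c(3) that XX by blast
  obtain A1 B2 where AB: "B2 \<noteq> 0" "degree B2 + card X \<le> n - 1"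
    "\<And>z. z \<in> unit_disk \<Longrightarrow> poly A1 z * p z = poly ((\<Prod>s\<in>\<sigma> ` {..<n}. [:-s, 1:]) * B2) z"
    "imag_quot A1 ((\<Prod>s\<in>\<sigma> ` {..<n}. [:-s, 1:]) * B2)"
    by (rule rational_of_vanishing_perturbation[OF assms(2) s1' j XX hp pn limp c(1) zero c(2) c3])
       (assumption | rule that)+
  have "herglotz_atoms (n - 1) (\<lambda>z. 1 / p z - p0 n \<sigma> \<Lambda> \<tau> z)"
    by (rule reciprocal_minus_p0_atoms[OF assms(2) _ XX hp rp _ _ limq AB])
       (use s1 M(1) in \<open>auto simp: w_def X_def\<close>)
  then obtain s a b where sab: "\<forall>j<n-1. s j \<in> sphere 0 1 \<and> (a j :: real) \<ge> 0"
    "\<And>z. z \<in> unit_disk \<Longrightarrow> 1 / p z - p0 n \<sigma> \<Lambda> \<tau> z = \<i> * of_real (b::real) + (\<Sum>j<n-1. of_real (a j) * kern (s j) z)"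
    unfolding herglotz_atoms_def by blast
  have "G z = (\<tau> - z) * (1 - cnj \<tau> * z) /
        (\<i> * of_real b + (\<Sum>j<n-1. of_real (a j) * ((s j + z) / (s j - z))) + p0 n \<sigma> \<Lambda> \<tau> z)" if z: "z \<in> unit_disk" for z
  proof -
    have "\<i> * of_real b + (\<Sum>j<n-1. of_real (a j) * ((s j + z) / (s j - z))) + p0 n \<sigma> \<Lambda> \<tau> z = 1 / p z"
      using sab(2)[OF z, symmetric] by (simp add: kern_def)
    then show ?thesis using G[OF z] by (simp add: bp_factor_def)
  qed
  with sab(1) show ?thesis by blast
qed

end
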